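(* Let $\mathcal{M}\subset\mathbb{R}^n$ be a locally symmetric $C^2$ submanifold of dimension $d$ such that there exist $y\in\mathcal{M}$ and $\rho>0$ for which every point of $\mathcal{M}\cap B(y,\rho)$ has pairwise distinct coordinates (i.e. the characteristic permutation of $\mathcal{M}$ is the identity). Let $\bar x\in\mathcal{M}\cap\mathbb{R}^n_{\ge}\cap\Delta(\sigma)$ for some $\sigma\in\Sigma^n$. Then $\lambda_\sigma^{-1}(\mathcal{M})=\{X_\sigma\in\mathbf{S}^n_\sigma:\lambda_\sigma(X_\sigma)\in\mathcal{M}\}$ is a $C^2$ submanifold of $\mathbf{S}^n_\sigma$ around any $\bar X_\sigma$ with $\lambda_\sigma(\bar X_\sigma)=\bar x$, and its codimension in $\mathbf{S}^n_\sigma$ is $n-d$.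
   Context: $\Sigma^n$ permutations of $\mathbb{N}_n$ acting by $(\sigma x)_i=x_{\sigma^{-1}(i)}$; $P(\sigma)$ partition into orbits of $\sigma$; $P(x)$ partition by equal coordinates; $\Delta(\sigma)=\{x:P(x)=P(\sigma)\}$; $\mathbb{R}^n_{\ge}=\{x:x_1\ge\cdots\ge x_n\}$; $B(x,\delta)$ open ball. A set $S$ is locally symmetric if $S\cap\mathbb{R}^n_\ge\neq\emptyset$ and for every $x\in S$ there is $\delta>0$ with $\sigma(S\cap B(x,\delta))=S\cap B(x,\delta)$ for all $y\in S\cap B(x,\delta)$, all $\sigma$ with $\sigma y=y$; a locally symmetric $C^2$ submanifold is a connected $C^2$ submanifold without boundary that is locally symmetric. Since $\bar x\in\mathbb{R}^n_\ge$, the sets of $P(\sigma)=P(\bar x)$ are intervals of consecutive integers; list them as $I_1,\dots,I_m$ in increasing order. $\mathbf{S}^k$ denotes real symmetric $k\times k$ matrices, $\lambda(Y)$ the nonincreasingly ordered eigenvalue vector. $\mathbf{S}^n_\sigma=\mathbf{S}^{|I_1|}\times\cdots\times\mathbf{S}^{|I_m|}$ and for $X_\sigma=(X_1,\dots,X_m)$, $\lambda_\sigma(X_\sigma)=(\lambda(X_1),\dots,\lambda(X_m))\in\mathbb{R}^n$ (concatenation). *)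

theory Defs
  imports "HOL-Analysis.Analysis" "HOL-Computational_Algebra.Polynomial"
begin

text \<open>Vectors of R^n are \<open>real^'n\<close> with a finite, linearly (well-)ordered index type 'n
  (n = CARD('n)); the order of 'n plays the role of the order of 1..n.\<close>

definition perm_act :: "('n::finite \<Rightarrow> 'n) \<Rightarrow> real^'n \<Rightarrow> real^'n" where
  "perm_act \<sigma> x = (\<chi> i. x $ (inv \<sigma> i))"

definition orb :: "('n \<Rightarrow> 'n) \<Rightarrow> 'n \<Rightarrow> 'n set" where
  "orb \<sigma> i = {(\<sigma> ^^ m) i | m. True}"

definition Psig :: "('n \<Rightarrow> 'n) \<Rightarrow> 'n set set" where
  "Psig \<sigma> = {orb \<sigma> i | i. True}"

definition Pvec :: "real^'n::finite \<Rightarrow> 'n set set" where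
  "Pvec x = {{j. x $ j = x $ i} | i. True}"

definition Delta :: "('n::finite \<Rightarrow> 'n) \<Rightarrow> (real^'n) set" where
  "Delta \<sigma> = {x. Pvec x = Psig \<sigma>}"

definition Rge :: "(real^'n::{finite,linorder}) set" where
  "Rge = {x. \<forall>i j. i \<le> j \<longrightarrow> x $ j \<le> x $ i}"

definition locally_symmetric :: "(real^'n::{finite,linorder}) set \<Rightarrow> bool" where
  "locally_symmetric S \<longleftrightarrow> S \<inter> Rge \<noteq> {} \<and>
     (\<forall>x\<in>S. \<exists>\<delta>>0. \<forall>y\<in>S \<inter> ball x \<delta>. \<forall>\<sigma>. \<sigma> permutes UNIV \<and> perm_act \<sigma> y = y \<longrightarrow>
         perm_act \<sigma> ` (S \<inter> ball x \<delta>) = S \<inter> ball x \<delta>)"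

definition C2_on :: "'a::real_normed_vector set \<Rightarrow> ('a \<Rightarrow> 'b::real_normed_vector) \<Rightarrow> bool" where
  "C2_on U f \<longleftrightarrow> (\<exists>f1 f2.
     (\<forall>z\<in>U. (f has_derivative blinfun_apply (f1 z)) (at z)) \<and>
     (\<forall>z\<in>U. (f1 has_derivative blinfun_apply (f2 z)) (at z)) \<and>
     continuous_on U f2)"

definition C2_submanifold_around ::
  "'a::euclidean_space set \<Rightarrow> 'a set \<Rightarrow> 'a \<Rightarrow> nat \<Rightarrow> bool" where
  "C2_submanifold_around L M x k \<longleftrightarrow> x \<in> M \<and> M \<subseteq> L \<and>
     (\<exists>U F DF. open U \<and> x \<in> U \<and>
        (\<forall>i<k. C2_on U (F i)) \<and>
        (\<forall>i<k. (F i has_derivative DF i) (at x)) \<and>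
        (\<forall>w::nat \<Rightarrow> real. \<exists>v\<in>L. \<forall>i<k. DF i v = w i) \<and>
        M \<inter> U = {z \<in> L \<inter> U. \<forall>i<k. F i z = (0::real)})"

definition loc_sym_C2_submanifold :: "(real^'n::{finite,linorder}) set \<Rightarrow> nat \<Rightarrow> bool" where
  "loc_sym_C2_submanifold M d \<longleftrightarrow> d \<le> CARD('n) \<and> M \<noteq> {} \<and> connected M \<and>
     (\<forall>x\<in>M. C2_submanifold_around UNIV M x (CARD('n) - d)) \<and> locally_symmetric M"

text \<open>Characteristic polynomial det(tI - A) of the principal block of X indexed by S (Leibniz formula).\<close>
definition block_charpoly :: "'n::finite set \<Rightarrow> real^'n^'n \<Rightarrow> real poly" where
  "block_charpoly S X = (\<Sum>p | p permutes S. of_int (sign p) *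
      (\<Prod>i\<in>S. (if i = p i then [:0, 1:] else 0) - [: X $ i $ (p i) :]))"

text \<open>S^n_sigma = S^{|I_1|} x ... x S^{|I_m|}, identified (isometrically) with the symmetric
  n x n matrices that are block diagonal w.r.t. the orbits I_k of sigma.\<close>
definition Ssig :: "('n::finite \<Rightarrow> 'n) \<Rightarrow> (real^'n^'n) set" where
  "Ssig \<sigma> = {X. (\<forall>i j. X $ i $ j = X $ j $ i) \<and> (\<forall>i j. j \<notin> orb \<sigma> i \<longrightarrow> X $ i $ j = 0)}"

definition lambda_sig :: "('n::{finite,linorder} \<Rightarrow> 'n::{finite,linorder}) \<Rightarrow> real^'n::{finite,linorder}^'n::{finite,linorder} \<Rightarrow> real^'n::{finite,linorder}" where
  "lambda_sig \<sigma> X = (THE y. \<forall>i.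
      (\<forall>j\<in>orb \<sigma> i. \<forall>j'\<in>orb \<sigma> i. j \<le> j' \<longrightarrow> y $ j' \<le> y $ j) \<and>
      (\<forall>t. card {j \<in> orb \<sigma> i. y $ j = t} = order t (block_charpoly (orb \<sigma> i) X)))"

end

theory Submission
  imports Defs
begin

text \<open>
  Write \<open>c\<close> for the point \<open>xbar\<close>; the blocks of \<open>\<sigma>\<close> are the level sets of \<open>c\<close>, and \<open>Xbar\<close> is the diagonal matrix
  of \<open>c\<close>. Since \<open>M\<close> is connected and has a point with distinct coordinates, points with \<open>x $ i \<noteq> x $ j\<close> are
  dense in \<open>M\<close>. If \<open>c $ i = c $ j\<close>, swapping \<open>i\<close> and \<open>j\<close> in such points near \<open>c\<close> shows that
  \<open>axis i 1 - axis j 1\<close> is tangent to \<open>M\<close> at \<open>c\<close>. Hence the differentials at \<open>c\<close> of local equations of \<open>M\<close> are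
  invariant under the stabiliser of \<open>c\<close>, averaging the equations over the stabiliser does not change them, and
  \<open>M\<close> is locally the zero set of invariant \<open>C\<^sup>2\<close> functions.

  It remains to see that \<open>g \<circ> \<lambda>\<^sub>\<sigma>\<close> is \<open>C\<^sup>2\<close> for an invariant \<open>C\<^sup>2\<close> function \<open>g\<close>. After multiplication by a
  cutoff, \<open>g\<close> is a limit in \<open>C\<^sup>2\<close> of polynomials (convolution with the Landau kernels), which may be taken
  invariant. An invariant polynomial lifts to a polynomial in the matrix entries, and the lift has \<open>C\<^sup>2\<close> norm
  bounded by that of the polynomial: by orthogonal invariance this is only to be checked at diagonal matrices,
  where the second derivatives in the off-diagonal directions are the quotients
  \<open>(\<partial>\<^sub>i q - \<partial>\<^sub>j q) / (x $ i - x $ j)\<close>. So the lifted polynomials converge in \<open>C\<^sup>2\<close>.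
\<close>

section \<open>C2 functions\<close>

text \<open>Two obstacles shape the argument. Averaging could enlarge the zero set: that the
  averaged equations have no zeros near \<open>c\<close> outside \<open>M\<close> is not automatic,
  and it is extracted from the fact that both systems share their differential at \<open>c\<close>.
  The second obstacle is that \<open>lambda_sig\<close> is not differentiable where eigenvalues
  inside a block collide, and eigenvectors need not depend continuously on the matrix, so no chain
  rule applies to the composition. Lifts of polynomials are smooth a priori, so that only estimates
  remain, but these must not degenerate with the gap \<open>x $ i - x $ j\<close>. Swapping
  \<open>i\<close> and \<open>j\<close> rewrites the numerator of the quotient as the difference of
  one partial derivative at two points whose distance is at most twice the gap; a Lipschitz bound of
  the gradient therefore suffices. The estimates are applied to differences of two lifts and make
  the derivatives uniformly Cauchy, without any formula for their limits. As \<open>C2_on\<close>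
  speaks of open sets of the full matrix space, everything is precomposed with the projection
  \<open>block_proj\<close>. The codimension survives because the lifted equations restrict to the
  original ones on diagonal matrices.\<close>

definition C2_with where
  "C2_with U f f1 f2 \<longleftrightarrow> (\<forall>z\<in>U. (f has_derivative blinfun_apply (f1 z)) (at z)) \<and>
     (\<forall>z\<in>U. (f1 has_derivative blinfun_apply (f2 z)) (at z)) \<and> continuous_on U f2"

lemma C2_on_iff_C2_with: "C2_on U f \<longleftrightarrow> (\<exists>f1 f2. C2_with U f f1 f2)"
  by (simp add: C2_on_def C2_with_def)

lemma C2_withD:
  assumes "C2_with U f f1 f2"
  shows "z \<in> U \<Longrightarrow> (f has_derivative blinfun_apply (f1 z)) (at z)"
    "z \<in> U \<Longrightarrow> (f1 has_derivative blinfun_apply (f2 z)) (at z)" "continuous_on U f2"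
  using assms by (auto simp: C2_with_def)

lemma C2_on_subset: "C2_on U f \<Longrightarrow> V \<subseteq> U \<Longrightarrow> C2_on V f"
  unfolding C2_on_def by (meson continuous_on_subset subsetD)

lemma C2_on_cong:
  assumes "open U" "\<And>z. z \<in> U \<Longrightarrow> f z = g z" "C2_on U f"
  shows "C2_on U g"
proof -
  obtain f1 f2 where "C2_with U f f1 f2" using assms(3) C2_on_iff_C2_with by blast
  note f = C2_withD[OF this]
  have "(g has_derivative blinfun_apply (f1 z)) (at z)" if "z \<in> U" for z
    using has_derivative_transform_within_open[OF f(1)[OF that] assms(1) that assms(2)] .
  with f(2,3) show ?thesis unfolding C2_on_def by blast
qed

text \<open>The derivatives are witnesses that may differ from one set to the other; uniqueness of
  the derivative on the open overlap forces them to agree, so a case distinction glues them.\<close>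

lemma C2_on_Un:
  fixes f :: "'a::euclidean_space \<Rightarrow> 'b::real_normed_vector"
  assumes "open U" "open V" "C2_on U f" "C2_on V f"
  shows "C2_on (U \<union> V) f"
proof -
  obtain f1 f2 where "C2_with U f f1 f2" using assms(3) C2_on_iff_C2_with by blast
  note f = C2_withD[OF this]
  obtain g1 g2 where "C2_with V f g1 g2" using assms(4) C2_on_iff_C2_with by blast
  note g = C2_withD[OF this]
  define h1 where "h1 z = (if z \<in> U then f1 z else g1 z)" for z
  define h2 where "h2 z = (if z \<in> U then f2 z else g2 z)" for z
  have hU: "h1 z = f1 z" "h2 z = f2 z" if "z \<in> U" for z using that by (auto simp: h1_def h2_def)
  have e1: "h1 z = g1 z" if "z \<in> V" for z
    using has_derivative_unique[OF f(1) g(1)] that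
    by (auto simp: h1_def blinfun_apply_inject)
  have d1: "(h1 has_derivative blinfun_apply (f2 z)) (at z)" if "z \<in> U" for z
    using has_derivative_transform_within_open[OF f(2)[OF that] assms(1) that, of h1] hU by simp
  have d2: "(h1 has_derivative blinfun_apply (g2 z)) (at z)" if "z \<in> V" for z
    using has_derivative_transform_within_open[OF g(2)[OF that] assms(2) that, of h1] e1 by simp
  have e2: "h2 z = g2 z" if "z \<in> V" for z
    using has_derivative_unique[OF d1 d2] that
    by (auto simp: h2_def blinfun_apply_inject)
  have "continuous_on (U \<union> V) h2"
  proof (rule continuous_on_open_Un[OF assms(1,2)])
    show "continuous_on U h2" using f(3) hU(2) by (simp cong: continuous_on_cong)
    show "continuous_on V h2" using g(3) e2 by (simp cong: continuous_on_cong)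
  qed
  moreover have "(f has_derivative blinfun_apply (h1 z)) (at z)" if "z \<in> U \<union> V" for z
    using that f(1)[of z] g(1)[of z] by (auto simp: h1_def)
  moreover have "(h1 has_derivative blinfun_apply (h2 z)) (at z)" if "z \<in> U \<union> V" for z
    using that d1[of z] d2[of z] by (auto simp: h2_def)
  ultimately show ?thesis unfolding C2_on_def by blast
qed

lemma C2_on_const: "C2_on U (\<lambda>_. c)"
  unfolding C2_on_def
  by (rule exI[of _ "\<lambda>_. 0"], rule exI[of _ "\<lambda>_. 0"]) (auto simp: zero_blinfun.rep_eq)

lemma C2_on_bounded_linear:
  assumes "bounded_linear f"
  shows "C2_on U f"
  unfolding C2_on_def
  by (rule exI[of _ "\<lambda>_. Blinfun f"], rule exI[of _ "\<lambda>_. 0"])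
    (use assms in \<open>auto simp: zero_blinfun.rep_eq bounded_linear_Blinfun_apply
       bounded_linear_imp_has_derivative\<close>)

lemma C2_on_add:
  assumes "C2_on U f" "C2_on U g"
  shows "C2_on U (\<lambda>z. f z + g z)"
proof -
  obtain f1 f2 where "C2_with U f f1 f2" using assms(1) C2_on_iff_C2_with by blast
  note f = C2_withD[OF this]
  obtain g1 g2 where "C2_with U g g1 g2" using assms(2) C2_on_iff_C2_with by blast
  note g = C2_withD[OF this]
  show ?thesis unfolding C2_on_def
    by (rule exI[of _ "\<lambda>z. f1 z + g1 z"], rule exI[of _ "\<lambda>z. f2 z + g2 z"])
      (auto simp: plus_blinfun.rep_eq intro!: has_derivative_add f g continuous_on_add)
qed

lemma C2_on_mult:
  fixes f g :: "'a::real_normed_vector \<Rightarrow> real"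
  assumes "C2_on U f" "C2_on U g"
  shows "C2_on U (\<lambda>z. f z * g z)"
proof -
  obtain f1 f2 where "C2_with U f f1 f2" using assms(1) C2_on_iff_C2_with by blast
  note f = C2_withD[OF this]
  obtain g1 g2 where "C2_with U g g1 g2" using assms(2) C2_on_iff_C2_with by blast
  note g = C2_withD[OF this]
  have cf: "continuous_on U f" "continuous_on U f1"
    by (rule has_derivative_continuous_on, rule has_derivative_at_withinI, erule f(1),
        rule has_derivative_continuous_on, rule has_derivative_at_withinI, erule f(2))
  have cg: "continuous_on U g" "continuous_on U g1"
    by (rule has_derivative_continuous_on, rule has_derivative_at_withinI, erule g(1),
        rule has_derivative_continuous_on, rule has_derivative_at_withinI, erule g(2))
  define h1 where "h1 z = f z *\<^sub>R g1 z + g z *\<^sub>R f1 z" for z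
  \<comment> \<open>The last two terms are the rank-one parts of the second derivative:
    \<open>blinfun_scaleR_left (g1 z) o\<^sub>L f1 z\<close> sends \<open>h\<close> to
    \<open>f1 z h *\<^sub>R g1 z\<close>.\<close>
  define h2 where "h2 z = f z *\<^sub>R g2 z + g z *\<^sub>R f2 z +
     (blinfun_scaleR_left (g1 z) o\<^sub>L f1 z) + (blinfun_scaleR_left (f1 z) o\<^sub>L g1 z)" for z
  have "((\<lambda>z. f z * g z) has_derivative blinfun_apply (h1 z)) (at z)" if "z \<in> U" for z
    by (rule has_derivative_eq_rhs[OF has_derivative_mult[OF f(1)[OF that] g(1)[OF that]]])
      (auto simp: h1_def blinfun.bilinear_simps)
  moreover have "(h1 has_derivative blinfun_apply (h2 z)) (at z)" if "z \<in> U" for z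
    unfolding h1_def
    by (rule has_derivative_eq_rhs[OF has_derivative_add[OF
          has_derivative_scaleR[OF f(1)[OF that] g(2)[OF that]]
          has_derivative_scaleR[OF g(1)[OF that] f(2)[OF that]]]])
      (auto simp: h2_def blinfun.bilinear_simps fun_eq_iff)
  moreover have "continuous_on U h2"
    unfolding h2_def using f(3) g(3) cf cg
    by (intro continuous_intros bounded_linear.continuous_on[OF bounded_linear_blinfun_scaleR_left])
  ultimately show ?thesis unfolding C2_on_def by blast
qed

lemma C2_on_cmult:
  fixes f :: "'a::real_normed_vector \<Rightarrow> real"
  shows "C2_on U f \<Longrightarrow> C2_on U (\<lambda>z. c * f z)"
  using C2_on_mult[OF C2_on_const] .

lemma C2_on_sum:
  assumes "\<And>i. i \<in> I \<Longrightarrow> C2_on U (f i)"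
  shows "C2_on U (\<lambda>z. \<Sum>i\<in>I. f i z)"
  using assms
  by (induction I rule: infinite_finite_induct) (auto intro: C2_on_const C2_on_add)

lemma C2_on_compose_real:
  fixes f :: "'a::real_normed_vector \<Rightarrow> real" and g g1 g2 :: "real \<Rightarrow> real"
  assumes "C2_on U f"
    and g: "\<And>t. (g has_real_derivative g1 t) (at t)" "\<And>t. (g1 has_real_derivative g2 t) (at t)"
      "continuous_on UNIV g2"
  shows "C2_on U (\<lambda>z. g (f z))"
proof -
  obtain f1 f2 where "C2_with U f f1 f2" using assms(1) C2_on_iff_C2_with by blast
  note f = C2_withD[OF this]
  have cf: "continuous_on U f" "continuous_on U f1"
    by (rule has_derivative_continuous_on, rule has_derivative_at_withinI, erule f(1),
        rule has_derivative_continuous_on, rule has_derivative_at_withinI, erule f(2))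
  have cg: "continuous_on UNIV g1" by (meson g(2) DERIV_continuous_on has_field_derivative_at_within)
  define h1 where "h1 z = g1 (f z) *\<^sub>R f1 z" for z
  define h2 where "h2 z = g1 (f z) *\<^sub>R f2 z + g2 (f z) *\<^sub>R (blinfun_scaleR_left (f1 z) o\<^sub>L f1 z)" for z
  have 1: "((\<lambda>z. G (f z)) has_derivative (\<lambda>h. G' * f1 z h)) (at z)"
    if "z \<in> U" "(G has_real_derivative G') (at (f z))" for z G G'
    using has_derivative_compose[OF f(1)[OF that(1)], of G "(*) G'"] that(2)
    unfolding has_field_derivative_def by simp
  have "((\<lambda>z. g (f z)) has_derivative blinfun_apply (h1 z)) (at z)" if "z \<in> U" for z
    by (rule has_derivative_eq_rhs[OF 1[OF that g(1)]]) (auto simp: h1_def blinfun.bilinear_simps)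
  moreover have "(h1 has_derivative blinfun_apply (h2 z)) (at z)" if "z \<in> U" for z
    unfolding h1_def
    by (rule has_derivative_eq_rhs[OF has_derivative_scaleR[OF 1[OF that g(2)] f(2)[OF that]]])
      (auto simp: h2_def blinfun.bilinear_simps fun_eq_iff)
  moreover have "continuous_on U h2"
    unfolding h2_def using f(3) cf
    by (intro continuous_intros bounded_linear.continuous_on[OF bounded_linear_blinfun_scaleR_left]
        continuous_on_compose2[OF cg] continuous_on_compose2[OF g(3)]) auto
  ultimately show ?thesis unfolding C2_on_def by blast
qed

lemma C2_on_compose_linear:
  fixes f :: "'b::real_normed_vector \<Rightarrow> 'c::real_normed_vector" and L :: "'a::real_normed_vector \<Rightarrow> 'b"
  assumes "C2_on U f" "bounded_linear L" "L ` V \<subseteq> U"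
  shows "C2_on V (\<lambda>z. f (L z))"
proof -
  obtain f1 f2 where "C2_with U f f1 f2" using assms(1) C2_on_iff_C2_with by blast
  note f = C2_withD[OF this]
  define B where "B = Blinfun L"
  have B: "blinfun_apply B = L" using assms(2) by (simp add: B_def bounded_linear_Blinfun_apply)
  have dL: "(L has_derivative L) (at z)" for z
    using assms(2) by (rule bounded_linear_imp_has_derivative)
  have bl: "bounded_linear (\<lambda>h :: 'b \<Rightarrow>\<^sub>L 'c. h o\<^sub>L B)"
    using bounded_bilinear.bounded_linear_left[OF bounded_bilinear_blinfun_compose] .
  define C where "C = Blinfun (\<lambda>h :: 'b \<Rightarrow>\<^sub>L 'c. h o\<^sub>L B)"
  have C: "blinfun_apply C = (\<lambda>h. h o\<^sub>L B)" using bl by (simp add: C_def bounded_linear_Blinfun_apply)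
  define h1 where "h1 z = f1 (L z) o\<^sub>L B" for z
  define h2 where "h2 z = C o\<^sub>L (f2 (L z) o\<^sub>L B)" for z
  have "((\<lambda>z. f (L z)) has_derivative blinfun_apply (h1 z)) (at z)" if "z \<in> V" for z
    by (rule has_derivative_eq_rhs[OF has_derivative_compose[OF dL f(1)]])
      (use that assms(3) in \<open>auto simp: h1_def B\<close>)
  moreover have "(h1 has_derivative blinfun_apply (h2 z)) (at z)" if "z \<in> V" for z
    unfolding h1_def
    by (rule has_derivative_eq_rhs[OF bounded_linear.has_derivative[OF bl has_derivative_compose[OF dL f(2)]]])
      (use that assms(3) in \<open>auto simp: h2_def B C\<close>)
  moreover have "continuous_on V h2"
    unfolding h2_def
    by (intro continuous_intros continuous_on_compose2[OF f(3)] linear_continuous_on assms)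
  ultimately show ?thesis unfolding C2_on_def by blast
qed

lemma C2_on_real_polynomial_function:
  "real_polynomial_function f \<Longrightarrow> C2_on U f"
  by (induction rule: real_polynomial_function.induct)
    (auto intro: C2_on_const C2_on_bounded_linear C2_on_add C2_on_mult)

text \<open>Termwise differentiation, applied once to \<open>f\<close> and once to
  \<open>f1\<close>. The limits of the derivatives are not given in advance but supplied by
  completeness, since for the lifted functions no expression for them is at hand.\<close>

lemma C2_on_limit:
  fixes f :: "nat \<Rightarrow> 'a::euclidean_space \<Rightarrow> real"
  assumes W: "open W" "convex W"
    and d1: "\<And>k z. z \<in> W \<Longrightarrow> (f k has_derivative blinfun_apply (f1 k z)) (at z)"
    and d2: "\<And>k z. z \<in> W \<Longrightarrow> (f1 k has_derivative blinfun_apply (f2 k z)) (at z)"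
    and c2: "\<And>k. continuous_on W (f2 k)"
    and u1: "uniformly_Cauchy_on W f1"
    and u2: "uniformly_Cauchy_on W f2"
    and lim: "\<And>z. z \<in> W \<Longrightarrow> (\<lambda>k. f k z) \<longlonglongrightarrow> g z"
  shows "C2_on W g"
proof (cases "W = {}")
  case True then show ?thesis by (simp add: C2_on_def)
next
  case False
  then obtain z0 where z0: "z0 \<in> W" by blast
  obtain g1 where g1: "uniform_limit W f1 g1 sequentially"
    using u1 by (auto dest!: Cauchy_uniformly_convergent simp: uniformly_convergent_on_def)
  obtain g2 where g2: "uniform_limit W f2 g2 sequentially"
    using u2 by (auto dest!: Cauchy_uniformly_convergent simp: uniformly_convergent_on_def)
  have le: "\<forall>\<^sub>F n in sequentially. \<forall>x\<in>W. \<forall>h. norm (blinfun_apply (F n x) h - blinfun_apply (G x) h) \<le> e * norm h"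
    if "uniform_limit W F G sequentially" "e > 0"
    for e and F :: "nat \<Rightarrow> 'a \<Rightarrow> 'a \<Rightarrow>\<^sub>L 'c::real_normed_vector" and G
  proof -
    have "\<forall>\<^sub>F n in sequentially. \<forall>x\<in>W. dist (F n x) (G x) < e" using that by (simp add: uniform_limit_iff)
    then show ?thesis
    proof eventually_elim
      case (elim n)
      show ?case
      proof (intro ballI allI)
        fix x h assume "x \<in> W"
        have "norm (blinfun_apply (F n x) h - blinfun_apply (G x) h) \<le> norm (F n x - G x) * norm h"
          using norm_blinfun[of "F n x - G x" h] by (simp add: blinfun.diff_left)
        also have "\<dots> \<le> e * norm h"
          using elim \<open>x \<in> W\<close> by (intro mult_right_mono) (auto simp: dist_norm intro: less_imp_le)
        finally show "norm (blinfun_apply (F n x) h - blinfun_apply (G x) h) \<le> e * norm h" .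
      qed
    qed
  qed
  have "\<exists>h. \<forall>x\<in>W. (\<lambda>n. f n x) \<longlonglongrightarrow> h x \<and> (h has_derivative blinfun_apply (g1 x)) (at x within W)"
  proof (rule has_derivative_sequence[where f=f and f'="\<lambda>n x. blinfun_apply (f1 n x)"
        and g'="\<lambda>x. blinfun_apply (g1 x)" and ?x0.0=z0 and l="g z0" and S=W])
    show "(f n has_derivative blinfun_apply (f1 n x)) (at x within W)" if "x \<in> W" for n x
      using d1[OF that] by (rule has_derivative_at_withinI)
    show "\<forall>\<^sub>F n in sequentially. \<forall>x\<in>W. \<forall>h. norm (blinfun_apply (f1 n x) h - blinfun_apply (g1 x) h) \<le> e * norm h"
      if "e > 0" for e using le[OF g1 that] .
  qed (use W z0 lim in auto)
  then obtain h where h: "\<And>x. x \<in> W \<Longrightarrow> (\<lambda>n. f n x) \<longlonglongrightarrow> h x"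
    "\<And>x. x \<in> W \<Longrightarrow> (h has_derivative blinfun_apply (g1 x)) (at x within W)" by blast
  have hg: "h x = g x" if "x \<in> W" for x using LIMSEQ_unique[OF h(1) lim] that by blast
  have lim1: "(\<lambda>n. f1 n x) \<longlonglongrightarrow> g1 x" if "x \<in> W" for x
    using tendsto_uniform_limitI[OF g1 that] .
  have "\<exists>h. \<forall>x\<in>W. (\<lambda>n. f1 n x) \<longlonglongrightarrow> h x \<and> (h has_derivative blinfun_apply (g2 x)) (at x within W)"
  proof (rule has_derivative_sequence[where f=f1 and f'="\<lambda>n x. blinfun_apply (f2 n x)"
        and g'="\<lambda>x. blinfun_apply (g2 x)" and ?x0.0=z0 and l="g1 z0" and S=W])
    show "(f1 n has_derivative blinfun_apply (f2 n x)) (at x within W)" if "x \<in> W" for n x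
      using d2[OF that] by (rule has_derivative_at_withinI)
    show "\<forall>\<^sub>F n in sequentially. \<forall>x\<in>W. \<forall>h. norm (blinfun_apply (f2 n x) h - blinfun_apply (g2 x) h) \<le> e * norm h"
      if "e > 0" for e using le[OF g2 that] .
  qed (use W z0 lim1 in auto)
  then obtain h1 where h1: "\<And>x. x \<in> W \<Longrightarrow> (\<lambda>n. f1 n x) \<longlonglongrightarrow> h1 x"
    "\<And>x. x \<in> W \<Longrightarrow> (h1 has_derivative blinfun_apply (g2 x)) (at x within W)" by blast
  have hg1: "h1 x = g1 x" if "x \<in> W" for x using LIMSEQ_unique[OF h1(1) lim1] that by blast
  have "(g has_derivative blinfun_apply (g1 z)) (at z)" if "z \<in> W" for z
    by (rule has_derivative_transform_within_open[OF _ W(1) that hg])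
       (use h(2)[OF that] at_within_open[OF that W(1)] in simp_all)
  moreover have "(g1 has_derivative blinfun_apply (g2 z)) (at z)" if "z \<in> W" for z
    by (rule has_derivative_transform_within_open[OF _ W(1) that hg1])
       (use h1(2)[OF that] at_within_open[OF that W(1)] in simp_all)
  moreover have "continuous_on W g2"
    by (rule uniform_limit_theorem[OF _ g2]) (auto simp: c2)
  ultimately show ?thesis unfolding C2_on_def by blast
qed

section \<open>Symmetric local equations of the manifold\<close>

text \<open>Strict differentiability: both points of the increment move. This is what is needed to
  compare two points of \<open>M\<close> neither of which is \<open>x\<close>, and to obtain
  contractions.\<close>

definition strict_deriv_at ::
  "('a::real_normed_vector \<Rightarrow> 'b::real_normed_vector) \<Rightarrow> ('a \<Rightarrow> 'b) \<Rightarrow> 'a \<Rightarrow> bool" where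
  "strict_deriv_at f D x \<longleftrightarrow> (\<forall>e>0. \<exists>\<delta>>0. \<forall>p\<in>ball x \<delta>. \<forall>q\<in>ball x \<delta>.
     norm (f p - f q - D (p - q)) \<le> e * norm (p - q))"

lemma strict_deriv_atE:
  assumes "strict_deriv_at f D x" "e > 0"
  obtains \<delta> where "\<delta> > 0" "\<And>p q. p \<in> ball x \<delta> \<Longrightarrow> q \<in> ball x \<delta> \<Longrightarrow> norm (f p - f q - D (p - q)) \<le> e * norm (p - q)"
  using assms unfolding strict_deriv_at_def by blast

text \<open>Near \<open>x\<close> the map \<open>p \<mapsto> f p - f1 x p\<close> has derivative of
  norm at most \<open>e\<close>, by continuity of \<open>f1\<close>; the mean value inequality on a
  ball does the rest.\<close>

lemma C2_on_strict_deriv_at: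
  fixes f :: "'a::euclidean_space \<Rightarrow> 'b::real_normed_vector"
  assumes U: "open U" "x \<in> U" and f: "C2_on U f" and D: "(f has_derivative D) (at x)"
  shows "strict_deriv_at f D x"
  unfolding strict_deriv_at_def
proof (intro allI impI)
  fix e :: real assume e: "e > 0"
  obtain f1 f2 where "C2_with U f f1 f2" using f C2_on_iff_C2_with by blast
  note f = C2_withD[OF this]
  have D: "D = blinfun_apply (f1 x)" using has_derivative_unique[OF D f(1)[OF U(2)]] .
  have "isCont f1 x" using f(2)[OF U(2)] has_derivative_continuous by blast
  then obtain \<delta>1 where \<delta>1: "\<delta>1 > 0" "\<And>z. dist z x < \<delta>1 \<Longrightarrow> dist (f1 z) (f1 x) < e"
    using e unfolding continuous_at_eps_delta by metis
  obtain \<delta>2 where \<delta>2: "\<delta>2 > 0" "ball x \<delta>2 \<subseteq> U" using U open_contains_ball by blast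
  let ?B = "ball x (min \<delta>1 \<delta>2)"
  have "norm (f p - f q - D (p - q)) \<le> e * norm (p - q)" if "p \<in> ?B" "q \<in> ?B" for p q
  proof -
    have "norm ((f p - f1 x p) - (f q - f1 x q)) \<le> e * norm (p - q)"
    proof (rule differentiable_bound[where S="?B" and f'="\<lambda>z. blinfun_apply (f1 z - f1 x)"])
      fix z assume z: "z \<in> ?B"
      show "((\<lambda>p. f p - f1 x p) has_derivative blinfun_apply (f1 z - f1 x)) (at z within ?B)"
        by (rule has_derivative_at_withinI, rule has_derivative_eq_rhs[OF has_derivative_diff[OF f(1)
              bounded_linear_imp_has_derivative[OF blinfun.bounded_linear_right]]])
          (use z \<delta>2 in \<open>auto simp: blinfun.diff_left\<close>)
      show "onorm (blinfun_apply (f1 z - f1 x)) \<le> e"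
        using \<delta>1(2)[of z] z by (simp add: dist_norm norm_blinfun.rep_eq[symmetric] norm_minus_commute)
    qed (use that in auto)
    then show ?thesis by (simp add: D blinfun.diff_right algebra_simps)
  qed
  then show "\<exists>\<delta>>0. \<forall>p\<in>ball x \<delta>. \<forall>q\<in>ball x \<delta>. norm (f p - f q - D (p - q)) \<le> e * norm (p - q)"
    using \<delta>1(1) \<delta>2(1) by (intro exI[of _ "min \<delta>1 \<delta>2"]) auto
qed

lemma strict_deriv_at_add:
  assumes "strict_deriv_at f D x" "strict_deriv_at g E x"
  shows "strict_deriv_at (\<lambda>p. f p + g p) (\<lambda>h. D h + E h) x"
  unfolding strict_deriv_at_def
proof (intro allI impI)
  fix e :: real assume "e > 0"
  then have e: "e/2 > 0" by simp
  obtain d1 where d1: "d1 > 0"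
    "\<And>p q. p \<in> ball x d1 \<Longrightarrow> q \<in> ball x d1 \<Longrightarrow> norm (f p - f q - D (p - q)) \<le> e/2 * norm (p - q)"
    using strict_deriv_atE[OF assms(1) e] by blast
  obtain d2 where d2: "d2 > 0"
    "\<And>p q. p \<in> ball x d2 \<Longrightarrow> q \<in> ball x d2 \<Longrightarrow> norm (g p - g q - E (p - q)) \<le> e/2 * norm (p - q)"
    using strict_deriv_atE[OF assms(2) e] by blast
  have "norm (f p + g p - (f q + g q) - (D (p - q) + E (p - q))) \<le> e * norm (p - q)"
    if "p \<in> ball x (min d1 d2)" "q \<in> ball x (min d1 d2)" for p q
  proof -
    have "norm ((f p - f q - D (p - q)) + (g p - g q - E (p - q))) \<le> e/2 * norm (p - q) + e/2 * norm (p - q)"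
      using that by (intro norm_triangle_mono d1 d2) auto
    then show ?thesis by (simp add: algebra_simps)
  qed
  then show "\<exists>\<delta>>0. \<forall>p\<in>ball x \<delta>. \<forall>q\<in>ball x \<delta>.
      norm (f p + g p - (f q + g q) - (D (p - q) + E (p - q))) \<le> e * norm (p - q)"
    using d1(1) d2(1) by (intro exI[of _ "min d1 d2"]) auto
qed

lemma strict_deriv_at_scaleR:
  fixes f :: "'a::real_normed_vector \<Rightarrow> real"
  assumes "strict_deriv_at f D x"
  shows "strict_deriv_at (\<lambda>p. f p *\<^sub>R v) (\<lambda>h. D h *\<^sub>R v) x"
  unfolding strict_deriv_at_def
proof (intro allI impI)
  fix e :: real assume "e > 0"
  \<comment> \<open>The added 1 keeps the denominator positive when \<open>v\<close> is
    zero.\<close>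
  then have e: "e / (norm v + 1) > 0" by (intro divide_pos_pos) (auto intro: add_nonneg_pos)
  obtain d where d: "d > 0"
    "\<And>p q. p \<in> ball x d \<Longrightarrow> q \<in> ball x d \<Longrightarrow> norm (f p - f q - D (p - q)) \<le> e / (norm v + 1) * norm (p - q)"
    using strict_deriv_atE[OF assms e] by blast
  have "norm (f p *\<^sub>R v - f q *\<^sub>R v - D (p - q) *\<^sub>R v) \<le> e * norm (p - q)"
    if "p \<in> ball x d" "q \<in> ball x d" for p q
  proof -
    have "norm (f p *\<^sub>R v - f q *\<^sub>R v - D (p - q) *\<^sub>R v) = norm (f p - f q - D (p - q)) * norm v"
      by (metis norm_scaleR real_norm_def scaleR_left_diff_distrib)
    also have "\<dots> \<le> norm (f p - f q - D (p - q)) * (norm v + 1)"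
      by (intro mult_left_mono) auto
    also have "\<dots> \<le> e / (norm v + 1) * norm (p - q) * (norm v + 1)"
      using d(2)[OF that] by (intro mult_right_mono) auto
    also have "\<dots> = e * norm (p - q)" using norm_ge_zero[of v] by (simp add: add_nonneg_eq_0_iff)
    finally show ?thesis .
  qed
  then show "\<exists>\<delta>>0. \<forall>p\<in>ball x \<delta>. \<forall>q\<in>ball x \<delta>.
      norm (f p *\<^sub>R v - f q *\<^sub>R v - D (p - q) *\<^sub>R v) \<le> e * norm (p - q)"
    using d(1) by blast
qed

lemma strict_deriv_at_sum:
  assumes "\<And>i. i \<in> I \<Longrightarrow> strict_deriv_at (f i) (D i) x"
  shows "strict_deriv_at (\<lambda>p. \<Sum>i\<in>I. f i p) (\<lambda>h. \<Sum>i\<in>I. D i h) x"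
  using assms
proof (induction I rule: infinite_finite_induct)
  case (insert i I)
  then show ?case by (auto intro: strict_deriv_at_add)
qed (auto simp: strict_deriv_at_def intro: exI[of _ 1])

text \<open>Newton's method with the fixed derivative \<open>P\<close>: when \<open>P\<close> is a projection fixing the values of
  \<open>S\<close>, the map \<open>q \<mapsto> q - S q\<close> is a contraction of every affine subspace parallel to the range of \<open>P\<close>.\<close>

lemma strict_deriv_projection_zero:
  fixes S P :: "'a::euclidean_space \<Rightarrow> 'a"
  assumes st: "strict_deriv_at S P x" and P: "linear P" and PS: "\<And>p. P (S p) = S p"
    and Sx: "S x = 0" and \<eta>: "\<eta> > 0"
  shows "\<exists>\<delta>>0. \<forall>p\<in>ball x \<delta>. \<exists>q\<in>ball x \<eta>. S q = 0 \<and> norm (q - p) \<le> 2 * norm (S p) \<and> P (q - p) = q - p"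
proof -
  obtain \<delta>1 where \<delta>1: "\<delta>1 > 0"
    "\<And>p q. p \<in> ball x \<delta>1 \<Longrightarrow> q \<in> ball x \<delta>1 \<Longrightarrow> norm (S p - S q - P (p - q)) \<le> 1/2 * norm (p - q)"
    using strict_deriv_atE[OF st, of "1/2"] by auto
  obtain B where B: "B > 0" "\<And>h. norm (P h) \<le> B * norm h"
    using P linear_bounded_pos by blast
  define \<rho> where "\<rho> = min \<delta>1 \<eta>"
  have \<rho>: "\<rho> > 0" using \<delta>1 \<eta> by (simp add: \<rho>_def)
  \<comment> \<open>From \<open>norm (S p) \<le> (1/2 + B) * norm (p - x)\<close> one gets
    \<open>norm (p - x) + 2 * norm (S p) \<le> (2 * B + 2) * norm (p - x)\<close>; this radius keeps
    it below \<open>\<rho>\<close>.\<close>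
  define \<delta> where "\<delta> = \<rho> / (2 * B + 3)"
  have \<delta>: "\<delta> > 0" using \<rho> B by (simp add: \<delta>_def)
  have "\<exists>q\<in>ball x \<eta>. S q = 0 \<and> norm (q - p) \<le> 2 * norm (S p) \<and> P (q - p) = q - p" if p: "p \<in> ball x \<delta>" for p
  proof -
    have px: "norm (p - x) < \<delta>" using p by (simp add: dist_norm norm_minus_commute)
    have "\<delta> \<le> \<rho>" unfolding \<delta>_def using \<rho> B by (simp add: field_simps)
    then have p1: "p \<in> ball x \<delta>1" using p by (simp add: \<rho>_def)
    have "norm (S p) \<le> norm (S p - S x - P (p - x)) + norm (P (p - x))"
      using Sx by (metis add.commute diff_add_cancel diff_zero norm_triangle_ineq)
    also have "\<dots> \<le> 1/2 * norm (p - x) + B * norm (p - x)"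
      by (intro add_mono B \<delta>1 p1) (use \<delta>1 in auto)
    finally have "norm (p - x) + 2 * norm (S p) \<le> (2 * B + 2) * norm (p - x)" by (simp add: algebra_simps)
    also have "\<dots> \<le> (2 * B + 3) * norm (p - x)" by (intro mult_right_mono) auto
    also have "\<dots> < (2 * B + 3) * \<delta>" using px B by (intro mult_strict_left_mono) auto
    also have "\<dots> = \<rho>" using B by (simp add: \<delta>_def)
    finally have small: "norm (p - x) + 2 * norm (S p) < \<rho>" .
    \<comment> \<open>The first Newton step moves \<open>p\<close> by \<open>norm (S p)\<close> and
      later steps shrink by 1/2, so the geometric series gives the radius
      \<open>2 * norm (S p)\<close>. On the affine subspace \<open>P\<close> acts on differences as
      the identity, which makes the iteration a contraction.\<close>
    define s where "s = {q \<in> cball p (2 * norm (S p)). P (q - p) = q - p}"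
    have sub: "s \<subseteq> ball x \<rho>"
    proof
      fix q assume "q \<in> s"
      then have "norm (q - p) \<le> 2 * norm (S p)" by (simp add: s_def dist_norm norm_minus_commute)
      then have "norm (q - x) < \<rho>" using small norm_triangle_ineq[of "q - p" "p - x"] by simp
      then show "q \<in> ball x \<rho>" by (simp add: dist_norm norm_minus_commute)
    qed
    have "closed s" unfolding s_def
    proof (rule closed_Collect_conj)
      show "closed {q. q \<in> cball p (2 * norm (S p))}" unfolding Collect_mem_eq by (rule closed_cball)
      show "closed {x. P (x - p) = x - p}"
        by (intro closed_Collect_eq continuous_intros linear_continuous_on_compose[OF _ P])
    qed
    have contr: "dist (q - S q) (q' - S q') \<le> 1/2 * dist q q'" if "q \<in> s" "q' \<in> s" for q q'
    proof -
      have "P (q - q') = P (q - p) - P (q' - p)" by (simp add: P[THEN linear_diff, symmetric])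
      then have Pq: "P (q - q') = q - q'" using that by (simp add: s_def)
      have "norm (S q - S q' - P (q - q')) \<le> 1/2 * norm (q - q')"
        using that sub by (intro \<delta>1) (auto simp: \<rho>_def)
      moreover have "norm (S q - S q' - P (q - q')) = dist (q - S q) (q' - S q')"
        unfolding Pq dist_norm by (subst norm_minus_cancel[symmetric]) (simp add: algebra_simps)
      ultimately show ?thesis by (simp add: dist_norm)
    qed
    have ps: "p \<in> s" by (simp add: s_def linear_0[OF P])
    have "\<exists>!q\<in>s. q - S q = q"
    proof (rule Banach_fix[where c="1/2"])
      show "complete s" using \<open>closed s\<close> complete_eq_closed by blast
      show "(\<lambda>q. q - S q) ` s \<subseteq> s"
      proof
        fix y assume "y \<in> (\<lambda>q. q - S q) ` s"
        then obtain q where q: "q \<in> s" "y = q - S q" by blast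
        have "P (y - p) = P (q - p) - P (S q)"
          by (simp add: q P[THEN linear_diff, symmetric] algebra_simps)
        then have 1: "P (y - p) = y - p" using q by (simp add: s_def PS)
        have "dist y p \<le> dist y (p - S p) + dist (p - S p) p" by (rule dist_triangle)
        also have "\<dots> \<le> 1/2 * dist q p + norm (S p)" using contr[OF q(1) ps] q(2) by (simp add: dist_norm)
        also have "\<dots> \<le> 2 * norm (S p)" using q(1) by (simp add: s_def dist_commute)
        finally show "y \<in> s" using 1 by (simp add: s_def dist_commute)
      qed
    qed (use ps contr in auto)
    then obtain q where "q \<in> s" "S q = 0" by auto
    then show ?thesis using sub by (intro bexI[of _ q]) (auto simp: s_def \<rho>_def dist_norm norm_minus_commute)
  qed
  then show ?thesis using \<delta> by blast
qed

section \<open>The action of permutations and its tangent directions\<close>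

lemma perm_act_nth: "perm_act g x $ i = x $ inv g i"
  by (simp add: perm_act_def)

lemma linear_perm_act: "linear (perm_act g)"
  by (rule linearI) (simp_all add: vec_eq_iff perm_act_nth)

lemma perm_act_compose:
  assumes "g permutes UNIV" "h permutes UNIV"
  shows "perm_act g (perm_act h x) = perm_act (g \<circ> h) x"
  using assms by (simp add: vec_eq_iff perm_act_nth o_inv_distrib permutes_bij)

lemma perm_act_id [simp]: "perm_act id x = x" by (simp add: vec_eq_iff perm_act_nth)

lemma norm_perm_act:
  fixes x :: "real^'n"
  assumes "g permutes UNIV"
  shows "norm (perm_act g x) = norm x"
proof -
  have "(\<Sum>i\<in>UNIV. (x $ inv g i)\<^sup>2) = (\<Sum>i\<in>UNIV. (x $ i)\<^sup>2)"
    using permutes_inv[OF assms] by (intro sum.permute[unfolded o_def, symmetric])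
  then show ?thesis by (simp add: norm_vec_def L2_set_def perm_act_nth)
qed

lemma dist_perm_act:
  fixes x :: "real^'n"
  assumes "g permutes UNIV"
  shows "dist (perm_act g x) (perm_act g y) = dist x y"
  using norm_perm_act[OF assms, of "x - y"] by (simp add: dist_norm linear_diff[OF linear_perm_act])

lemma perm_act_eq_sum:
  assumes "g permutes UNIV"
  shows "perm_act g v = (\<Sum>a\<in>UNIV. v $ a *\<^sub>R axis (g a) 1)"
proof -
  have "(\<Sum>a\<in>UNIV. v $ a * axis (g a) 1 $ i) = v $ inv g i" for i
  proof -
    have "(\<Sum>a\<in>UNIV. v $ a * axis (g a) 1 $ i) = (\<Sum>a\<in>UNIV. if a = inv g i then v $ a else 0)"
      using permutes_inverses[OF assms] by (intro sum.cong refl) (auto simp: axis_def)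
    then show ?thesis by simp
  qed
  then show ?thesis by (simp add: vec_eq_iff perm_act_nth)
qed

text \<open>A swap is the reflection along \<open>axis i 1 - axis j 1\<close>; hence the secant from
  a point to its swapped image has a direction that does not depend on the point.\<close>

lemma perm_act_transpose:
  "perm_act (Transposition.transpose i j) y = y - (y $ i - y $ j) *\<^sub>R (axis i 1 - axis j 1)"
  by (auto simp: vec_eq_iff perm_act_nth inv_unique_comp[of "Transposition.transpose i j" "Transposition.transpose i j"]
      axis_def Transposition.transpose_def)

text \<open>The centre \<open>x\<close> is taken as the fixed point in the definition of local
  symmetry, so one radius serves the whole stabiliser of \<open>x\<close>.\<close>

lemma locally_symmetric_fixing:
  assumes "locally_symmetric M" "x \<in> M"
  obtains \<delta> where "\<delta> > 0"
    "\<And>g y. g permutes UNIV \<Longrightarrow> perm_act g x = x \<Longrightarrow> y \<in> M \<Longrightarrow> y \<in> ball x \<delta> \<Longrightarrow> perm_act g y \<in> M"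
proof -
  obtain \<delta> where \<delta>: "\<delta> > 0" "\<forall>y\<in>M \<inter> ball x \<delta>. \<forall>\<sigma>. \<sigma> permutes UNIV \<and> perm_act \<sigma> y = y \<longrightarrow>
         perm_act \<sigma> ` (M \<inter> ball x \<delta>) = M \<inter> ball x \<delta>"
    using assms unfolding locally_symmetric_def by blast
  show thesis
  proof (rule that[OF \<delta>(1)])
    fix g y assume a: "g permutes UNIV" "perm_act g x = x" "y \<in> M" "y \<in> ball x \<delta>"
    then have "perm_act g ` (M \<inter> ball x \<delta>) = M \<inter> ball x \<delta>"
      using \<delta>(1) assms(2) by (intro \<delta>(2)[rule_format, of x]) simp_all
    then show "perm_act g y \<in> M" using a by blast
  qed
qed

text \<open>For \<open>y\<close> in \<open>M\<close> close to \<open>x\<close> with different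
  coordinates \<open>i\<close> and \<open>j\<close>, both \<open>y\<close> and its swapped image are
  zeros of \<open>S\<close> and their difference is a nonzero multiple of
  \<open>axis i 1 - axis j 1\<close>. Strict differentiability, divided by that multiple, bounds the
  value of \<open>P\<close> on this direction by any \<open>e\<close> times its norm.\<close>

lemma swap_direction_tangent:
  fixes M :: "(real^'n::{finite,linorder}) set"
  assumes st: "strict_deriv_at S P x" and P: "linear P"
    and \<delta>0: "\<delta>0 > 0" "\<And>p. p \<in> ball x \<delta>0 \<Longrightarrow> p \<in> M \<longleftrightarrow> S p = 0"
    and M: "locally_symmetric M" "x \<in> M" and xij: "x $ i = x $ j"
    and dense: "\<And>\<epsilon>. \<epsilon> > 0 \<Longrightarrow> \<exists>y\<in>M \<inter> ball x \<epsilon>. y $ i \<noteq> y $ j"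
  shows "P (axis i 1 - axis j 1) = 0"
proof -
  let ?u = "axis i 1 - axis j 1 :: (real,'n) vec" and ?t = "Transposition.transpose i j"
  have tp: "?t permutes UNIV" by (simp add: permutes_swap_id)
  have tx: "perm_act ?t x = x" by (simp add: perm_act_transpose xij)
  have "norm (P ?u) \<le> e * norm ?u" if e: "e > 0" for e
  proof -
    obtain \<delta>1 where \<delta>1: "\<delta>1 > 0"
      "\<And>p q. p \<in> ball x \<delta>1 \<Longrightarrow> q \<in> ball x \<delta>1 \<Longrightarrow> norm (S p - S q - P (p - q)) \<le> e * norm (p - q)"
      using strict_deriv_atE[OF st e] by blast
    obtain \<delta>2 where \<delta>2: "\<delta>2 > 0"
      "\<And>g y. g permutes UNIV \<Longrightarrow> perm_act g x = x \<Longrightarrow> y \<in> M \<Longrightarrow> y \<in> ball x \<delta>2 \<Longrightarrow> perm_act g y \<in> M"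
      using locally_symmetric_fixing[OF M] by blast
    obtain y where y: "y \<in> M" "y \<in> ball x (min \<delta>0 (min \<delta>1 \<delta>2))" "y $ i \<noteq> y $ j"
      using dense[of "min \<delta>0 (min \<delta>1 \<delta>2)"] \<delta>0(1) \<delta>1(1) \<delta>2(1) by auto
    let ?z = "perm_act ?t y"
    have zM: "?z \<in> M" using \<delta>2(2)[OF tp tx] y by simp
    have zb: "?z \<in> ball x (min \<delta>0 (min \<delta>1 \<delta>2))" using dist_perm_act[OF tp, of x y] tx y(2) by simp
    have "norm (S y - S ?z - P (y - ?z)) \<le> e * norm (y - ?z)" using y zb by (intro \<delta>1) auto
    moreover have "S y = 0" "S ?z = 0" using \<delta>0(2) y zM zb by auto
    moreover have "y - ?z = (y $ i - y $ j) *\<^sub>R ?u" by (simp add: perm_act_transpose)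
    ultimately have "\<bar>y $ i - y $ j\<bar> * norm (P ?u) \<le> \<bar>y $ i - y $ j\<bar> * (e * norm ?u)"
      by (simp only: linear_cmul[OF P] norm_scaleR diff_self diff_0 norm_minus_cancel) (simp add: mult_ac)
    then show ?thesis using y(3) by simp
  qed
  then have "norm (P ?u) \<le> 0 + e" if "e > 0" for e
  proof -
    assume H: "\<And>e. e > 0 \<Longrightarrow> norm (P ?u) \<le> e * norm ?u"
    have "norm (P ?u) \<le> e / (norm ?u + 1) * norm ?u"
      using that by (intro H divide_pos_pos) (auto intro: add_nonneg_pos)
    also have "\<dots> \<le> e / (norm ?u + 1) * (norm ?u + 1)" using that by (intro mult_left_mono) auto
    also have "\<dots> = e" using norm_ge_zero[of ?u] by (simp add: add_nonneg_eq_0_iff)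
    finally show "norm (P ?u) \<le> 0 + e" by simp
  qed
  then have "norm (P ?u) \<le> 0" by (rule field_le_epsilon)
  then show ?thesis by simp
qed

lemma dual_vectors:
  fixes DF :: "nat \<Rightarrow> 'a::euclidean_space \<Rightarrow> real"
  assumes "\<forall>w::nat \<Rightarrow> real. \<exists>v. \<forall>i<k. DF i v = w i"
  obtains v where "\<And>i j. i < k \<Longrightarrow> DF i (v j) = (if i = j then 1 else 0)"
  using assms[THEN spec, of "\<lambda>i. if i = _ then 1 else 0"] by metis

text \<open>With \<open>v\<close> dual to the \<open>DF i\<close>, the map
  \<open>h \<mapsto> \<Sum>j<k. DF j h *\<^sub>R v j\<close> is the projection onto the span of the
  \<open>v j\<close> along the common kernel of the \<open>DF j\<close>, and the \<open>DF i\<close>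
  read off coefficients in that span.\<close>

lemma projection_of_dual_vectors:
  fixes v :: "nat \<Rightarrow> 'a::euclidean_space"
  assumes v: "\<And>i j. i < k \<Longrightarrow> DF i (v j) = (if i = j then 1 else 0)"
    and lin: "\<And>i. i < k \<Longrightarrow> linear (DF i)"
  shows "(\<Sum>j<k. DF j (\<Sum>i<k. a i *\<^sub>R v i) *\<^sub>R v j) = (\<Sum>i<k. a i *\<^sub>R v i)"
    and "i < k \<Longrightarrow> DF i (\<Sum>i<k. a i *\<^sub>R v i) = a i"
proof -
  have *: "DF j (\<Sum>i<k. a i *\<^sub>R v i) = a j" if "j < k" for j
  proof -
    have "DF j (\<Sum>i<k. a i *\<^sub>R v i) = (\<Sum>i<k. a i * DF j (v i))"
      using lin[OF that] by (simp add: linear_sum linear_cmul)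
    also have "\<dots> = (\<Sum>i<k. if i = j then a i else 0)" using v that by (intro sum.cong) auto
    also have "\<dots> = a j" using that by simp
    finally show ?thesis .
  qed
  then show "i < k \<Longrightarrow> DF i (\<Sum>i<k. a i *\<^sub>R v i) = a i" by blast
  show "(\<Sum>j<k. DF j (\<Sum>i<k. a i *\<^sub>R v i) *\<^sub>R v j) = (\<Sum>i<k. a i *\<^sub>R v i)"
    using * by (intro sum.cong) auto
qed

text \<open>The \<open>k\<close> scalar equations are packed into one vector equation whose values
  lie in the range of its own derivative \<open>P\<close> at \<open>x\<close>. This is the form to
  which the fixed-derivative Newton method applies, and no right-hand side space other than the
  ambient one is involved.\<close>

lemma projection_equation:
  fixes M :: "'a::euclidean_space set" and F :: "nat \<Rightarrow> 'a \<Rightarrow> real"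
  assumes U: "open U" "x \<in> U" and C2: "\<forall>i<k. C2_on U (F i)"
    and D: "\<forall>i<k. (F i has_derivative DF i) (at x)"
    and v: "\<And>i j. i < k \<Longrightarrow> DF i (v j) = (if i = j then 1 else 0)"
    and eq: "M \<inter> U = {z \<in> U. \<forall>i<k. F i z = 0}"
  defines "S \<equiv> \<lambda>p. \<Sum>i<k. F i p *\<^sub>R v i" and "P \<equiv> \<lambda>h. \<Sum>i<k. DF i h *\<^sub>R v i"
  shows "strict_deriv_at S P x" "linear P" "P (S p) = S p" "S p = 0 \<Longrightarrow> i < k \<Longrightarrow> F i p = 0"
    "p \<in> U \<Longrightarrow> p \<in> M \<longleftrightarrow> S p = 0"
proof -
  have lin: "linear (DF i)" if "i < k" for i using D that has_derivative_linear by blast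
  show "strict_deriv_at S P x" unfolding S_def P_def
    by (intro strict_deriv_at_sum strict_deriv_at_scaleR C2_on_strict_deriv_at[OF U]) (use C2 D in auto)
  show "linear P" unfolding P_def
    by (rule linearI)
      (simp_all add: linear_add[OF lin] linear_cmul[OF lin] scaleR_left_distrib sum.distrib scaleR_sum_right)
  show "P (S p) = S p"
    unfolding P_def S_def using projection_of_dual_vectors(1)[OF v lin] by simp
  have F0: "F i p = 0" if "S p = 0" "i < k" for i p
    using projection_of_dual_vectors(2)[OF v lin that(2), of "\<lambda>i. F i p"] that(1) linear_0[OF lin[OF that(2)]]
    by (simp add: S_def)
  then show "S p = 0 \<Longrightarrow> i < k \<Longrightarrow> F i p = 0" .
  show "p \<in> M \<longleftrightarrow> S p = 0" if "p \<in> U"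
  proof
    assume "p \<in> M" then have "p \<in> M \<inter> U" using that by blast
    then show "S p = 0" unfolding eq by (simp add: S_def)
  next
    assume "S p = 0"
    then have "p \<in> M \<inter> U" unfolding eq using that F0 by simp
    then show "p \<in> M" by blast
  qed
qed

lemma submanifold_projection_equation:
  fixes M :: "'a::euclidean_space set"
  assumes "C2_submanifold_around UNIV M x k"
  obtains S P \<delta> where "strict_deriv_at S P x" "linear P" "\<And>p. P (S p) = S p" "\<delta> > 0"
    "\<And>p. p \<in> ball x \<delta> \<Longrightarrow> p \<in> M \<longleftrightarrow> S p = 0" "S x = 0"
proof -
  obtain U F DF where U: "open U" "x \<in> U" and C2: "\<forall>i<k. C2_on U (F i)"
    and D: "\<forall>i<k. (F i has_derivative DF i) (at x)"
    and surj: "\<forall>w::nat \<Rightarrow> real. \<exists>v. \<forall>i<k. DF i v = w i"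
    and eq: "M \<inter> U = {z \<in> U. \<forall>i<k. F i z = 0}" and xM: "x \<in> M"
    using assms unfolding C2_submanifold_around_def by auto
  obtain v where v: "\<And>i j. i < k \<Longrightarrow> DF i (v j) = (if i = j then 1 else 0)"
    using dual_vectors[OF surj] by blast
  note pe = projection_equation[OF U C2 D v eq]
  obtain \<delta> where \<delta>: "\<delta> > 0" "ball x \<delta> \<subseteq> U" using U open_contains_ball by blast
  show thesis
    by (rule that[OF pe(1-3) \<delta>(1)]) (use pe(5) \<delta>(2) U(2) xM in auto)
qed

text \<open>The set of points near which \<open>M\<close> lies in the hyperplane \<open>x $ i = x $ j\<close> is open and closed in \<open>M\<close>:
  at a boundary point the direction \<open>axis i 1 - axis j 1\<close> is tangent to \<open>M\<close>, hence almost tangent at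
  the nearby points, which therefore can be moved inside \<open>M\<close> off the hyperplane.\<close>

lemma distinct_coordinates_dense:
  fixes M :: "(real^'n::{finite,linorder}) set"
  assumes M: "loc_sym_C2_submanifold M d"
    and gen: "\<exists>y\<in>M. \<exists>\<rho>>0. \<forall>z\<in>M \<inter> ball y \<rho>. \<forall>i j. i \<noteq> j \<longrightarrow> z $ i \<noteq> z $ j"
    and "x \<in> M" "i \<noteq> j" "\<epsilon> > 0"
  shows "\<exists>y\<in>M \<inter> ball x \<epsilon>. y $ i \<noteq> y $ j"
proof -
  let ?u = "axis i 1 - axis j 1 :: (real,'n) vec"
  have u: "?u $ i = 1" "?u $ j = - 1" using \<open>i \<noteq> j\<close> by (auto simp: axis_def)
  have nu: "norm ?u \<le> 2" using norm_triangle_ineq4[of "axis i 1" "axis j 1 :: (real,'n) vec"] by simp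
  have conn: "connected M" and mfd: "\<And>x. x \<in> M \<Longrightarrow> C2_submanifold_around UNIV M x (CARD('n) - d)"
    and sym: "locally_symmetric M" using M unfolding loc_sym_C2_submanifold_def by auto
  define E where "E = {x \<in> M. \<exists>\<epsilon>>0. \<forall>z\<in>M \<inter> ball x \<epsilon>. z $ i = z $ j}"
  have "E \<subseteq> M" by (auto simp: E_def)
  have "openin (top_of_set M) E"
    unfolding openin_contains_ball
  proof (intro conjI ballI)
    fix x assume "x \<in> E"
    then obtain e where e: "e > 0" "\<forall>z\<in>M \<inter> ball x e. z $ i = z $ j" by (auto simp: E_def)
    have "y \<in> E" if "y \<in> ball x (e/2) \<inter> M" for y
    proof -
      have "ball y (e/2) \<subseteq> ball x e"
      proof
        fix w assume "w \<in> ball y (e/2)"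
        then show "w \<in> ball x e" using that dist_triangle[of x w y] by simp
      qed
      then show ?thesis using e that unfolding E_def by (auto intro!: exI[of _ "e/2"])
    qed
    then show "\<exists>e>0. ball x e \<inter> M \<subseteq> E" using e(1) by (intro exI[of _ "e/2"]) auto
  qed (auto simp: E_def)
  moreover have "openin (top_of_set M) (M - E)"
    unfolding openin_contains_ball
  proof (intro conjI ballI)
    fix x assume x: "x \<in> M - E"
    show "\<exists>e>0. ball x e \<inter> M \<subseteq> M - E"
    proof (cases "x $ i = x $ j")
      case False
      have "open {z :: (real,'n) vec. z $ i \<noteq> z $ j}" by (intro open_Collect_neq continuous_intros)
      then obtain e where "e > 0" "ball x e \<subseteq> {z. z $ i \<noteq> z $ j}"
        using False open_contains_ball by (metis (mono_tags, lifting) mem_Collect_eq)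
      then show ?thesis by (intro exI[of _ e]) (force simp: E_def)
    next
      case True
      have xM: "x \<in> M" using x by blast
      have dense: "\<exists>y\<in>M \<inter> ball x \<epsilon>. y $ i \<noteq> y $ j" if "\<epsilon> > 0" for \<epsilon>
        using x that unfolding E_def by blast
      obtain S P \<delta>0 where S: "strict_deriv_at S P x" "linear P" "\<And>p. P (S p) = S p" "\<delta>0 > 0"
        "\<And>p. p \<in> ball x \<delta>0 \<Longrightarrow> p \<in> M \<longleftrightarrow> S p = 0" "S x = 0"
        using submanifold_projection_equation[OF mfd[OF xM]] by metis
      have Pu: "P ?u = 0" using swap_direction_tangent[OF S(1,2,4,5) sym xM True dense] .
      \<comment> \<open>The factor 1/8 is tuned to a displacement of norm at most
        \<open>2 * t\<close>: then \<open>norm (S ?p) \<le> t / 4\<close>, and the correction back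
        to \<open>M\<close> changes each coordinate by at most \<open>t / 2\<close>, which cannot
        close the gap \<open>2 * t\<close> opened between the coordinates \<open>i\<close> and
        \<open>j\<close>.\<close>
      obtain \<delta>1 where \<delta>1: "\<delta>1 > 0"
        "\<And>p q. p \<in> ball x \<delta>1 \<Longrightarrow> q \<in> ball x \<delta>1 \<Longrightarrow> norm (S p - S q - P (p - q)) \<le> 1/8 * norm (p - q)"
        using strict_deriv_atE[OF S(1), of "1/8"] by auto
      obtain \<delta>2 where \<delta>2: "\<delta>2 > 0"
        "\<And>p. p \<in> ball x \<delta>2 \<Longrightarrow> \<exists>q\<in>ball x \<delta>0. S q = 0 \<and> norm (q - p) \<le> 2 * norm (S p) \<and> P (q - p) = q - p"
        using strict_deriv_projection_zero[OF S(1,2,3,6,4)] by blast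
      define r where "r = min \<delta>0 (min \<delta>1 \<delta>2)"
      have r: "r > 0" using S(4) \<delta>1(1) \<delta>2(1) by (simp add: r_def)
      have "z \<notin> E" if z: "z \<in> M" "z \<in> ball x r" for z
      proof
        assume "z \<in> E"
        then obtain e where e: "e > 0" "\<forall>q\<in>M \<inter> ball z e. q $ i = q $ j" by (auto simp: E_def)
        \<comment> \<open>\<open>q\<close> will lie within \<open>2 * t + t / 2 < e\<close> of
          \<open>z\<close>, hence where \<open>M\<close> is supposed to lie in the hyperplane; the
          second bound keeps \<open>?p\<close> in \<open>ball x r\<close>.\<close>
        define t where "t = min (e / 4) ((r - dist x z) / 4)"
        have t: "t > 0" "3 * t < e" "2 * t < r - dist x z" using e z by (auto simp: t_def min_def)
        let ?p = "z + t *\<^sub>R ?u"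
        have tu: "norm (t *\<^sub>R ?u) \<le> 2 * t" using nu t(1) by (simp add: mult.commute)
        have "dist x ?p \<le> dist x z + norm (t *\<^sub>R ?u)"
          using dist_triangle[of x ?p z] by (simp add: dist_norm)
        then have pb: "?p \<in> ball x r" using tu t unfolding mem_ball by linarith
        have "norm (S ?p - S z - P (?p - z)) \<le> 1/8 * norm (?p - z)"
          using pb z by (intro \<delta>1) (auto simp: r_def)
        moreover have "S z = 0" using S(5) z by (auto simp: r_def)
        moreover have "P (?p - z) = 0" by (simp add: linear_cmul[OF S(2)] Pu)
        ultimately have Sp: "norm (S ?p) \<le> t / 4" using tu by simp
        obtain q where q: "q \<in> ball x \<delta>0" "S q = 0" "norm (q - ?p) \<le> 2 * norm (S ?p)"
          using \<delta>2(2)[of ?p] pb by (auto simp: r_def)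
        have qM: "q \<in> M" using S(5) q by blast
        have qp: "norm (q - ?p) \<le> t / 2" using q(3) Sp by simp
        have "norm (q - z) \<le> norm (q - ?p) + norm (t *\<^sub>R ?u)"
          using norm_triangle_ineq[of "q - ?p" "t *\<^sub>R ?u"] by simp
        then have "norm (q - z) < e" using tu qp t by linarith
        then have "q \<in> ball z e" by (simp add: dist_norm norm_minus_commute)
        then have qq: "q $ i = q $ j" using e qM by blast
        have "z $ i = z $ j" using e z by simp
        then have "?p $ i - ?p $ j = 2 * t" using u by (simp add: algebra_simps)
        moreover have "\<bar>(q - ?p) $ i\<bar> \<le> t / 2" "\<bar>(q - ?p) $ j\<bar> \<le> t / 2"
          using qp component_le_norm_cart order_trans by blast+
        ultimately show False using qq t(1) unfolding vector_minus_component by linarith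
      qed
      then show ?thesis using r by (intro exI[of _ r]) auto
    qed
  qed auto
  ultimately have "E = {} \<or> E = M"
    using conn[unfolded connected_clopen, rule_format, of E] \<open>E \<subseteq> M\<close> by (simp add: closedin_def)
  moreover have "E \<noteq> M"
  proof
    assume "E = M"
    obtain y \<rho> where y: "y \<in> M" "\<rho> > 0" "\<forall>z\<in>M \<inter> ball y \<rho>. \<forall>i j. i \<noteq> j \<longrightarrow> z $ i \<noteq> z $ j"
      using gen by (elim bexE exE conjE)
    then have "y \<in> E" using \<open>E = M\<close> by blast
    then have "y $ i = y $ j" using y(1) by (auto simp: E_def)
    moreover have "y \<in> M \<inter> ball y \<rho>" using y(1,2) by simp
    ultimately show False using y(3) \<open>i \<noteq> j\<close> by blast
  qed
  ultimately have "x \<notin> E" by blast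
  then show ?thesis using \<open>x \<in> M\<close> \<open>\<epsilon> > 0\<close> by (auto simp: E_def)
qed

section \<open>Averaging the local equations over the stabiliser\<close>

definition perm_stab :: "real^'n \<Rightarrow> ('n::finite \<Rightarrow> 'n) set" where
  "perm_stab c = {g. g permutes UNIV \<and> perm_act g c = c}"

lemma perm_stab_iff: "g \<in> perm_stab c \<longleftrightarrow> g permutes UNIV \<and> (\<forall>i. c $ g i = c $ i)"
proof -
  have "perm_act g c = c \<longleftrightarrow> (\<forall>i. c $ g i = c $ i)" if g: "g permutes UNIV"
  proof -
    have "perm_act g c = c \<longleftrightarrow> (\<forall>i. c $ inv g (g i) = c $ g i)"
      unfolding vec_eq_iff perm_act_nth using permutes_inverses[OF g] by metis
    then show ?thesis using permutes_inverses[OF g] by auto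
  qed
  then show ?thesis by (auto simp: perm_stab_def)
qed

lemma finite_perm_stab: "finite (perm_stab c)"
  unfolding perm_stab_def by (rule finite_subset[OF _ finite_permutations[of UNIV]]) auto

lemma id_in_perm_stab: "id \<in> perm_stab c" by (simp add: perm_stab_def permutes_id)

lemma card_perm_stab_pos: "real (card (perm_stab c)) > 0"
  using finite_perm_stab id_in_perm_stab by (auto simp: card_gt_0_iff)

text \<open>The averages \<open>H i\<close> vanish on \<open>M\<close> near \<open>x\<close> because
  \<open>M\<close> is locally stable under the stabiliser. Conversely, from a common zero
  \<open>z\<close> of the \<open>H i\<close> the Newton method for the original equations leads to
  some \<open>q\<close> in \<open>M\<close> with \<open>q - z\<close> fixed by \<open>P\<close>. The
  averaged map \<open>S'\<close> vanishes at both points and also has derivative \<open>P\<close>,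
  so \<open>norm (q - z) \<le> 1/2 * norm (q - z)\<close> and \<open>z = q\<close>.\<close>

lemma symmetric_local_equations:
  fixes M :: "(real^'n::{finite,linorder}) set"
  assumes M: "loc_sym_C2_submanifold M d"
    and gen: "\<exists>y\<in>M. \<exists>\<rho>>0. \<forall>z\<in>M \<inter> ball y \<rho>. \<forall>i j. i \<noteq> j \<longrightarrow> z $ i \<noteq> z $ j"
    and x: "x \<in> M"
  obtains r F DF where "r > 0" "\<And>i. i < CARD('n) - d \<Longrightarrow> C2_on (ball x r) (F i)"
    "\<And>i. i < CARD('n) - d \<Longrightarrow> (F i has_derivative DF i) (at x)"
    "\<forall>w::nat \<Rightarrow> real. \<exists>v. \<forall>i<CARD('n) - d. DF i v = w i"
    "\<And>z. z \<in> ball x r \<Longrightarrow> z \<in> M \<longleftrightarrow> (\<forall>i<CARD('n) - d. F i z = 0)"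
    "\<And>i g z. i < CARD('n) - d \<Longrightarrow> g permutes UNIV \<Longrightarrow> perm_act g x = x \<Longrightarrow> F i (perm_act g z) = F i z"
proof -
  let ?k = "CARD('n) - d"
  have mfd: "C2_submanifold_around UNIV M x ?k" and sym: "locally_symmetric M"
    using M x unfolding loc_sym_C2_submanifold_def by auto
  obtain U F DF where U: "open U" "x \<in> U" and C2: "\<forall>i<?k. C2_on U (F i)"
    and D: "\<forall>i<?k. (F i has_derivative DF i) (at x)"
    and surj: "\<forall>w::nat \<Rightarrow> real. \<exists>v. \<forall>i<?k. DF i v = w i"
    and eq: "M \<inter> U = {z \<in> U. \<forall>i<?k. F i z = 0}"
    using mfd unfolding C2_submanifold_around_def by auto
  obtain v where v: "\<And>i j. i < ?k \<Longrightarrow> DF i (v j) = (if i = j then 1 else 0)"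
    using dual_vectors[OF surj] by blast
  have lin: "linear (DF i)" if "i < ?k" for i using D that has_derivative_linear by blast
  obtain \<delta> where \<delta>: "\<delta> > 0" "ball x \<delta> \<subseteq> U" using U open_contains_ball by blast
  define S where "S = (\<lambda>p. \<Sum>i<?k. F i p *\<^sub>R v i)"
  define P where "P = (\<lambda>h. \<Sum>i<?k. DF i h *\<^sub>R v i)"
  note pe = projection_equation[OF U C2 D v eq]
  have st: "strict_deriv_at S P x" and P: "linear P" and PS: "\<And>p. P (S p) = S p"
    and F0: "\<And>i p. S p = 0 \<Longrightarrow> i < ?k \<Longrightarrow> F i p = 0" and iff: "\<And>p. p \<in> U \<Longrightarrow> p \<in> M \<longleftrightarrow> S p = 0"
    unfolding S_def P_def using pe by blast+
  have DFu: "DF l (axis i 1 - axis j 1) = 0" if l: "l < ?k" and "x $ i = x $ j" for l i j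
  proof (cases "i = j")
    case True then show ?thesis using linear_0[OF lin[OF l]] by simp
  next
    case False
    have "P (axis i 1 - axis j 1) = 0"
      by (rule swap_direction_tangent[OF st P \<delta>(1) _ sym x that(2)])
        (use iff \<delta> distinct_coordinates_dense[OF M gen x False] in auto)
    then show ?thesis
      using projection_of_dual_vectors(2)[OF v lin l, of "\<lambda>i. DF i _"] linear_0[OF lin[OF l]]
      by (metis P_def)
  qed
  define G where "G = perm_stab x"
  have finG: "finite G" and idG: "id \<in> G" and cG: "real (card G) > 0"
    unfolding G_def by (rule finite_perm_stab id_in_perm_stab card_perm_stab_pos)+
  have Gp: "g permutes UNIV" "perm_act g x = x" if "g \<in> G" for g using that by (auto simp: G_def perm_stab_def)
  have fix_coord: "x $ g a = x $ a" if "g \<in> G" for g a using that by (simp add: G_def perm_stab_iff)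
  have DFg: "DF l (perm_act g w) = DF l w" if l: "l < ?k" and g: "g \<in> G" for l g w
  proof -
    have "w = perm_act id w" by simp
    also have "\<dots> = (\<Sum>a\<in>UNIV. w $ a *\<^sub>R axis a 1)" by (subst perm_act_eq_sum) (auto simp: permutes_id)
    finally have w: "w = (\<Sum>a\<in>UNIV. w $ a *\<^sub>R axis a 1)" .
    \<comment> \<open>\<open>g\<close> moves every axis within a level set of \<open>x\<close>, so
      the displacement is a combination of the directions killed by \<open>DFu\<close>.\<close>
    have "perm_act g w - w = (\<Sum>a\<in>UNIV. w $ a *\<^sub>R (axis (g a) 1 - axis a 1))"
    proof -
      have "perm_act g w = (\<Sum>a\<in>UNIV. w $ a *\<^sub>R axis (g a) 1)" using Gp(1)[OF g] by (rule perm_act_eq_sum)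
      then show ?thesis using w by (metis (no_types, lifting) scaleR_diff_right sum.cong sum_subtractf)
    qed
    also have "DF l \<dots> = 0" using DFu[OF l] fix_coord[OF g]
      by (simp add: linear_sum[OF lin[OF l]] linear_cmul[OF lin[OF l]])
    finally show ?thesis by (simp add: linear_diff[OF lin[OF l]])
  qed
  define H where "H i z = 1 / card G * (\<Sum>g\<in>G. F i (perm_act g z))" for i z
  have img: "perm_act g ` ball x r \<subseteq> ball x r" if "g \<in> G" for g r
    using dist_perm_act[OF Gp(1)[OF that], of x] Gp(2)[OF that] by auto
  have HC2: "C2_on (ball x \<delta>) (H i)" if "i < ?k" for i
    unfolding H_def
  proof (intro C2_on_cmult C2_on_sum C2_on_compose_linear[where U=U and L="perm_act _"])
    show "perm_act g ` ball x \<delta> \<subseteq> U" if "g \<in> G" for g using img[OF that] \<delta>(2) by (rule order_trans)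
  qed (use C2 that linear_perm_act in \<open>auto simp: linear_conv_bounded_linear\<close>)
  have HD: "(H i has_derivative DF i) (at x)" if "i < ?k" for i
  proof -
    have "((\<lambda>z. F i (perm_act g z)) has_derivative DF i) (at x)" if g: "g \<in> G" for g
    proof -
      have "((\<lambda>z. F i (perm_act g z)) has_derivative (\<lambda>h. DF i (perm_act g h))) (at x)"
        by (rule has_derivative_compose[OF linear_imp_has_derivative[OF linear_perm_act]])
          (use D Gp(2)[OF g] \<open>i < ?k\<close> in auto)
      then show ?thesis using DFg[OF \<open>i < ?k\<close> g] by simp
    qed
    then have "(H i has_derivative (\<lambda>h. 1 / card G * (\<Sum>g\<in>G. DF i h))) (at x)"
      unfolding H_def by (intro has_derivative_mult_right has_derivative_sum)
    moreover have "(\<lambda>h. 1 / card G * (\<Sum>g\<in>G. DF i h)) = DF i" using cG idG by auto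
    ultimately show ?thesis by simp
  qed
  have Hinv: "H i (perm_act g z) = H i z" if "g \<in> G" for i g z
  proof -
    have "(\<Sum>h\<in>G. F i (perm_act h (perm_act g z))) = (\<Sum>h\<in>G. F i (perm_act (h \<circ> g) z))"
      using that by (intro sum.cong refl) (simp add: perm_act_compose Gp)
    also have "\<dots> = (\<Sum>h\<in>G. F i (perm_act h z))"
    proof (rule sum.reindex_bij_witness[where i="\<lambda>h. h \<circ> inv g" and j="\<lambda>h. h \<circ> g"])
      have gi: "inv g permutes UNIV" "g \<circ> inv g = id" "inv g \<circ> g = id"
        using Gp(1)[OF that] permutes_inv permutes_inv_o[of g UNIV] by auto
      have "x $ inv g a = x $ a" for a
        using fix_coord[OF that, of "inv g a"] permutes_inverses(1)[OF Gp(1)[OF that]] by simp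
      then show "h \<circ> inv g \<in> G" "h \<circ> g \<in> G" if "h \<in> G" for h
        using that \<open>g \<in> G\<close> gi(1) by (auto simp: G_def perm_stab_iff permutes_compose)
      show "h \<circ> g \<circ> inv g = h" "h \<circ> inv g \<circ> g = h" for h using gi by (simp_all add: comp_assoc)
    qed auto
    finally show ?thesis by (simp add: H_def)
  qed
  define S' where "S' p = (\<Sum>i<?k. H i p *\<^sub>R v i)" for p
  have st': "strict_deriv_at S' P x" unfolding S'_def P_def
    by (intro strict_deriv_at_sum strict_deriv_at_scaleR C2_on_strict_deriv_at[of "ball x \<delta>"])
       (use HC2 HD \<delta> in auto)
  obtain \<delta>1 where \<delta>1: "\<delta>1 > 0"
    "\<And>p q. p \<in> ball x \<delta>1 \<Longrightarrow> q \<in> ball x \<delta>1 \<Longrightarrow> norm (S' p - S' q - P (p - q)) \<le> 1/2 * norm (p - q)"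
    using strict_deriv_atE[OF st', of "1/2"] by auto
  obtain \<delta>3 where \<delta>3: "\<delta>3 > 0"
    "\<And>g y. g permutes UNIV \<Longrightarrow> perm_act g x = x \<Longrightarrow> y \<in> M \<Longrightarrow> y \<in> ball x \<delta>3 \<Longrightarrow> perm_act g y \<in> M"
    using locally_symmetric_fixing[OF sym x] by blast
  \<comment> \<open>Within this radius the original equations describe \<open>M\<close>
    (\<open>\<delta>\<close>), \<open>S'\<close> separates points whose difference is fixed by
    \<open>P\<close> (\<open>\<delta>1\<close>), and the stabiliser maps points of \<open>M\<close>
    into \<open>M\<close> (\<open>\<delta>3\<close>).\<close>
  define \<eta> where "\<eta> = min \<delta> (min \<delta>1 \<delta>3)"
  have \<eta>: "\<eta> > 0" using \<delta> \<delta>1 \<delta>3 by (simp add: \<eta>_def)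
  have Sx: "S x = 0" using iff U x by blast
  obtain \<delta>2 where \<delta>2: "\<delta>2 > 0"
    "\<And>p. p \<in> ball x \<delta>2 \<Longrightarrow> \<exists>q\<in>ball x \<eta>. S q = 0 \<and> norm (q - p) \<le> 2 * norm (S p) \<and> P (q - p) = q - p"
    using strict_deriv_projection_zero[OF st P PS Sx \<eta>] by blast
  have MH: "H i z = 0" if z: "z \<in> M" "z \<in> ball x \<eta>" and i: "i < ?k" for z i
  proof -
    have "F i (perm_act g z) = 0" if "g \<in> G" for g
    proof -
      have "perm_act g z \<in> M" using \<delta>3(2)[OF Gp[OF that], of z] z by (auto simp: \<eta>_def)
      moreover have "perm_act g z \<in> ball x \<eta>" using img[OF that, of \<eta>] z(2) by blast
      then have "perm_act g z \<in> U" using \<delta>(2) by (auto simp: \<eta>_def)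
      ultimately show ?thesis using iff F0 i by blast
    qed
    then show ?thesis by (simp add: H_def)
  qed
  define r where "r = min \<eta> \<delta>2"
  show thesis
  proof (rule that[of r H DF])
    show "r > 0" using \<eta> \<delta>2 by (simp add: r_def)
    show "C2_on (ball x r) (H i)" if "i < ?k" for i
      by (rule C2_on_subset[OF HC2[OF that]]) (auto simp: r_def \<eta>_def)
    show "z \<in> M \<longleftrightarrow> (\<forall>i<?k. H i z = 0)" if z: "z \<in> ball x r" for z
    proof
      assume "z \<in> M" then show "\<forall>i<?k. H i z = 0" using MH z by (auto simp: r_def)
    next
      assume H0: "\<forall>i<?k. H i z = 0"
      obtain q where q: "q \<in> ball x \<eta>" "S q = 0" "P (q - z) = q - z"
        using \<delta>2(2)[of z] z by (auto simp: r_def)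
      have qM: "q \<in> M" using q iff \<delta>(2) by (auto simp: \<eta>_def)
      have "S' z = 0" "S' q = 0" using H0 MH[OF qM q(1)] by (simp_all add: S'_def)
      then have "norm (q - z) \<le> 1/2 * norm (q - z)"
        using \<delta>1(2)[of q z] q z by (auto simp: \<eta>_def r_def norm_minus_commute)
      then show "z \<in> M" using qM by simp
    qed
  qed (use HD surj Hinv in \<open>auto simp: G_def perm_stab_def\<close>)
qed

section \<open>Block spectral theorem\<close>

definition diag_mat :: "real^'n \<Rightarrow> real^'n^'n" where
  "diag_mat x = (\<chi> i j. if i = j then x $ i else 0)"

text \<open>The product of the orthogonal groups of the blocks, embedded block diagonally. Only the
  level sets of \<open>c\<close> enter, so no enumeration of the blocks is required.\<close>

definition block_orth :: "real^'n \<Rightarrow> (real^'n^'n) set" where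
  "block_orth c = {U. orthogonal_matrix U \<and> (\<forall>i j. c $ i \<noteq> c $ j \<longrightarrow> U $ i $ j = 0)}"

definition block_sym :: "real^'n \<Rightarrow> (real^'n^'n) set" where
  "block_sym c = {X. transpose X = X \<and> (\<forall>i j. c $ i \<noteq> c $ j \<longrightarrow> X $ i $ j = 0)}"

lemma diag_mat_nth: "diag_mat x $ i $ j = (if i = j then x $ i else 0)"
  by (simp add: diag_mat_def)

lemma linear_diag_mat: "linear diag_mat"
  by (rule linearI) (auto simp: vec_eq_iff diag_mat_nth)

lemma diag_mat_mult_nth:
  "(diag_mat x ** A) $ i $ j = x $ i * A $ i $ j"
  "(A ** diag_mat x) $ i $ j = A $ i $ j * x $ j"
  by (simp_all add: matrix_matrix_mult_def diag_mat_nth if_distrib if_distribR cong: if_cong)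

lemma diag_mat_mult: "diag_mat x ** diag_mat y = diag_mat (\<chi> i. x $ i * y $ i)"
  by (auto simp: vec_eq_iff diag_mat_mult_nth) (auto simp: diag_mat_nth)

lemma transpose_diag_mat [simp]: "transpose (diag_mat x) = diag_mat x"
  by (auto simp: vec_eq_iff transpose_def diag_mat_nth)

lemma det_diag_mat: "det (diag_mat x) = (\<Prod>i\<in>UNIV. x $ i)"
  by (subst det_diagonal) (auto simp: diag_mat_nth)

lemma norm_vec_vec_eq: "norm (A :: real^'n^'m) = sqrt (\<Sum>i\<in>UNIV. \<Sum>j\<in>UNIV. (A $ i $ j)\<^sup>2)"
  by (simp add: norm_vec_def L2_set_def sum_nonneg)

lemma norm_transpose: "norm (transpose A) = norm (A :: real^'n^'m)"
  unfolding norm_vec_vec_eq transpose_def by (subst sum.swap) simp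

lemma norm_diag_mat: "norm (diag_mat x) = norm x"
proof -
  have "(\<Sum>j\<in>UNIV. (diag_mat x $ i $ j)\<^sup>2) = (x $ i)\<^sup>2" for i
    by (simp add: diag_mat_nth if_distrib[of "\<lambda>t. t\<^sup>2"] cong: if_cong)
  then show ?thesis unfolding norm_vec_vec_eq by (simp add: norm_vec_def L2_set_def)
qed

lemma matrix_diff_distrib:
  fixes A B C :: "real^'n^'n"
  shows "A ** (B - C) = A ** B - A ** C" "(B - C) ** A = B ** A - C ** A"
  by (simp_all add: vec_eq_iff matrix_matrix_mult_def right_diff_distrib left_diff_distrib sum_subtractf)

lemma commute_diag_mat:
  assumes "\<forall>i j. c $ i \<noteq> c $ j \<longrightarrow> A $ i $ j = 0" "\<And>i j. c $ i = c $ j \<Longrightarrow> x $ i = x $ j"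
  shows "A ** diag_mat x = diag_mat x ** A"
proof -
  have "A $ i $ j * x $ j = x $ i * A $ i $ j" for i j
    using assms(1)[rule_format, of i j] assms(2)[of i j] by (cases "c $ i = c $ j") auto
  then show ?thesis by (simp add: vec_eq_iff diag_mat_mult_nth)
qed

text \<open>Entrywise, commuting with \<open>diag_mat c\<close> says
  \<open>A $ i $ j * (c $ i - c $ j) = 0\<close>. In this form closure of the block shape under
  products and conjugation is pure algebra.\<close>

lemma block_iff_commute:
  "(\<forall>i j. c $ i \<noteq> c $ j \<longrightarrow> A $ i $ j = 0) \<longleftrightarrow> A ** diag_mat c = diag_mat c ** A"
proof
  assume "A ** diag_mat c = diag_mat c ** A"
  then have "A $ i $ j * c $ j = A $ i $ j * c $ i" for i j
    by (simp add: vec_eq_iff diag_mat_mult_nth mult.commute)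
  then show "\<forall>i j. c $ i \<noteq> c $ j \<longrightarrow> A $ i $ j = 0" by (simp add: mult_cancel_left) metis
qed (rule commute_diag_mat)

lemma block_orthD:
  assumes "U \<in> block_orth c"
  shows "U ** transpose U = mat 1" "transpose U ** U = mat 1" "orthogonal_matrix U"
    "\<forall>i j. c $ i \<noteq> c $ j \<longrightarrow> U $ i $ j = 0"
  using assms by (auto simp: block_orth_def orthogonal_matrix_def)

lemma block_orth_commute:
  assumes "U \<in> block_orth c" "\<And>i j. c $ i = c $ j \<Longrightarrow> x $ i = x $ j"
  shows "U ** diag_mat x = diag_mat x ** U"
  using commute_diag_mat[OF block_orthD(4)[OF assms(1)] assms(2)] .

lemma conj_commute_diag_mat:
  assumes U: "U \<in> block_orth c" and A: "A ** diag_mat x = diag_mat x ** A"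
    and x: "\<And>i j. c $ i = c $ j \<Longrightarrow> x $ i = x $ j"
  shows "(U ** A ** transpose U) ** diag_mat x = diag_mat x ** (U ** A ** transpose U)"
proof -
  have Ut: "transpose U ** diag_mat x = diag_mat x ** transpose U"
    using arg_cong[OF block_orth_commute[OF U x], of transpose] by (simp add: matrix_transpose_mul)
  have "(U ** A ** transpose U) ** diag_mat x = U ** A ** (transpose U ** diag_mat x)"
    by (simp only: matrix_mul_assoc)
  also have "\<dots> = U ** (A ** diag_mat x) ** transpose U" by (simp only: Ut matrix_mul_assoc)
  also have "\<dots> = (U ** diag_mat x) ** A ** transpose U" by (simp only: A matrix_mul_assoc)
  also have "\<dots> = diag_mat x ** (U ** A ** transpose U)"
    by (simp only: block_orth_commute[OF U x] matrix_mul_assoc)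
  finally show ?thesis .
qed

lemma block_orth_transpose: "U \<in> block_orth c \<Longrightarrow> transpose U \<in> block_orth c"
  by (auto simp: block_orth_def) (simp add: transpose_def)

lemma mat_1_in_block_orth: "mat 1 \<in> block_orth c"
  using orthogonal_matrix_id by (auto simp: block_orth_def) (auto simp: mat_def)

lemma block_orth_mult: "U \<in> block_orth c \<Longrightarrow> V \<in> block_orth c \<Longrightarrow> U ** V \<in> block_orth c"
  unfolding block_orth_def block_iff_commute
  by (simp add: orthogonal_matrix_mul) (simp add: matrix_mul_assoc[symmetric], simp add: matrix_mul_assoc)

lemma norm_orth_mult:
  fixes U X :: "real^'n^'n"
  assumes "orthogonal_matrix U"
  shows "norm (U ** X) = norm X" "norm (X ** U) = norm X"
proof -
  have "norm (A ** transpose V) = norm A" if V: "orthogonal_matrix V" for A V :: "real^'n^'n"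
  proof -
    have "orthogonal_transformation ((*v) V)"
      using V by (simp add: orthogonal_transformation_matrix)
    then have "norm (V *v x) = norm x" for x by (simp add: orthogonal_transformation)
    moreover have "(A ** transpose V) $ i = V *v (A $ i)" for i
      by (simp add: vec_eq_iff matrix_matrix_mult_def matrix_vector_mult_def transpose_def mult.commute)
    ultimately show ?thesis by (simp add: norm_vec_def)
  qed
  note R = this
  show "norm (X ** U) = norm X" using R[of "transpose U" X] assms by simp
  have "norm (U ** X) = norm (transpose X ** transpose U)" by (metis matrix_transpose_mul norm_transpose)
  then show "norm (U ** X) = norm X" using R[OF assms] by (simp add: norm_transpose)
qed

lemma norm_conj_orth:
  fixes U X :: "real^'n^'n"
  assumes "orthogonal_matrix U"
  shows "norm (U ** X ** transpose U) = norm X"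
  using assms by (simp add: norm_orth_mult)

text \<open>All members have the norm of the identity matrix and the defining conditions are closed.
  Compactness provides the maximiser in the spectral theorem.\<close>

lemma compact_block_orth:
  fixes c :: "real^'n"
  shows "compact (block_orth c)"
proof (rule compact_eq_bounded_closed[THEN iffD2, OF conjI])
  have "norm U = norm (mat 1 :: real^'n^'n)" if "U \<in> block_orth c" for U :: "real^'n^'n"
    using norm_orth_mult(1)[OF block_orthD(3)[OF that], of "mat 1"] by simp
  then show "bounded (block_orth c)" unfolding bounded_iff by (metis order_refl)
  have "block_orth c = (\<Inter>i. \<Inter>j. {U. (transpose U ** U) $ i $ j = (mat 1 :: real^'n^'n) $ i $ j}) \<inter>
     (\<Inter>i. \<Inter>j. {U. c $ i \<noteq> c $ j \<longrightarrow> U $ i $ j = 0})"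
    by (auto simp: block_orth_def orthogonal_matrix vec_eq_iff)
  also have "closed \<dots>"
  proof (intro closed_Int closed_INT ballI)
    show "closed {U. (transpose U ** U) $ i $ j = (mat 1 :: real^'n^'n) $ i $ j}" for i j
      unfolding matrix_matrix_mult_def transpose_def
      by (intro closed_Collect_eq) (auto intro!: continuous_intros)
    show "closed {U :: real^'n^'n. c $ i \<noteq> c $ j \<longrightarrow> U $ i $ j = 0}" for i j
      by (intro closed_Collect_imp closed_Collect_eq) (auto intro!: continuous_intros)
  qed
  finally show "closed (block_orth c)" .
qed

text \<open>A rotation in the plane of \<open>i\<close> and \<open>j\<close> once
  \<open>a\<^sup>2 + b\<^sup>2 = 1\<close>. The two entries stay free parameters so that rational
  rotations, the curve of cosine and sine, and the quarter turn with \<open>a = 0\<close>,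
  \<open>b = 1\<close> are all instances.\<close>

definition givens :: "'n \<Rightarrow> 'n \<Rightarrow> real \<Rightarrow> real \<Rightarrow> real^'n^'n" where
  "givens i j a b = (\<chi> p q. if p = i then (if q = i then a else if q = j then - b else 0)
     else if p = j then (if q = i then b else if q = j then a else 0)
     else if p = q then 1 else 0)"

lemma sum_two_deltas:
  fixes f :: "'n::finite \<Rightarrow> real"
  assumes "i \<noteq> j"
  shows "(\<Sum>q\<in>UNIV. (if q = i then a else if q = j then b else 0) * f q) = a * f i + b * f j"
proof -
  have "(\<Sum>q\<in>UNIV. (if q = i then a else if q = j then b else 0) * f q) =
     (\<Sum>q\<in>UNIV. (if q = i then a * f q else 0) + (if q = j then b * f q else 0))"
    using assms by (intro sum.cong refl) auto
  then show ?thesis by (simp add: sum.distrib)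
qed

lemma givens_mult_nth:
  assumes "i \<noteq> j"
  shows "(givens i j a b ** A) $ p $ q = (if p = i then a * A $ i $ q - b * A $ j $ q
     else if p = j then b * A $ i $ q + a * A $ j $ q else A $ p $ q)"
proof (cases "p = i \<or> p = j")
  case False
  then have "(givens i j a b ** A) $ p $ q = (\<Sum>k\<in>UNIV. (if p = k then 1 else 0) * A $ k $ q)"
    by (simp add: matrix_matrix_mult_def givens_def)
  also have "\<dots> = (\<Sum>k\<in>UNIV. if p = k then A $ k $ q else 0)" by (intro sum.cong) auto
  finally have "(givens i j a b ** A) $ p $ q = (\<Sum>k\<in>UNIV. if p = k then A $ k $ q else 0)" .
  then show ?thesis using False by simp
next
  case True
  then show ?thesis
    using sum_two_deltas[OF assms, of a "- b" "\<lambda>k. A $ k $ q"] sum_two_deltas[OF assms, of b a "\<lambda>k. A $ k $ q"] assms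
    by (auto simp: matrix_matrix_mult_def givens_def)
qed

lemma transpose_givens: "i \<noteq> j \<Longrightarrow> transpose (givens i j a b) = givens i j a (- b)"
  by (auto simp: vec_eq_iff transpose_def givens_def)

lemma givens_orth:
  assumes "i \<noteq> j" "a\<^sup>2 + b\<^sup>2 = 1" "c $ i = c $ j"
  shows "givens i j a b \<in> block_orth c"
proof -
  have *: "a * a + b * b = 1" using assms(2) by (simp add: power2_eq_square)
  have "(givens i j a (- b) ** givens i j a b) $ p $ q = mat 1 $ p $ q" for p q
    unfolding givens_mult_nth[OF assms(1)] using assms(1) *
    by (auto simp: givens_def mat_def algebra_simps)
  then have "transpose (givens i j a b) ** givens i j a b = mat 1"
    by (simp add: transpose_givens[OF assms(1)] vec_eq_iff)
  then show ?thesis using assms by (auto simp: block_orth_def orthogonal_matrix givens_def)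
qed

lemma mult_givens_nth:
  assumes "i \<noteq> j"
  shows "(A ** givens i j a b) $ p $ q = (if q = i then a * A $ p $ i + b * A $ p $ j
     else if q = j then a * A $ p $ j - b * A $ p $ i else A $ p $ q)"
proof -
  have "(A ** givens i j a b) $ p $ q = (transpose (givens i j a b) ** transpose A) $ q $ p"
    by (simp add: matrix_transpose_mul[symmetric]) (simp add: transpose_def)
  then show ?thesis
    unfolding transpose_givens[OF assms] givens_mult_nth[OF assms] by (simp add: transpose_def)
qed

text \<open>Maximising \<open>\<Sum>p. w p * (U\<^sup>T X U) p p\<close> with strictly decreasing weights \<open>w\<close> over the compact group
  \<open>block_orth c\<close> diagonalises \<open>X\<close> and sorts the eigenvalues at once, as Givens rotations show.\<close>

lemma block_spectral:
  fixes X :: "real^'n::{finite,linorder}^'n::{finite,linorder}"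
  assumes X: "X \<in> block_sym c"
  obtains U y where "U \<in> block_orth c" "X = U ** diag_mat y ** transpose U"
    "\<And>i j. i \<le> j \<Longrightarrow> c $ i = c $ j \<Longrightarrow> y $ j \<le> y $ i"
proof -
  \<comment> \<open>Counting the indices above \<open>p\<close> yields strictly decreasing weights
    on an abstract finite order.\<close>
  define w where "w p = real (card {q. (p :: 'n) < q})" for p
  have w: "w j < w i" if "i < j" for i j
    unfolding w_def of_nat_less_iff using that by (intro psubset_card_mono) auto
  define \<phi> where "\<phi> U = (\<Sum>p\<in>UNIV. w p * (transpose U ** X ** U) $ p $ p)" for U
  have "continuous_on (block_orth c) \<phi>"
    unfolding \<phi>_def matrix_matrix_mult_def transpose_def by (auto intro!: continuous_intros)
  then obtain U where U: "U \<in> block_orth c" and max: "\<And>V. V \<in> block_orth c \<Longrightarrow> \<phi> V \<le> \<phi> U"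
    using continuous_attains_sup[OF compact_block_orth[of c], of \<phi>] mat_1_in_block_orth[of c] by blast
  define Y where "Y = transpose U ** X ** U"
  have Xs: "transpose X = X" using X by (simp add: block_sym_def)
  have Ysym: "Y $ p $ q = Y $ q $ p" for p q
  proof -
    have "transpose Y = Y" unfolding Y_def by (simp add: matrix_transpose_mul Xs matrix_mul_assoc)
    then have "transpose Y $ p $ q = Y $ p $ q" by simp
    then show ?thesis by (simp add: transpose_def)
  qed
  have key: "Y $ i $ j = 0 \<and> Y $ j $ j \<le> Y $ i $ i" if "i < j" "c $ i = c $ j" for i j
  proof -
    have ij: "i \<noteq> j" using that by simp
    \<comment> \<open>The competitor is \<open>U\<close> times the rotation of slope
      \<open>t = b / a\<close>. It changes \<open>\<phi>\<close> by \<open>D * (w i - w j)\<close>,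
      so \<open>D \<le> 0\<close>, and multiplying by \<open>s\<^sup>2\<close> clears the
      denominators.\<close>
    have *: "t\<^sup>2 * (Y $ j $ j - Y $ i $ i) + 2 * t * Y $ i $ j \<le> 0" for t
    proof -
      define s where "s = sqrt (1 + t\<^sup>2)"
      have s: "s > 0" "s\<^sup>2 = 1 + t\<^sup>2" unfolding s_def by (auto simp: add_pos_nonneg)
      define a b where "a = 1 / s" and "b = t / s"
      have ab: "a\<^sup>2 + b\<^sup>2 = 1" using s
        by (simp add: a_def b_def power_divide add_divide_distrib[symmetric]) (metis less_numeral_extra(3) zero_less_power)
      let ?R = "givens i j a b"
      have "U ** ?R \<in> block_orth c" using U givens_orth[of i j a b c] that ij ab by (intro block_orth_mult) auto
      then have le: "\<phi> (U ** ?R) \<le> \<phi> U" by (rule max)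
      have eq: "transpose (U ** ?R) ** X ** (U ** ?R) = givens i j a (- b) ** (Y ** ?R)"
        by (simp add: matrix_transpose_mul transpose_givens[OF ij] Y_def matrix_mul_assoc)
      have d: "(givens i j a (- b) ** (Y ** ?R)) $ p $ p = (if p = i then a\<^sup>2 * Y $ i $ i + 2 * a * b * Y $ i $ j + b\<^sup>2 * Y $ j $ j
          else if p = j then b\<^sup>2 * Y $ i $ i - 2 * a * b * Y $ i $ j + a\<^sup>2 * Y $ j $ j else Y $ p $ p)" for p
        unfolding givens_mult_nth[OF ij] mult_givens_nth[OF ij] using ij Ysym[of j i]
        by (auto simp: algebra_simps power2_eq_square)
      have a2: "a\<^sup>2 = 1 - b\<^sup>2" using ab by simp
      define D where "D = b\<^sup>2 * (Y $ j $ j - Y $ i $ i) + 2 * a * b * Y $ i $ j"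
      have "\<phi> (U ** ?R) - \<phi> U = (\<Sum>p\<in>UNIV. w p * ((givens i j a (- b) ** (Y ** ?R)) $ p $ p - Y $ p $ p))"
        unfolding \<phi>_def eq Y_def[symmetric] by (simp add: sum_subtractf right_diff_distrib)
      also have "\<dots> = (\<Sum>p\<in>UNIV. (if p = i then D else if p = j then - D else 0) * w p)"
        unfolding d D_def a2 by (intro sum.cong refl) (auto simp: algebra_simps)
      also have "\<dots> = D * (w i - w j)" unfolding sum_two_deltas[OF ij] by (simp add: algebra_simps)
      finally have "D * (w i - w j) \<le> 0" using le by simp
      then have "D \<le> 0" using w[OF that(1)] by (simp add: mult_le_0_iff)
      then have "s\<^sup>2 * D \<le> 0" by (simp add: mult_nonneg_nonpos)
      moreover have "s\<^sup>2 * D = t\<^sup>2 * (Y $ j $ j - Y $ i $ i) + 2 * t * Y $ i $ j"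
        using s(1) by (simp add: D_def a_def b_def field_simps power2_eq_square)
      ultimately show ?thesis by simp
    qed
    define e h where "e = Y $ i $ i - Y $ j $ j" and "h = Y $ i $ j"
    have **: "2 * t * h \<le> t\<^sup>2 * e" for t using *[of t] by (simp add: e_def h_def algebra_simps)
    have "2 * h \<le> e" "- (2 * h) \<le> e" using **[of 1] **[of "-1"] by auto
    then have e: "e \<ge> 0" by linarith
    \<comment> \<open>The quadratic bound is sharpest at \<open>t = h / e\<close>; replacing
      \<open>e\<close> by \<open>e + 1\<close> avoids division by zero and still forces
      \<open>h = 0\<close>.\<close>
    have "2 * (h / (e + 1)) * h \<le> (h / (e + 1))\<^sup>2 * e" by (rule **)
    also have "\<dots> \<le> (h / (e + 1))\<^sup>2 * (e + 1)" by (intro mult_left_mono) auto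
    also have "\<dots> = h\<^sup>2 / (e + 1)" using e by (simp add: power2_eq_square)
    finally have "2 * h\<^sup>2 / (e + 1) \<le> h\<^sup>2 / (e + 1)" by (simp add: power2_eq_square)
    then have "h\<^sup>2 \<le> 0" using e by (simp add: divide_le_cancel)
    then show ?thesis using e by (simp add: e_def h_def)
  qed
  have Yblock: "Y $ p $ q = 0" if "c $ p \<noteq> c $ q" for p q
  proof -
    have "X ** diag_mat c = diag_mat c ** X" using X by (simp add: block_sym_def block_iff_commute)
    then have "Y ** diag_mat c = diag_mat c ** Y"
      using conj_commute_diag_mat[OF block_orth_transpose[OF U], of X c] by (simp add: Y_def)
    then show ?thesis using that by (simp add: block_iff_commute[symmetric])
  qed
  define y where "y = (\<chi> i. Y $ i $ i)"
  have "Y $ p $ q = 0" if "p \<noteq> q" for p q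
  proof (cases "c $ p = c $ q")
    case True
    then show ?thesis using key[of p q] key[of q p] Ysym[of p q] that by (cases p q rule: linorder_cases) auto
  qed (use Yblock in blast)
  then have Y: "Y = diag_mat y" by (auto simp: vec_eq_iff diag_mat_nth y_def)
  have "U ** Y ** transpose U = (U ** transpose U) ** X ** (U ** transpose U)"
    by (simp only: Y_def matrix_mul_assoc)
  then have XU: "X = U ** diag_mat y ** transpose U"
    unfolding Y using block_orthD(1)[OF U] by simp
  have "y $ j \<le> y $ i" if "i \<le> j" "c $ i = c $ j" for i j
    using key[of i j] that by (cases "i = j") (auto simp: y_def)
  then show thesis using that U XU by blast
qed

text \<open>Padding the block by the identity outside \<open>S\<close> turns its characteristic
  polynomial into a determinant of full size: permutations that move an index outside
  \<open>S\<close> meet a zero entry. Multiplicativity of \<open>det\<close> thereby becomes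
  available.\<close>

lemma poly_block_charpoly:
  "poly (block_charpoly S X) t =
    det (\<chi> i j. if i \<in> S \<and> j \<in> S then (if i = j then t else 0) - X $ i $ j else if i = j then 1 else 0)"
    (is "_ = det ?B")
proof -
  have "det ?B = (\<Sum>p | p permutes UNIV. of_int (sign p) * (\<Prod>i\<in>UNIV. ?B $ i $ p i))"
    by (simp add: det_def)
  also have "\<dots> = (\<Sum>p | p permutes S. of_int (sign p) * (\<Prod>i\<in>UNIV. ?B $ i $ p i))"
  proof (rule sum.mono_neutral_right)
    show "finite {p. p permutes (UNIV :: 'a set)}" by (simp add: finite_permutations)
    show "{p. p permutes S} \<subseteq> {p. p permutes UNIV}" using permutes_subset by blast
    show "\<forall>p\<in>{p. p permutes UNIV} - {p. p permutes S}. of_int (sign p) * (\<Prod>i\<in>UNIV. ?B $ i $ p i) = 0"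
    proof
      fix p assume "p \<in> {p. p permutes UNIV} - {p. p permutes S}"
      then have p: "p permutes UNIV" "\<not> p permutes S" by auto
      have "\<exists>i. i \<notin> S \<and> p i \<noteq> i" using p by (auto simp: permutes_def)
      then obtain i where "i \<notin> S" "p i \<noteq> i" by blast
      then have "?B $ i $ p i = 0" by auto
      then have "(\<Prod>i\<in>UNIV. ?B $ i $ p i) = 0" by (intro prod_zero bexI[of _ i]) auto
      then show "of_int (sign p) * (\<Prod>i\<in>UNIV. ?B $ i $ p i) = 0" by simp
    qed
  qed
  also have "\<dots> = poly (block_charpoly S X) t"
    unfolding block_charpoly_def poly_sum poly_mult poly_prod
  proof (intro sum.cong refl arg_cong2[where f="(*)"])
    fix p assume "p \<in> {p. p permutes S}"
    then have p: "p permutes S" by simp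
    have "(\<Prod>i\<in>UNIV. ?B $ i $ p i) = (\<Prod>i\<in>S. ?B $ i $ p i)"
      using permutes_not_in[OF p] by (intro prod.mono_neutral_right) auto
    also have "\<dots> = (\<Prod>i\<in>S. poly ((if i = p i then [:0, 1:] else 0) - [:X $ i $ p i:]) t)"
      using permutes_in_image[OF p] by (intro prod.cong refl) auto
    finally show "(\<Prod>i\<in>UNIV. ?B $ i $ p i) = (\<Prod>i\<in>S. poly ((if i = p i then [:0, 1:] else 0) - [:X $ i $ p i:]) t)" .
    show "real_of_int (sign p) = poly (of_int (sign p)) t" by simp
  qed
  finally show ?thesis ..
qed

lemma order_prod_linear_factors:
  fixes y :: "'i \<Rightarrow> real"
  assumes "finite S"
  shows "order t (\<Prod>j\<in>S. [:- y j, 1:]) = card {j \<in> S. y j = t}"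
  using assms
proof (induction S rule: finite_induct)
  case (insert j S)
  have "order t (\<Prod>j\<in>insert j S. [:- y j, 1:]) = order t [:- y j, 1:] + card {j \<in> S. y j = t}"
    using insert by (simp add: order_mult del: mult_pCons_left mult_pCons_right)
  moreover have "order t [:- y j, 1:] = (if y j = t then 1 else 0)"
    using order_power_n_n[of t 1] by (auto intro: order_0I)
  moreover have "{k \<in> insert j S. y k = t} = (if y j = t then insert j {k \<in> S. y k = t} else {k \<in> S. y k = t})"
    by auto
  ultimately show ?case using insert by auto
qed simp

text \<open>The padded matrix is \<open>diag_mat d - diag_mat p ** ?X\<close> with \<open>d\<close>
  and \<open>p\<close> constant on blocks. Both diagonal matrices commute with \<open>U\<close>, so
  the whole matrix is a conjugate of a diagonal one.\<close>

lemma block_charpoly_conj_diag: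
  fixes U :: "real^'n^'n"
  assumes U: "U \<in> block_orth c"
  shows "block_charpoly {j. c $ j = c $ i} (U ** diag_mat y ** transpose U) = (\<Prod>j | c $ j = c $ i. [:- y $ j, 1:])"
proof (rule poly_eq_poly_eq_iff[THEN iffD1], rule ext)
  fix t :: real
  let ?S = "{j. c $ j = c $ i}" and ?X = "U ** diag_mat y ** transpose U"
  define d where "d = (\<chi> k. if c $ k = c $ i then t else 1)"
  define p where "p = (\<chi> k. if c $ k = c $ i then 1 else (0 :: real))"
  have "diag_mat y ** diag_mat c = diag_mat c ** diag_mat y" by (simp add: diag_mat_mult mult.commute)
  then have "?X ** diag_mat c = diag_mat c ** ?X"
    using conj_commute_diag_mat[OF U, of "diag_mat y" c] by simp
  then have Xb: "?X $ k $ l = 0" if "c $ k \<noteq> c $ l" for k l using that block_iff_commute[of c ?X] by blast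
  have "(\<chi> k l. if k \<in> ?S \<and> l \<in> ?S then (if k = l then t else 0) - ?X $ k $ l else if k = l then 1 else 0)
     = diag_mat d - diag_mat p ** ?X"
    using Xb by (auto simp: vec_eq_iff diag_mat_mult_nth d_def p_def) (auto simp: diag_mat_nth)
  also have "\<dots> = U ** (diag_mat d - diag_mat p ** diag_mat y) ** transpose U"
  proof -
    have c: "U ** diag_mat d = diag_mat d ** U" "U ** diag_mat p = diag_mat p ** U"
      by (rule block_orth_commute[OF U]; simp add: d_def p_def)+
    have "U ** diag_mat d ** transpose U = diag_mat d"
      by (simp add: c matrix_mul_assoc[symmetric] block_orthD(1)[OF U])
    moreover have "U ** (diag_mat p ** diag_mat y) ** transpose U = diag_mat p ** ?X"
      by (simp only: matrix_mul_assoc c)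
    ultimately show ?thesis by (simp add: matrix_diff_distrib)
  qed
  finally have "poly (block_charpoly ?S ?X) t = det (U ** (diag_mat d - diag_mat p ** diag_mat y) ** transpose U)"
    by (simp only: poly_block_charpoly)
  also have "\<dots> = det (U ** transpose U) * det (diag_mat d - diag_mat p ** diag_mat y)"
    by (simp add: det_mul)
  also have "\<dots> = det (diag_mat (\<chi> k. d $ k - p $ k * y $ k))"
  proof -
    have "diag_mat d - diag_mat p ** diag_mat y = diag_mat (\<chi> k. d $ k - p $ k * y $ k)"
      by (simp add: diag_mat_mult) (simp add: vec_eq_iff diag_mat_nth)
    then show ?thesis using block_orthD(1)[OF U] by simp
  qed
  also have "\<dots> = (\<Prod>k\<in>UNIV. d $ k - p $ k * y $ k)" by (simp add: det_diag_mat)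
  also have "\<dots> = (\<Prod>k\<in>?S. d $ k - p $ k * y $ k)"
    by (rule prod.mono_neutral_right) (auto simp: d_def p_def)
  also have "\<dots> = poly (\<Prod>j | c $ j = c $ i. [:- y $ j, 1:]) t"
    unfolding poly_prod by (intro prod.cong) (auto simp: d_def p_def)
  finally show "poly (block_charpoly ?S ?X) t = poly (\<Prod>j | c $ j = c $ i. [:- y $ j, 1:]) t" .
qed

text \<open>Equal fibre sizes give upper level sets of equal size. If \<open>g i < f i\<close>,
  monotonicity puts \<open>{j \<in> S. g j \<ge> f i}\<close> inside
  \<open>{j \<in> S. f j \<ge> f i}\<close>, and \<open>i\<close> lies only in the latter.\<close>

lemma decreasing_eq_if_same_fibres:
  fixes f g :: "'i::linorder \<Rightarrow> real"
  assumes S: "finite S" and f: "\<forall>j\<in>S. \<forall>j'\<in>S. j \<le> j' \<longrightarrow> f j' \<le> f j" and g: "\<forall>j\<in>S. \<forall>j'\<in>S. j \<le> j' \<longrightarrow> g j' \<le> g j"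
    and fib: "\<And>t. card {j \<in> S. f j = t} = card {j \<in> S. g j = t}" and i: "i \<in> S"
  shows "f i \<le> g i"
proof (rule ccontr)
  assume lt: "\<not> f i \<le> g i"
  let ?T = "f ` S \<union> g ` S"
  have fibsum: "card {j \<in> S. h j \<ge> s} = (\<Sum>t\<in>?T. if t \<ge> s then card {j \<in> S. h j = t} else 0)"
    if "h ` S \<subseteq> ?T" for h s
  proof -
    have "(\<Sum>t\<in>?T. \<Sum>j | j \<in> {j \<in> S. h j \<ge> s} \<and> h j = t. 1) = (\<Sum>j\<in>{j \<in> S. h j \<ge> s}. 1 :: nat)"
      using S that by (intro sum.group) auto
    moreover have "(\<Sum>j | j \<in> {j \<in> S. h j \<ge> s} \<and> h j = t. 1 :: nat) = (if t \<ge> s then card {j \<in> S. h j = t} else 0)" for t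
    proof -
      have "{j. j \<in> {j \<in> S. h j \<ge> s} \<and> h j = t} = (if t \<ge> s then {j \<in> S. h j = t} else {})" by auto
      then show ?thesis by (simp only: sum_constant) auto
    qed
    ultimately show ?thesis by simp
  qed
  have "card {j \<in> S. f j \<ge> f i} = card {j \<in> S. g j \<ge> f i}"
    by (simp only: fibsum[of f] fibsum[of g] Un_upper1 Un_upper2 fib)
  moreover have "{j \<in> S. g j \<ge> f i} \<subset> {j \<in> S. f j \<ge> f i}"
  proof
    show "{j \<in> S. g j \<ge> f i} \<subseteq> {j \<in> S. f j \<ge> f i}"
    proof
      fix j assume j: "j \<in> {j \<in> S. g j \<ge> f i}"
      then have "\<not> i \<le> j" using g[rule_format, of i j] i lt by auto
      then have "j \<le> i" by simp
      then show "j \<in> {j \<in> S. f j \<ge> f i}" using f i j by auto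
    qed
    show "{j \<in> S. g j \<ge> f i} \<noteq> {j \<in> S. f j \<ge> f i}" using i lt by auto
  qed
  then have "card {j \<in> S. g j \<ge> f i} < card {j \<in> S. f j \<ge> f i}" using S by (intro psubset_card_mono) auto
  ultimately show False by simp
qed

text \<open>Root multiplicities of the block characteristic polynomials together with the order
  inside each block determine a vector uniquely, so the definite description in
  \<open>lambda_sig\<close> picks \<open>y\<close>.\<close>

lemma lambda_sig_conj_diag:
  fixes U :: "real^'n::{finite,linorder}^'n::{finite,linorder}"
  assumes orb: "\<And>i. orb \<sigma> i = {j. c $ j = c $ i}" and U: "U \<in> block_orth c"
    and y: "\<And>i j. i \<le> j \<Longrightarrow> c $ i = c $ j \<Longrightarrow> y $ j \<le> y $ i"
  shows "lambda_sig \<sigma> (U ** diag_mat y ** transpose U) = y"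
proof -
  let ?X = "U ** diag_mat y ** transpose U"
  have ord: "order t (block_charpoly {j. c $ j = c $ i} ?X) = card {j \<in> {j. c $ j = c $ i}. y $ j = t}" for i t
    unfolding block_charpoly_conj_diag[OF U] by (rule order_prod_linear_factors) simp
  show ?thesis
    unfolding lambda_sig_def orb ord
  proof (rule the_equality)
    fix z assume z: "\<forall>i. (\<forall>j\<in>{j. c $ j = c $ i}. \<forall>j'\<in>{j. c $ j = c $ i}. j \<le> j' \<longrightarrow> z $ j' \<le> z $ j) \<and>
             (\<forall>t. card {j \<in> {j. c $ j = c $ i}. z $ j = t} = card {j \<in> {j. c $ j = c $ i}. y $ j = t})"
    have "z $ i \<le> y $ i" "y $ i \<le> z $ i" for i
      by (rule decreasing_eq_if_same_fibres[where S="{j. c $ j = c $ i}"]; use z y in force)+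
    then show "z = y" by (simp add: vec_eq_iff order_antisym)
  qed (use y in auto)
qed

section \<open>Approximation by polynomials in C2\<close>

text \<open>A polynomial kernel of mass 1 on \<open>B\<close>. It is nonnegative there as soon as
  \<open>L\<close> bounds \<open>z \<bullet> z\<close> on \<open>B\<close>, and high powers
  concentrate it at 0.\<close>

definition landau_kernel :: "real \<Rightarrow> 'a::euclidean_space set \<Rightarrow> nat \<Rightarrow> 'a \<Rightarrow> real" where
  "landau_kernel L B k z = (1 - (z \<bullet> z) / L) ^ k / integral B (\<lambda>z. (1 - (z \<bullet> z) / L) ^ k)"

text \<open>The variable \<open>x\<close> sits in \<open>\<phi>\<close>, so differentiation in
  \<open>x\<close> falls on \<open>\<phi>\<close> and leaves the kernel alone; the target is a
  Banach space so that the same formula covers a function and its derivatives.\<close>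

definition conv_on :: "'a::euclidean_space set \<Rightarrow> ('a \<Rightarrow> real) \<Rightarrow> ('a \<Rightarrow> 'b::banach) \<Rightarrow> 'a \<Rightarrow> 'b" where
  "conv_on B K \<phi> x = integral B (\<lambda>z. K z *\<^sub>R \<phi> (x - z))"

lemma continuous_on_landau_kernel: "continuous_on S (landau_kernel L B k)"
  unfolding landau_kernel_def divide_inverse by (intro continuous_intros)

text \<open>Near 0 uniform continuity of \<open>\<phi>\<close> controls the error. Farther than
  \<open>\<delta>\<close> from 0 the kernel is at most \<open>(q/m) ^ k / V\<close>, with
  \<open>V\<close> the volume of a small box around which the unnormalised kernel is at least
  \<open>m ^ k\<close>; as \<open>q < m\<close>, this part decays geometrically.\<close>

lemma landau_kernel_conv_uniform_limit:
  fixes \<phi> :: "'a::euclidean_space \<Rightarrow> 'b::banach"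
  assumes \<phi>: "continuous_on UNIV \<phi>" and C: "compact C"
    and L: "L > 0" "\<And>z. z \<in> cbox a b \<Longrightarrow> z \<bullet> z \<le> L" and 0: "0 \<in> box a b"
  shows "uniform_limit C (\<lambda>k. conv_on (cbox a b) (landau_kernel L (cbox a b) k) \<phi>) \<phi> sequentially"
proof (rule uniform_limitI)
  fix \<epsilon> :: real assume \<epsilon>: "\<epsilon> > 0"
  let ?B = "cbox a b"
  define h where "h z = 1 - (z \<bullet> z) / L" for z :: 'a
  define I where "I k = integral ?B (\<lambda>z. h z ^ k)" for k
  define K where "K k = landau_kernel L ?B k" for k
  have K: "K k z = h z ^ k / I k" for k z by (simp add: K_def landau_kernel_def h_def I_def)
  have h01: "0 \<le> h z" "h z \<le> 1" if "z \<in> ?B" for z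
    using L(1) L(2)[OF that] by (auto simp: h_def)
  have hc: "continuous_on S (\<lambda>z. h z ^ k)" for S k
    unfolding h_def divide_inverse by (intro continuous_intros)
  \<comment> \<open>A compact set containing every argument at which \<open>\<phi>\<close> is
    evaluated: the points \<open>x - z\<close> and, through the inserted 0, the points
    \<open>x\<close>.\<close>
  define D where "D = {x - y | x y. x \<in> C \<and> y \<in> insert 0 ?B}"
  have D: "compact D" unfolding D_def using C by (intro compact_differences) auto
  have inD: "x - z \<in> D" "x \<in> D" if "x \<in> C" "z \<in> ?B" for x z
  proof -
    show "x - z \<in> D" using that unfolding D_def by blast
    have "x = x - 0" by simp
    then show "x \<in> D" using that unfolding D_def by blast
  qed
  have cD: "continuous_on D \<phi>" using \<phi> continuous_on_subset by blast
  obtain M0 where M0: "\<And>x. x \<in> D \<Longrightarrow> norm (\<phi> x) \<le> M0"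
    using compact_imp_bounded[OF compact_continuous_image[OF cD D]] by (auto simp: bounded_iff)
  define M where "M = max M0 0"
  have M: "M \<ge> 0" "\<And>x. x \<in> D \<Longrightarrow> norm (\<phi> x) \<le> M" using M0 by (force simp: M_def)+
  have "uniformly_continuous_on D \<phi>" using compact_uniformly_continuous[OF cD D] .
  then obtain \<delta>0 where \<delta>0: "\<delta>0 > 0" "\<And>x x'. x \<in> D \<Longrightarrow> x' \<in> D \<Longrightarrow> dist x' x < \<delta>0 \<Longrightarrow> dist (\<phi> x') (\<phi> x) < \<epsilon> / 2"
    unfolding uniformly_continuous_on_def using \<epsilon> half_gt_zero by metis
  \<comment> \<open>The bound by \<open>sqrt L\<close> makes \<open>q\<close> below nonnegative, as
    its powers require.\<close>
  define \<delta> where "\<delta> = min \<delta>0 (sqrt L)"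
  have \<delta>: "\<delta> > 0" "\<delta> \<le> \<delta>0" "\<delta>\<^sup>2 \<le> L"
  proof -
    show "\<delta> > 0" "\<delta> \<le> \<delta>0" using \<delta>0 L by (auto simp: \<delta>_def)
    have "\<delta> \<le> sqrt L" by (simp add: \<delta>_def)
    then have "\<delta>\<^sup>2 \<le> (sqrt L)\<^sup>2" using \<open>\<delta> > 0\<close> by (intro power_mono) auto
    then show "\<delta>\<^sup>2 \<le> L" using L by simp
  qed
  \<comment> \<open>\<open>q\<close> bounds \<open>h\<close> from above outside the ball of radius
    \<open>\<delta>\<close>, and \<open>m\<close> bounds it from below inside the ball of half that
    radius.\<close>
  define q m where "q = 1 - \<delta>\<^sup>2 / L" and "m = 1 - (\<delta>/2)\<^sup>2 / L"
  have q: "0 \<le> q" using \<delta> L by (simp add: q_def)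
  have "(\<delta>/2)\<^sup>2 / L < \<delta>\<^sup>2 / L" using \<delta> L by (intro divide_strict_right_mono) (auto simp: power2_eq_square)
  then have qm: "q < m" by (simp add: q_def m_def)
  have "open (box a b \<inter> ball 0 (\<delta>/2))" "0 \<in> box a b \<inter> ball 0 (\<delta>/2)" using 0 \<delta> by auto
  then obtain a' b' where B': "cbox a' b' \<subseteq> box a b \<inter> ball 0 (\<delta>/2)" "\<forall>i\<in>Basis. a' \<bullet> i < b' \<bullet> i"
    using open_contains_cbox by metis
  define V where "V = measure lborel (cbox a' b')"
  have V: "V > 0" using B'(2) by (simp add: V_def content_pos_lt)
  have B'B: "cbox a' b' \<subseteq> ?B" using B'(1) box_subset_cbox by blast
  have hm: "m \<le> h z" if "z \<in> cbox a' b'" for z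
  proof -
    have "norm z < \<delta>/2" using B' that by auto
    then have "z \<bullet> z \<le> (\<delta>/2)\<^sup>2" using power_mono[of "norm z" "\<delta>/2" 2] by (simp add: power2_norm_eq_inner)
    then have "(z \<bullet> z) / L \<le> (\<delta>/2)\<^sup>2 / L" using L by (intro divide_right_mono) auto
    then show ?thesis by (simp add: h_def m_def)
  qed
  have Iint: "(\<lambda>z. h z ^ k) integrable_on cbox u v" for k u v by (intro integrable_continuous hc)
  have IV: "m ^ k * V \<le> I k" for k
  proof -
    have "m ^ k * V = integral (cbox a' b') (\<lambda>z. m ^ k)" by (simp add: V_def mult.commute)
    also have "\<dots> \<le> integral (cbox a' b') (\<lambda>z. h z ^ k)"
      using hm qm q by (intro integral_le Iint power_mono) auto
    also have "\<dots> \<le> I k" unfolding I_def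
      using B'B h01 by (intro integral_subset_le Iint) auto
    finally show ?thesis .
  qed
  have m0: "m > 0" using q qm by simp
  have I0: "I k > 0" for k using IV[of k] m0 V by (smt (verit) mult_pos_pos zero_less_power)
  have Kc: "continuous_on S (K k)" for S k unfolding K_def by (rule continuous_on_landau_kernel)
  have K1: "integral ?B (K k) = 1" for k
    unfolding K using I0[of k] by (simp add: I_def)
  have Kle: "K k z \<le> (q/m) ^ k / V" if "z \<in> ?B" "norm z \<ge> \<delta>" for k z
  proof -
    have "\<delta>\<^sup>2 \<le> z \<bullet> z" using power_mono[OF that(2), of 2] \<delta> by (simp add: power2_norm_eq_inner)
    then have "\<delta>\<^sup>2 / L \<le> (z \<bullet> z) / L" using L by (intro divide_right_mono) auto
    then have "h z \<le> q" by (simp add: h_def q_def)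
    then have "h z ^ k \<le> q ^ k" using h01[OF that(1)] by (intro power_mono) auto
    then have "K k z \<le> q ^ k / (m ^ k * V)"
      unfolding K using IV[of k] m0 V q by (intro frac_le) auto
    then show ?thesis by (simp add: power_divide)
  qed
  have K0: "K k z \<ge> 0" if "z \<in> ?B" for k z unfolding K using h01[OF that] I0[of k] by simp
  have "(\<lambda>k. (q/m) ^ k) \<longlonglongrightarrow> 0" using q qm m0 by (intro LIMSEQ_power_zero) auto
  then have "(\<lambda>k. 2 * M * measure lborel ?B / V * (q/m) ^ k) \<longlonglongrightarrow> 2 * M * measure lborel ?B / V * 0"
    by (intro tendsto_mult tendsto_const)
  then have "\<forall>\<^sub>F k in sequentially. 2 * M * measure lborel ?B / V * (q/m) ^ k < \<epsilon> / 2"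
    using \<epsilon> by (intro order_tendstoD) auto
  then show "\<forall>\<^sub>F k in sequentially. \<forall>x\<in>C. dist (conv_on ?B (landau_kernel L ?B k) \<phi> x) (\<phi> x) < \<epsilon>"
  proof eventually_elim
    case (elim k)
    show ?case
    proof
      fix x assume x: "x \<in> C"
      have c1: "continuous_on ?B (\<lambda>z. \<phi> (x - z))"
        by (intro continuous_intros continuous_on_compose2[OF \<phi>]) auto
      have i1: "(\<lambda>z. K k z *\<^sub>R \<phi> (x - z)) integrable_on ?B"
        by (intro integrable_continuous continuous_on_scaleR Kc c1)
      have i2: "(\<lambda>z. K k z *\<^sub>R \<phi> x) integrable_on ?B"
        by (intro integrable_continuous continuous_intros Kc)
      have "integral ?B (\<lambda>z. K k z *\<^sub>R \<phi> x) = \<phi> x"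
        using has_integral_scaleR_left[OF integrable_integral[OF integrable_continuous[OF Kc[of ?B k]]], of "\<phi> x"]
        by (simp add: K1 integral_unique)
      then have "conv_on ?B (K k) \<phi> x - \<phi> x = integral ?B (\<lambda>z. K k z *\<^sub>R \<phi> (x - z) - K k z *\<^sub>R \<phi> x)"
        using integral_diff[OF i1 i2] by (simp add: conv_on_def)
      also have "norm \<dots> \<le> integral ?B (\<lambda>z. K k z * (\<epsilon> / 2) + 2 * M * ((q/m) ^ k / V))"
      proof (rule integral_norm_bound_integral)
        show "(\<lambda>z. K k z *\<^sub>R \<phi> (x - z) - K k z *\<^sub>R \<phi> x) integrable_on ?B" using i1 i2 by (rule integrable_diff)
        show "(\<lambda>z. K k z * (\<epsilon> / 2) + 2 * M * ((q/m) ^ k / V)) integrable_on ?B"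
          by (intro integrable_continuous continuous_intros Kc)
        fix z assume z: "z \<in> ?B"
        have e: "norm (K k z *\<^sub>R \<phi> (x - z) - K k z *\<^sub>R \<phi> x) = K k z * norm (\<phi> (x - z) - \<phi> x)"
          using K0[OF z] by (simp add: scaleR_diff_right[symmetric])
        have q0: "0 \<le> (q/m) ^ k / V" using q m0 V by simp
        show "norm (K k z *\<^sub>R \<phi> (x - z) - K k z *\<^sub>R \<phi> x) \<le> K k z * (\<epsilon> / 2) + 2 * M * ((q/m) ^ k / V)"
        proof (cases "norm z < \<delta>")
          case True
          then have "dist (\<phi> (x - z)) (\<phi> x) < \<epsilon> / 2"
            using \<delta> inD[OF x z] by (intro \<delta>0(2)) (auto simp: dist_norm)
          then have "K k z * norm (\<phi> (x - z) - \<phi> x) \<le> K k z * (\<epsilon> / 2)"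
            using K0[OF z] by (intro mult_left_mono) (auto simp: dist_norm)
          then show ?thesis unfolding e using M q0 mult_nonneg_nonneg[of "2 * M"] by (smt (verit))
        next
          case False
          have "norm (\<phi> (x - z) - \<phi> x) \<le> 2 * M"
            using norm_triangle_ineq4[of "\<phi> (x - z)" "\<phi> x"] M(2)[OF inD(1)[OF x z]] M(2)[OF inD(2)[OF x z]] by linarith
          then have "K k z * norm (\<phi> (x - z) - \<phi> x) \<le> (q/m) ^ k / V * (2 * M)"
            using Kle[OF z, of k] K0[OF z] False q0 by (intro mult_mono) auto
          moreover have "0 \<le> K k z * (\<epsilon> / 2)" using K0[OF z] \<epsilon> by simp
          ultimately show ?thesis unfolding e by (simp add: mult.commute)
        qed
      qed
      also have "\<dots> = \<epsilon> / 2 + 2 * M * measure lborel ?B / V * (q/m) ^ k"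
      proof -
        have "integral ?B (\<lambda>z. K k z * (\<epsilon> / 2) + 2 * M * ((q/m) ^ k / V)) =
           integral ?B (\<lambda>z. K k z * (\<epsilon> / 2)) + integral ?B (\<lambda>z. 2 * M * ((q/m) ^ k / V))"
          by (intro integral_add integrable_continuous continuous_intros Kc)
        then show ?thesis using K1[of k] by (simp add: field_simps)
      qed
      also have "\<dots> < \<epsilon>" using elim by simp
      finally show "dist (conv_on ?B (landau_kernel L ?B k) \<phi> x) (\<phi> x) < \<epsilon>" by (simp add: dist_norm K_def)
    qed
  qed
qed

lemma conv_on_has_derivative:
  fixes \<phi> :: "'a::euclidean_space \<Rightarrow> 'b::banach" and \<phi>' :: "'a \<Rightarrow> 'a \<Rightarrow>\<^sub>L 'b"
  assumes \<phi>: "\<And>x. (\<phi> has_derivative blinfun_apply (\<phi>' x)) (at x)" and c: "continuous_on UNIV \<phi>'"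
    and K: "continuous_on (cbox a b) K"
  shows "(conv_on (cbox a b) K \<phi> has_derivative blinfun_apply (conv_on (cbox a b) K \<phi>' x)) (at x)"
proof -
  have c\<phi>: "continuous_on UNIV \<phi>"
    by (rule has_derivative_continuous_on, rule has_derivative_at_withinI, rule \<phi>)
  have "((\<lambda>x. integral (cbox a b) (\<lambda>z. K z *\<^sub>R \<phi> (x - z))) has_derivative
     blinfun_apply (integral (cbox a b) (\<lambda>z. K z *\<^sub>R \<phi>' (x - z)))) (at x within UNIV)"
  proof (rule leibniz_rule)
    fix x z
    have "((\<lambda>x. \<phi> (x - z)) has_derivative blinfun_apply (\<phi>' (x - z))) (at x)"
      by (rule has_derivative_compose[OF _ \<phi>, of "\<lambda>x. x - z" "\<lambda>h. h"]) (auto intro!: derivative_eq_intros)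
    then have "((\<lambda>x. K z *\<^sub>R \<phi> (x - z)) has_derivative (\<lambda>h. K z *\<^sub>R \<phi>' (x - z) h)) (at x)"
      by (rule has_derivative_scaleR_right)
    then show "((\<lambda>x. K z *\<^sub>R \<phi> (x - z)) has_derivative blinfun_apply (K z *\<^sub>R \<phi>' (x - z))) (at x within UNIV)"
      by (simp add: scaleR_blinfun.rep_eq)
  next
    fix x
    show "(\<lambda>z. K z *\<^sub>R \<phi> (x - z)) integrable_on cbox a b"
      by (intro integrable_continuous continuous_on_scaleR K continuous_on_compose2[OF c\<phi>] continuous_intros) auto
    show "continuous_on (UNIV \<times> cbox a b) (\<lambda>(x, z). K z *\<^sub>R \<phi>' (x - z))"
      unfolding split_beta
      by (intro continuous_on_scaleR continuous_on_compose2[OF K] continuous_on_compose2[OF c] continuous_intros) auto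
  qed auto
  then show ?thesis unfolding conv_on_def[abs_def] .
qed

text \<open>The polynomials, generated by monomials because the lift to matrices is constructed for
  one monomial at a time and then extended linearly.\<close>

inductive mono_span :: "(real^'n \<Rightarrow> real) \<Rightarrow> bool" where
  mono: "mono_span (\<lambda>x. \<Prod>i\<in>UNIV. x $ i ^ m i)"
| scale: "mono_span f \<Longrightarrow> mono_span (\<lambda>x. a * f x)"
| add: "mono_span f \<Longrightarrow> mono_span g \<Longrightarrow> mono_span (\<lambda>x. f x + g x)"

lemma mono_span_coord_mult:
  fixes f :: "real^'n \<Rightarrow> real"
  assumes "mono_span f"
  shows "mono_span (\<lambda>x. x $ i * f x)"
  using assms
proof induction
  case (mono m)
  have "(\<Prod>j\<in>UNIV. x $ j ^ (m(i := Suc (m i))) j) = x $ i * (\<Prod>j\<in>UNIV. x $ j ^ m j)" for x :: "real^'n"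
    by (simp add: prod.remove[of UNIV i])
  then show ?case using mono_span.mono[of "m(i := Suc (m i))"] by simp
next
  case (scale f a)
  then show ?case using mono_span.scale[OF scale.IH, of a] by (simp add: mult.left_commute)
next
  case (add f g)
  then show ?case using mono_span.add[OF add.IH] by (simp add: distrib_left)
qed

lemma mono_span_zero: "mono_span (\<lambda>x. 0)"
  using mono_span.scale[OF mono_span.mono, of 0] by simp

lemma mono_span_one: "mono_span (\<lambda>x. 1)"
  using mono_span.mono[of "\<lambda>_. 0"] by simp

text \<open>Separated kernels: polynomial in \<open>x\<close>, merely continuous in
  \<open>y\<close>. Integrating such a kernel against a function of \<open>y\<close> leaves a
  polynomial in \<open>x\<close>.\<close>

inductive sep_span :: "(real^'n \<Rightarrow> real^'n \<Rightarrow> real) \<Rightarrow> bool" where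
  prod: "mono_span f \<Longrightarrow> continuous_on UNIV b \<Longrightarrow> sep_span (\<lambda>x y. f x * b y)"
| add: "sep_span f \<Longrightarrow> sep_span g \<Longrightarrow> sep_span (\<lambda>x y. f x y + g x y)"

lemma sep_span_mult_coord:
  assumes "sep_span f"
  shows "sep_span (\<lambda>x y. x $ i * f x y)"
  using assms
proof induction
  case (prod f b)
  then show ?case using sep_span.prod[OF mono_span_coord_mult[OF prod(1), of i] prod(2)] by (simp add: mult.assoc)
next
  case (add f g)
  then show ?case using sep_span.add[OF add.IH] by (simp add: distrib_left)
qed

lemma sep_span_mult_continuous:
  assumes "sep_span f" "continuous_on UNIV c"
  shows "sep_span (\<lambda>x y. c y * f x y)"
  using assms(1)
proof induction
  case (prod f b)
  then show ?case
    using sep_span.prod[OF prod(1) continuous_on_mult[OF assms(2) prod(2)]] by (simp add: mult.left_commute)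
next
  case (add f g)
  then show ?case using sep_span.add[OF add.IH] by (simp add: distrib_left)
qed

lemma sep_span_scale: "sep_span f \<Longrightarrow> sep_span (\<lambda>x y. c * f x y)"
  by (rule sep_span_mult_continuous) auto

lemma sep_span_sum:
  assumes "finite I" "\<And>i. i \<in> I \<Longrightarrow> sep_span (f i)"
  shows "sep_span (\<lambda>x y. \<Sum>i\<in>I. f i x y)"
  using assms
proof (induction I rule: finite_induct)
  case empty
  show ?case using sep_span.prod[OF mono_span_zero, of "\<lambda>_. 0"] by simp
next
  case (insert i I)
  then show ?case using sep_span.add[of "f i" "\<lambda>x y. \<Sum>i\<in>I. f i x y"] by simp
qed

text \<open>Each further factor is expanded as the coordinate sum of
  \<open>x $ i * x $ i - 2 * y $ i * x $ i + y $ i * y $ i\<close>, and multiplying by coordinates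
  of \<open>x\<close> or \<open>y\<close> preserves separation.\<close>

lemma sep_span_landau:
  fixes L :: real
  shows "sep_span (\<lambda>x y :: real^'n. (1 - ((x - y) \<bullet> (x - y)) / L) ^ k)"
proof (induction k)
  case 0
  show ?case using sep_span.prod[OF mono_span_one, of "\<lambda>_. 1"] by simp
next
  case (Suc k)
  let ?w = "\<lambda>x y :: real^'n. (1 - ((x - y) \<bullet> (x - y)) / L) ^ k"
  have cc: "continuous_on UNIV (\<lambda>y :: real^'n. y $ i)" for i by (intro continuous_intros)
  have 1: "sep_span (\<lambda>x y. \<Sum>i\<in>UNIV. x $ i * (x $ i * ?w x y) + ((-2) * (y $ i * (x $ i * ?w x y)) + y $ i * (y $ i * ?w x y)))"
    by (intro sep_span_sum sep_span.add sep_span_scale sep_span_mult_coord sep_span_mult_continuous cc Suc) simp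
  have "sep_span (\<lambda>x y. ?w x y + (- 1 / L) *
     (\<Sum>i\<in>UNIV. x $ i * (x $ i * ?w x y) + ((-2) * (y $ i * (x $ i * ?w x y)) + y $ i * (y $ i * ?w x y))))"
    by (intro sep_span.add[OF Suc] sep_span_scale 1)
  moreover have "?w x y + (- 1 / L) *
     (\<Sum>i\<in>UNIV. x $ i * (x $ i * ?w x y) + ((-2) * (y $ i * (x $ i * ?w x y)) + y $ i * (y $ i * ?w x y)))
     = (1 - ((x - y) \<bullet> (x - y)) / L) ^ Suc k" for x y :: "real^'n"
  proof -
    have "(\<Sum>i\<in>UNIV. x $ i * (x $ i * ?w x y) + ((-2) * (y $ i * (x $ i * ?w x y)) + y $ i * (y $ i * ?w x y)))
      = (\<Sum>i\<in>UNIV. (x - y) $ i * (x - y) $ i * ?w x y)"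
      by (intro sum.cong refl) (simp add: algebra_simps)
    also have "\<dots> = ((x - y) \<bullet> (x - y)) * ?w x y" by (simp add: inner_vec_def sum_distrib_right)
    finally show ?thesis by (simp add: algebra_simps)
  qed
  ultimately show ?case by simp
qed

text \<open>Continuity in \<open>y\<close> is carried through the induction, because splitting the
  integral of a sum requires integrability of both summands.\<close>

lemma sep_span_integral:
  assumes "sep_span w" "continuous_on UNIV g"
  shows "mono_span (\<lambda>x. integral (cbox a b) (\<lambda>y. w x y * g y)) \<and> (\<forall>x. continuous_on UNIV (w x))"
  using assms(1)
proof induction
  case (prod f c)
  have "integral (cbox a b) (\<lambda>y. f x * c y * g y) = integral (cbox a b) (\<lambda>y. c y * g y) * f x" for x
    by (simp add: mult.assoc mult.commute[of _ "f x"])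
  then show ?case using mono_span.scale[OF prod(1)] prod(2) by (auto intro!: continuous_intros)
next
  case (add f1 f2)
  have "integral (cbox a b) (\<lambda>y. (f1 x y + f2 x y) * g y) =
    integral (cbox a b) (\<lambda>y. f1 x y * g y) + integral (cbox a b) (\<lambda>y. f2 x y * g y)" for x
    unfolding distrib_right using add.IH assms(2)
    by (intro integral_add integrable_continuous continuous_on_mult) (auto intro: continuous_on_subset)
  then show ?case using mono_span.add add.IH by (auto intro!: continuous_intros)
qed

text \<open>The substitution \<open>y = x - z\<close>. As \<open>g\<close> lives on
  \<open>T\<close>, which fits into both boxes, the integral may be moved to a box independent of
  \<open>x\<close>, and then \<open>x\<close> occurs only in the kernel.\<close>

lemma conv_on_eq_integral_support:
  fixes g K :: "'a::euclidean_space \<Rightarrow> real"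
  assumes g: "continuous_on UNIV g" and K: "continuous_on UNIV K"
    and supp: "\<And>y. y \<notin> T \<Longrightarrow> g y = 0" and T2: "T \<subseteq> cbox u v"
    and Tx: "\<And>y. y \<in> T \<Longrightarrow> x - y \<in> cbox a b" and ne: "T \<noteq> {}"
  shows "conv_on (cbox a b) K g x = integral (cbox u v) (\<lambda>y. K (x - y) * g y)"
proof -
  let ?f = "\<lambda>y. K (x - y) * g y"
  have cf: "continuous_on UNIV ?f" by (intro continuous_intros continuous_on_compose2[OF K] g) auto
  have f0: "?f y = 0" if "y \<notin> T" for y using supp[OF that] by simp
  then have fT: "(\<lambda>y. if y \<in> T then ?f y else 0) = ?f" by auto
  have "(?f has_integral integral (cbox u v) ?f) (cbox u v)"
    using cf by (intro integrable_integral integrable_continuous) (auto intro: continuous_on_subset)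
  then have iT: "(?f has_integral integral (cbox u v) ?f) T"
    using has_integral_restrict[OF T2, of ?f] fT by simp
  have Tb: "T \<subseteq> cbox (x - b) (x - a)"
    using Tx by (force simp: mem_box inner_diff_left)
  have "(?f has_integral integral (cbox u v) ?f) (cbox (x - b) (x - a))"
    by (rule has_integral_on_superset[OF iT f0 Tb])
  then have "((\<lambda>z. ?f ((-1) *\<^sub>R z + x)) has_integral (1 / (\<bar>- 1\<bar> ^ DIM('a))) *\<^sub>R integral (cbox u v) ?f)
     ((\<lambda>z. (1 / - 1) *\<^sub>R z + - ((1 / - 1) *\<^sub>R x)) ` cbox (x - b) (x - a))"
    by (rule has_integral_affinity[where m="- 1" and c=x]) simp
  moreover have "(\<lambda>z. (1 / - 1) *\<^sub>R z + - ((1 / - 1) *\<^sub>R x)) ` cbox (x - b) (x - a) = cbox a b"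
  proof -
    have "cbox (x - b) (x - a) \<noteq> {}" using ne Tb by blast
    then show ?thesis
      using image_affinity_cbox[of "1 / - 1" "- ((1 / - 1) *\<^sub>R x)" "x - b" "x - a"] by simp
  qed
  ultimately have "((\<lambda>z. K z * g (x - z)) has_integral integral (cbox u v) ?f) (cbox a b)" by simp
  then show ?thesis unfolding conv_on_def by (simp add: integral_unique)
qed

text \<open>The approximants have two descriptions that agree on \<open>ball c r\<close>: with
  \<open>x\<close> in the kernel they are polynomials, with \<open>x\<close> in \<open>g\<close>
  their derivatives are convolutions of \<open>g1\<close> and \<open>g2\<close> and converge
  uniformly.\<close>

lemma C2_approx_by_mono_span:
  fixes g :: "real^'n \<Rightarrow> real"
  assumes g1: "\<And>x. (g has_derivative blinfun_apply (g1 x)) (at x)"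
    and g2: "\<And>x. (g1 has_derivative blinfun_apply (g2 x)) (at x)"
    and cg2: "continuous_on UNIV g2"
    and supp: "\<And>y. y \<notin> cball c r \<Longrightarrow> g y = 0" and r: "r > 0"
  obtains p p1 p2 where "\<And>k. mono_span (p k)"
    "\<And>k x. x \<in> ball c r \<Longrightarrow> (p k has_derivative blinfun_apply (p1 k x)) (at x)"
    "\<And>k x. x \<in> ball c r \<Longrightarrow> (p1 k has_derivative blinfun_apply (p2 k x)) (at x)"
    "uniform_limit (ball c r) p g sequentially"
    "uniform_limit (ball c r) p1 g1 sequentially"
    "uniform_limit (ball c r) p2 g2 sequentially"
proof -
  have cg1: "continuous_on UNIV g1"
    by (rule has_derivative_continuous_on, rule has_derivative_at_withinI, rule g2)
  have cg: "continuous_on UNIV g"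
    by (rule has_derivative_continuous_on, rule has_derivative_at_withinI, rule g1)
  \<comment> \<open>Differences of points of \<open>cball c r\<close> have norm at most
    \<open>2 * r\<close>, so the kernel box contains them, and 0 is an interior point of the
    box.\<close>
  obtain b where b: "cball (0 :: real^'n) (3 * r) \<subseteq> cbox (- b) b"
    using bounded_subset_cbox_symmetric[OF bounded_cball] by blast
  let ?B = "cbox (- b) b"
  obtain L0 where L0: "\<And>z. z \<in> ?B \<Longrightarrow> norm z \<le> L0" using bounded_cbox[of "- b" b] by (auto simp: bounded_iff)
  define L where "L = L0\<^sup>2 + 1"
  have L: "L > 0" "\<And>z. z \<in> ?B \<Longrightarrow> z \<bullet> z \<le> L"
  proof -
    show "L > 0" by (simp add: L_def add_nonneg_pos)
    fix z assume "z \<in> ?B"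
    then have "(norm z)\<^sup>2 \<le> L0\<^sup>2" using L0 by (intro power_mono) auto
    then show "z \<bullet> z \<le> L" by (simp add: L_def power2_norm_eq_inner)
  qed
  have "ball (0 :: real^'n) (3 * r) \<subseteq> interior ?B" using b by (intro interior_maximal) auto
  then have 0: "0 \<in> box (- b) b" using r by (auto simp: interior_cbox)
  define K where "K k = landau_kernel L ?B k" for k
  have Kc: "continuous_on S (K k)" for S k unfolding K_def by (rule continuous_on_landau_kernel)
  obtain u v where uv: "cball c r \<subseteq> cbox u v" using bounded_subset_cbox_symmetric[OF bounded_cball] by blast
  define p where "p k x = integral (cbox u v) (\<lambda>y. K k (x - y) * g y)" for k x
  have pm: "mono_span (p k)" for k
  proof -
    have "K k (x - y) * g y = (1 / integral ?B (\<lambda>z. (1 - (z \<bullet> z) / L) ^ k)) * ((1 - ((x - y) \<bullet> (x - y)) / L) ^ k * g y)" for x y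
      by (simp add: K_def landau_kernel_def)
    then have eq: "p k = (\<lambda>x. (1 / integral ?B (\<lambda>z. (1 - (z \<bullet> z) / L) ^ k)) *
       integral (cbox u v) (\<lambda>y. (1 - ((x - y) \<bullet> (x - y)) / L) ^ k * g y))"
      unfolding p_def by (simp only: integral_mult_right)
    show ?thesis unfolding eq
      by (rule mono_span.scale[OF sep_span_integral[OF sep_span_landau cg, THEN conjunct1]])
  qed
  have pe: "conv_on ?B (K k) g x = p k x" if "x \<in> ball c r" for k x
    unfolding p_def
  proof (rule conv_on_eq_integral_support[OF cg Kc supp uv])
    fix y assume y: "y \<in> cball c r"
    have "norm (x - y) \<le> dist c x + dist c y" using dist_triangle[of x y c] by (simp add: dist_norm norm_minus_commute)
    then have "x - y \<in> cball 0 (3 * r)" using that y r by simp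
    then show "x - y \<in> ?B" using b by blast
  qed (use r in auto)
  have d1: "(conv_on ?B (K k) g has_derivative blinfun_apply (conv_on ?B (K k) g1 x)) (at x)" for k x
    by (rule conv_on_has_derivative[OF g1 cg1 Kc])
  have d2: "(conv_on ?B (K k) g1 has_derivative blinfun_apply (conv_on ?B (K k) g2 x)) (at x)" for k x
    by (rule conv_on_has_derivative[OF g2 cg2 Kc])
  have ul: "uniform_limit (ball c r) (\<lambda>k. conv_on ?B (K k) \<phi>) \<phi> sequentially"
    if "continuous_on UNIV \<phi>" for \<phi> :: "real^'n \<Rightarrow> 'z::banach"
    using uniform_limit_on_subset[OF landau_kernel_conv_uniform_limit[OF that compact_cball[of c r] L 0] ball_subset_cball]
    by (simp add: K_def)
  show thesis
  proof (rule that[of p "\<lambda>k. conv_on ?B (K k) g1" "\<lambda>k. conv_on ?B (K k) g2"])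
    show "(p k has_derivative blinfun_apply (conv_on ?B (K k) g1 x)) (at x)" if "x \<in> ball c r" for k x
      by (rule has_derivative_transform_within_open[OF d1 open_ball that pe])
    show "uniform_limit (ball c r) p g sequentially"
      by (rule uniform_limit_cong'[THEN iffD1, OF _ _ ul[OF cg]]) (auto simp: pe)
  qed (use pm d2 ul cg1 cg2 in auto)
qed

section \<open>Lifting symmetric polynomials to matrices\<close>

lemma matrix_add_distrib:
  fixes A B C :: "real^'n^'n"
  shows "A ** (B + C) = A ** B + A ** C" "(B + C) ** A = B ** A + C ** A"
  by (simp_all add: vec_eq_iff matrix_matrix_mult_def distrib_left distrib_right sum.distrib)

text \<open>Expanding the products gives a sum over all maps \<open>f\<close>, counted for each
  \<open>S\<close> that contains their range. Inclusion-exclusion over \<open>S\<close> keeps the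
  surjective maps, which on a finite type are the permutations.\<close>

lemma ryser_permanent:
  fixes e :: "'n::finite \<Rightarrow> 'n \<Rightarrow> real"
  shows "(\<Sum>S\<in>Pow UNIV. (-1) ^ card (- S) * (\<Prod>i\<in>UNIV. \<Sum>a\<in>S. e a i)) =
    (\<Sum>p | p permutes UNIV. \<Prod>i\<in>UNIV. e (p i) i)"
proof -
  \<comment> \<open>The alternating sum is the expansion of a product of factors
    \<open>1 + 0\<close> for \<open>i\<close> in \<open>T\<close> and \<open>1 - 1\<close>
    otherwise, which vanishes unless \<open>T\<close> is everything.\<close>
  have inner: "(\<Sum>S\<in>Pow UNIV. (-1) ^ card (- S) * (if T \<subseteq> S then 1 else 0)) = (if T = UNIV then 1 else 0 :: real)"
    for T :: "'n set"
  proof -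
    have "(\<Prod>i\<in>UNIV. 1 + (if i \<in> T then 0 else - 1 :: real)) =
       (\<Sum>S\<in>Pow UNIV. (\<Prod>i\<in>S. 1) * (\<Prod>i\<in>UNIV - S. if i \<in> T then 0 else - 1))"
      by (rule prod_add) simp
    moreover have "(\<Prod>i\<in>UNIV - S. if i \<in> T then 0 else - 1 :: real) = (-1) ^ card (- S) * (if T \<subseteq> S then 1 else 0)" for S
    proof (cases "T \<subseteq> S")
      case True
      then have "(\<Prod>i\<in>UNIV - S. if i \<in> T then 0 else - 1 :: real) = (\<Prod>i\<in>UNIV - S. - 1)"
        by (intro prod.cong) auto
      then show ?thesis using True by (simp add: Compl_eq_Diff_UNIV)
    next
      case False
      then obtain i where "i \<in> T" "i \<notin> S" by blast
      then have "(\<Prod>i\<in>UNIV - S. if i \<in> T then 0 else - 1 :: real) = 0"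
        by (intro prod_zero bexI[of _ i]) auto
      then show ?thesis using False by simp
    qed
    moreover have "(\<Prod>i\<in>UNIV. 1 + (if i \<in> T then 0 else - 1 :: real)) = (if T = UNIV then 1 else 0)"
    proof (cases "T = UNIV")
      case False
      then obtain i where "i \<notin> T" by blast
      then have "(\<Prod>i\<in>UNIV. 1 + (if i \<in> T then 0 else - 1 :: real)) = 0"
        by (intro prod_zero bexI[of _ i]) auto
      then show ?thesis using False by simp
    qed simp
    ultimately show ?thesis by simp
  qed
  have expand: "(\<Prod>i\<in>UNIV. \<Sum>a\<in>S. e a i) = (\<Sum>f\<in>UNIV. (if range f \<subseteq> S then 1 else 0) * (\<Prod>i\<in>UNIV. e (f i) i))" for S
  proof -
    have "(\<Prod>i\<in>UNIV. \<Sum>a\<in>S. e a i) = (\<Sum>f\<in>PiE UNIV (\<lambda>_. S). \<Prod>i\<in>UNIV. e (f i) i)"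
      by (rule prod_sum_PiE) auto
    also have "\<dots> = (\<Sum>f\<in>UNIV. if range f \<subseteq> S then (\<Prod>i\<in>UNIV. e (f i) i) else 0)"
      by (rule sum.mono_neutral_cong_left) (auto simp: PiE_def)
    finally show ?thesis by (simp add: if_distrib[of "\<lambda>u. u * _"] cong: if_cong)
  qed
  have "(\<Sum>S\<in>Pow UNIV. (-1) ^ card (- S) * (\<Prod>i\<in>UNIV. \<Sum>a\<in>S. e a i)) =
    (\<Sum>S\<in>Pow UNIV. \<Sum>f\<in>UNIV. (-1) ^ card (- S) * (if range f \<subseteq> S then 1 else 0) * (\<Prod>i\<in>UNIV. e (f i) i))"
    unfolding expand sum_distrib_left mult.assoc ..
  also have "\<dots> = (\<Sum>f\<in>UNIV. \<Sum>S\<in>Pow UNIV. (-1) ^ card (- S) * (if range f \<subseteq> S then 1 else 0) * (\<Prod>i\<in>UNIV. e (f i) i))"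
    by (rule sum.swap)
  also have "\<dots> = (\<Sum>f\<in>UNIV. (if range f = UNIV then 1 else 0) * (\<Prod>i\<in>UNIV. e (f i) i))"
    unfolding sum_distrib_right[symmetric] inner ..
  also have "\<dots> = (\<Sum>p | p permutes UNIV. \<Prod>i\<in>UNIV. e (p i) i)"
  proof (rule sum.mono_neutral_cong_right)
    show "{p. p permutes UNIV} \<subseteq> (UNIV :: ('n \<Rightarrow> 'n) set)" by simp
    have surj: "range p = UNIV \<longleftrightarrow> p permutes UNIV" for p :: "'n \<Rightarrow> 'n"
    proof
      assume "range p = UNIV"
      then have "bij p" by (simp add: bij_def finite_UNIV_surj_inj)
      then show "p permutes UNIV" by (intro bij_imp_permutes) auto
    qed (simp add: permutes_image)
    show "\<forall>f\<in>UNIV - {p. p permutes UNIV}. (if range f = UNIV then 1 else 0) * (\<Prod>i\<in>UNIV. e (f i) i) = 0"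
      by (simp add: surj)
    show "(if range p = UNIV then 1 else 0) * (\<Prod>i\<in>UNIV. e (p i) i) = (\<Prod>i\<in>UNIV. e (p i) i)"
      if "p \<in> {p. p permutes UNIV}" for p using that by (simp add: surj)
  qed simp
  finally show ?thesis .
qed

section \<open>Matrix powers and the lift of monomials\<close>

primrec mat_pow :: "real^'n^'n \<Rightarrow> nat \<Rightarrow> real^'n^'n" where
  "mat_pow X 0 = mat 1"
| "mat_pow X (Suc k) = X ** mat_pow X k"

lemma mat_pow_conj_diag:
  assumes U: "U \<in> block_orth c"
  shows "mat_pow (U ** diag_mat y ** transpose U) k = U ** diag_mat (\<chi> i. y $ i ^ k) ** transpose U"
proof (induction k)
  case 0
  have "diag_mat (\<chi> i. 1) = (mat 1 :: real^'a^'a)" by (simp add: vec_eq_iff diag_mat_nth mat_def)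
  then show ?case using block_orthD(1)[OF U] by simp
next
  case (Suc k)
  have "mat_pow (U ** diag_mat y ** transpose U) (Suc k) =
     U ** diag_mat y ** (transpose U ** U) ** diag_mat (\<chi> i. y $ i ^ k) ** transpose U"
    unfolding mat_pow.simps Suc by (simp only: matrix_mul_assoc)
  also have "\<dots> = U ** (diag_mat y ** diag_mat (\<chi> i. y $ i ^ k)) ** transpose U"
    unfolding block_orthD(2)[OF U] by (simp add: matrix_mul_assoc)
  finally show ?case by (simp add: diag_mat_mult)
qed

lemma real_polynomial_function_entry: "real_polynomial_function (\<lambda>X :: real^'n^'n. X $ i $ j)"
  by (intro real_polynomial_function.intros(1) bounded_linear_compose[OF bounded_linear_vec_nth bounded_linear_vec_nth])

lemma real_polynomial_function_mat_pow: "real_polynomial_function (\<lambda>X :: real^'n^'n. mat_pow X k $ i $ j)"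
proof (induction k arbitrary: i j)
  case (Suc k)
  show ?case
    by (simp add: matrix_matrix_mult_def)
      (intro real_polynomial_function_sum real_polynomial_function.intros(4) real_polynomial_function_entry Suc finite)
qed (auto simp: mat_def)

text \<open>As a weight in the permanent this indicator kills every permutation that leaves a block,
  which cuts the sum over all permutations down to the stabiliser of \<open>c\<close>.\<close>

definition block_ind :: "real^'n \<Rightarrow> 'n \<Rightarrow> real^'n" where
  "block_ind c a = (\<chi> i. if c $ i = c $ a then 1 else 0)"

text \<open>The symmetrisation of a monomial is a permanent, and Ryser's formula writes it as a combination of
  products over the coordinates, which are the determinants of polynomials in the matrix.\<close>

lemma mono_span_lift:
  fixes f :: "real^'n \<Rightarrow> real" and c :: "real^'n"
  assumes "mono_span f"
  shows "\<exists>Q. real_polynomial_function Q \<and>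
     (\<forall>U\<in>block_orth c. \<forall>y. Q (U ** diag_mat y ** transpose U) = (\<Sum>g\<in>perm_stab c. f (perm_act g y)))"
  using assms
proof induction
  case (mono m)
  define Q where "Q X = (\<Sum>S\<in>Pow UNIV. (-1) ^ card (- S) *
     det (\<Sum>a\<in>S. diag_mat (block_ind c a) ** mat_pow X (m a)))" for X
  have "real_polynomial_function Q"
    unfolding Q_def det_def sum_component diag_mat_mult_nth
    by (intro real_polynomial_function_sum real_polynomial_function_prod real_polynomial_function.intros(4)
        real_polynomial_function.intros(2) real_polynomial_function_mat_pow)
      (auto intro: finite_subset simp: finite_permutations)
  moreover have "Q (U ** diag_mat y ** transpose U) = (\<Sum>g\<in>perm_stab c. \<Prod>i\<in>UNIV. perm_act g y $ i ^ m i)"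
    if U: "U \<in> block_orth c" for U y
  proof -
    define e where "e a i = block_ind c a $ i * y $ i ^ m a" for a i
    have dt: "det (\<Sum>a\<in>S. diag_mat (block_ind c a) ** mat_pow (U ** diag_mat y ** transpose U) (m a)) =
        (\<Prod>i\<in>UNIV. \<Sum>a\<in>S. e a i)" for S
    proof -
      have "diag_mat (block_ind c a) ** mat_pow (U ** diag_mat y ** transpose U) (m a) =
         U ** diag_mat (\<chi> i. e a i) ** transpose U" for a
      proof -
        have "U ** diag_mat (block_ind c a) = diag_mat (block_ind c a) ** U"
          by (rule block_orth_commute[OF U]) (simp add: block_ind_def)
        then have "diag_mat (block_ind c a) ** mat_pow (U ** diag_mat y ** transpose U) (m a) =
          U ** (diag_mat (block_ind c a) ** diag_mat (\<chi> i. y $ i ^ m a)) ** transpose U"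
          unfolding mat_pow_conj_diag[OF U] by (simp only: matrix_mul_assoc)
        then show ?thesis by (simp add: diag_mat_mult e_def)
      qed
      then have "(\<Sum>a\<in>S. diag_mat (block_ind c a) ** mat_pow (U ** diag_mat y ** transpose U) (m a)) =
         (\<Sum>a\<in>S. U ** diag_mat (\<chi> i. e a i) ** transpose U)" by simp
      also have "\<dots> = U ** diag_mat (\<chi> i. \<Sum>a\<in>S. e a i) ** transpose U"
      proof -
        have "finite S" by simp
        then show ?thesis
        proof (induction S rule: finite_induct)
          case empty
          have "diag_mat (\<chi> i. \<Sum>a\<in>{}. e a i) = 0" by (simp add: vec_eq_iff diag_mat_nth)
          then show ?case by (simp only: sum.empty) (simp add: vec_eq_iff matrix_matrix_mult_def)
        next
          case (insert a S)
          have "diag_mat (\<chi> i. e a i) + diag_mat (\<chi> i. \<Sum>a\<in>S. e a i) = diag_mat (\<chi> i. \<Sum>a\<in>insert a S. e a i)"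
            using insert(1,2) by (simp add: linear_add[OF linear_diag_mat, symmetric]) (simp add: vec_eq_iff diag_mat_nth)
          then show ?case using insert
            by (simp add: matrix_add_distrib[symmetric])
        qed
      qed
      finally show ?thesis using arg_cong[OF block_orthD(1)[OF U], of det]
        by (simp add: det_mul det_diag_mat mult.commute mult.left_commute)
    qed
    have "Q (U ** diag_mat y ** transpose U) = (\<Sum>p | p permutes UNIV. \<Prod>i\<in>UNIV. e (p i) i)"
      unfolding Q_def dt by (rule ryser_permanent)
    also have "\<dots> = (\<Sum>g\<in>perm_stab c. \<Prod>i\<in>UNIV. e (g i) i)"
    proof (rule sum.mono_neutral_right)
      show "\<forall>p\<in>{p. p permutes UNIV} - perm_stab c. (\<Prod>i\<in>UNIV. e (p i) i) = 0"
      proof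
        fix p assume "p \<in> {p. p permutes UNIV} - perm_stab c"
        then obtain i where "c $ p i \<noteq> c $ i" by (auto simp: perm_stab_iff)
        then have "e (p i) i = 0" by (simp add: e_def block_ind_def)
        then show "(\<Prod>i\<in>UNIV. e (p i) i) = 0" by (intro prod_zero bexI[of _ i]) auto
      qed
    qed (auto simp: perm_stab_def finite_permutations)
    also have "\<dots> = (\<Sum>g\<in>perm_stab c. \<Prod>i\<in>UNIV. perm_act g y $ i ^ m i)"
    proof (rule sum.cong[OF refl])
      fix g assume g: "g \<in> perm_stab c"
      then have gp: "g permutes UNIV" by (simp add: perm_stab_def)
      \<comment> \<open>Reindexing by \<open>g\<close> moves the permutation from the point to the
        exponents, the form in which the permanent delivers the terms.\<close>
      have "(\<Prod>i\<in>UNIV. perm_act g y $ i ^ m i) = (\<Prod>i\<in>UNIV. perm_act g y $ (g i) ^ m (g i))"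
        using prod.permute[OF gp, of "\<lambda>i. perm_act g y $ i ^ m i"] by (simp add: o_def)
      then show "(\<Prod>i\<in>UNIV. e (g i) i) = (\<Prod>i\<in>UNIV. perm_act g y $ i ^ m i)"
        using g permutes_inverses[OF gp] by (simp add: perm_act_nth e_def block_ind_def perm_stab_iff)
    qed
    finally show ?thesis .
  qed
  ultimately show ?case by blast
next
  case (scale f a)
  then obtain Q where Q: "real_polynomial_function Q"
    "\<forall>U\<in>block_orth c. \<forall>y. Q (U ** diag_mat y ** transpose U) = (\<Sum>g\<in>perm_stab c. f (perm_act g y))" by blast
  then show ?case
    by (intro exI[of _ "\<lambda>X. a * Q X"]) (auto simp: sum_distrib_left)
next
  case (add f h)
  then obtain Q R where Q: "real_polynomial_function Q"
    "\<forall>U\<in>block_orth c. \<forall>y. Q (U ** diag_mat y ** transpose U) = (\<Sum>g\<in>perm_stab c. f (perm_act g y))"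
    and R: "real_polynomial_function R"
    "\<forall>U\<in>block_orth c. \<forall>y. R (U ** diag_mat y ** transpose U) = (\<Sum>g\<in>perm_stab c. h (perm_act g y))" by blast
  then show ?case
    by (intro exI[of _ "\<lambda>X. Q X + R X"]) (auto simp: sum.distrib)
qed

section \<open>Second order bounds for invariant functions of matrices\<close>

lemma block_symD:
  assumes "X \<in> block_sym c"
  shows "X $ i $ j = X $ j $ i" "c $ i \<noteq> c $ j \<Longrightarrow> X $ i $ j = 0"
proof -
  have "transpose X $ i $ j = X $ i $ j" using assms by (simp add: block_sym_def)
  then show "X $ i $ j = X $ j $ i" by (simp add: transpose_def)
qed (use assms in \<open>simp add: block_sym_def\<close>)

lemma block_symI:
  "(\<And>i j. X $ i $ j = X $ j $ i) \<Longrightarrow> (\<And>i j. c $ i \<noteq> c $ j \<Longrightarrow> X $ i $ j = 0) \<Longrightarrow> X \<in> block_sym c"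
  by (simp add: block_sym_def vec_eq_iff transpose_def)

lemma diag_mat_in_block_sym: "diag_mat x \<in> block_sym c"
  by (rule block_symI) (auto simp: diag_mat_nth)

lemma block_sym_add: "X \<in> block_sym c \<Longrightarrow> Y \<in> block_sym c \<Longrightarrow> X + Y \<in> block_sym c"
  by (rule block_symI) (auto simp: block_symD)

lemma block_sym_scaleR: "X \<in> block_sym c \<Longrightarrow> t *\<^sub>R X \<in> block_sym c"
  by (rule block_symI) (auto simp: block_symD)

lemma block_sym_conj:
  assumes U: "U \<in> block_orth c" and X: "X \<in> block_sym c"
  shows "U ** X ** transpose U \<in> block_sym c"
proof -
  have "X ** diag_mat c = diag_mat c ** X" using X by (simp add: block_sym_def block_iff_commute)
  from conj_commute_diag_mat[OF U this]
  have "(U ** X ** transpose U) ** diag_mat c = diag_mat c ** (U ** X ** transpose U)" by simp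
  moreover have "transpose (U ** X ** transpose U) = U ** X ** transpose U"
    using X by (simp add: block_sym_def matrix_transpose_mul matrix_mul_assoc)
  ultimately show ?thesis by (simp add: block_sym_def block_iff_commute)
qed

lemma norm_conj_diag:
  assumes U: "U \<in> block_orth c"
  shows "norm (U ** diag_mat y ** transpose U - diag_mat c) = norm (y - c)"
proof -
  have "U ** diag_mat c ** transpose U = diag_mat c"
    using block_orth_commute[OF U, of c] block_orthD(1)[OF U] by (simp add: matrix_mul_assoc[symmetric])
  then have "U ** diag_mat y ** transpose U - diag_mat c = U ** diag_mat (y - c) ** transpose U"
    by (simp add: linear_diff[OF linear_diag_mat] matrix_diff_distrib)
  then show ?thesis using norm_conj_orth[OF block_orthD(3)[OF U]] by (simp add: norm_diag_mat)
qed

text \<open>Gives access to the product rule for curves of matrices.\<close>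

lemma bounded_bilinear_matrix_mult: "bounded_bilinear ((**) :: real^'n^'n \<Rightarrow> real^'n^'n \<Rightarrow> real^'n^'n)"
proof (rule bilinear_conv_bounded_bilinear[THEN iffD1])
  show "bilinear ((**) :: real^'n^'n \<Rightarrow> real^'n^'n \<Rightarrow> real^'n^'n)"
    unfolding bilinear_def
    by (auto intro!: linearI simp: vec_eq_iff matrix_matrix_mult_def
        algebra_simps sum.distrib sum_distrib_left)
qed

lemma bounded_linear_conj:
  fixes U V :: "real^'n^'n"
  shows "bounded_linear (\<lambda>X :: real^'n^'n. U ** X ** V)"
  using bounded_linear_compose[OF bounded_bilinear.bounded_linear_left[OF bounded_bilinear_matrix_mult, of V]
      bounded_bilinear.bounded_linear_right[OF bounded_bilinear_matrix_mult, of U]] .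

section \<open>Off-diagonal directions and infinitesimal rotations\<close>

definition esym :: "'n \<Rightarrow> 'n \<Rightarrow> real^'n^'n" where
  "esym i j = (\<chi> p q. if p = i \<and> q = j \<or> p = j \<and> q = i then 1 else 0)"

definition diag_vec :: "real^'n^'n \<Rightarrow> real^'n" where "diag_vec H = (\<chi> i. H $ i $ i)"

definition rot_gen :: "'n \<Rightarrow> 'n \<Rightarrow> real^'n^'n" where
  "rot_gen i j = (\<chi> p q. if p = i \<and> q = j then - 1 else if p = j \<and> q = i then 1 else 0)"

lemma norm_diag_vec_le: "norm (diag_vec H) \<le> norm H"
proof -
  have "(\<Sum>i\<in>UNIV. (H $ i $ i)\<^sup>2) \<le> (\<Sum>i\<in>UNIV. \<Sum>j\<in>UNIV. (H $ i $ j)\<^sup>2)"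
    by (intro sum_mono member_le_sum) auto
  then show ?thesis unfolding norm_vec_vec_eq by (simp add: norm_vec_def L2_set_def diag_vec_def)
qed

lemma entry_le_norm: "\<bar>H $ i $ j\<bar> \<le> norm (H :: real^'n^'n)"
  using component_le_norm_cart[of "H $ i" j] Finite_Cartesian_Product.norm_nth_le[of H i] by linarith

text \<open>The double sum visits each unordered pair twice and \<open>esym i j = esym j i\<close>,
  whence the factor 1/2.\<close>

lemma block_sym_decomp:
  assumes K: "K \<in> block_sym c"
  shows "K = diag_mat (diag_vec K) +
    (\<Sum>i\<in>UNIV. \<Sum>j\<in>UNIV. if i \<noteq> j \<and> c $ i = c $ j then (K $ i $ j / 2) *\<^sub>R esym i j else 0)" (is "K = _ + ?S")
proof -
  have "?S $ p $ q = (if p = q then 0 else K $ p $ q)" for p q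
  proof (cases "p = q")
    case True
    then show ?thesis unfolding sum_component by (auto intro!: sum.neutral simp: esym_def)
  next
    case False
    have "?S $ p $ q = (\<Sum>i\<in>UNIV. \<Sum>j\<in>UNIV. (if i \<noteq> j \<and> c $ i = c $ j then (K $ i $ j / 2) *\<^sub>R esym i j else 0) $ p $ q)"
      by (simp add: sum_component)
    also have "\<dots> = (\<Sum>i\<in>UNIV. \<Sum>j\<in>UNIV. (if i = p then (if j = q then K $ p $ q / 2 else 0) else 0) +
       (if i = q then (if j = p then K $ q $ p / 2 else 0) else 0))"
    proof (intro sum.cong refl)
      fix i j
      have z: "c $ p \<noteq> c $ q \<Longrightarrow> K $ p $ q = 0" "c $ q \<noteq> c $ p \<Longrightarrow> K $ q $ p = 0"
        using block_symD(2)[OF K] by blast+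
      consider "i = p" "j = q" | "i = q" "j = p" | "\<not> (i = p \<and> j = q)" "\<not> (i = q \<and> j = p)" by blast
      then show "(if i \<noteq> j \<and> c $ i = c $ j then (K $ i $ j / 2) *\<^sub>R esym i j else 0) $ p $ q =
        (if i = p then (if j = q then K $ p $ q / 2 else 0) else 0) + (if i = q then (if j = p then K $ q $ p / 2 else 0) else 0)"
      proof cases
        case 1 then show ?thesis using False z(1) by (cases "c $ p = c $ q") (auto simp: esym_def)
      next
        case 2 then show ?thesis using False z(2) by (cases "c $ q = c $ p") (auto simp: esym_def)
      next
        case 3
        then have "esym i j $ p $ q = 0" by (auto simp: esym_def)
        then show ?thesis using 3 by auto
      qed
    qed
    also have "\<dots> = (\<Sum>i\<in>UNIV. \<Sum>j\<in>UNIV. (if i = p then (if j = q then K $ p $ q / 2 else 0) else 0)) +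
       (\<Sum>i\<in>UNIV. \<Sum>j\<in>UNIV. (if i = q then (if j = p then K $ q $ p / 2 else 0) else 0))"
      by (simp only: sum.distrib)
    also have "\<dots> = K $ p $ q / 2 + K $ q $ p / 2"
    proof -
      have "(\<Sum>i\<in>UNIV. \<Sum>j\<in>UNIV. (if i = p then (if j = q then z else 0) else 0)) = z" for p q :: 'a and z :: real
      proof -
        have "(\<Sum>j\<in>UNIV. (if i = p then (if j = q then z else 0) else 0)) = (if i = p then z else 0)" for i by simp
        then show ?thesis by simp
      qed
      then show ?thesis by simp
    qed
    finally show ?thesis using False block_symD(1)[OF K, of p q] by simp
  qed
  then show ?thesis by (simp add: vec_eq_iff diag_mat_nth diag_vec_def)
qed

lemma rot_gen_mult_nth:
  fixes K :: "real^'n^'n"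
  assumes "i \<noteq> j"
  shows "(rot_gen i j ** K) $ p $ q = (if p = i then - K $ j $ q else if p = j then K $ i $ q else 0)"
    "(K ** transpose (rot_gen i j)) $ p $ q = (if q = i then - K $ p $ j else if q = j then K $ p $ i else 0)"
proof -
  have *: "(\<Sum>k\<in>UNIV. rot_gen i j $ p $ k * f k) = (if p = i then - f j else if p = j then f i else 0)" for f :: "'n \<Rightarrow> real" and p
  proof -
    have "(\<Sum>k\<in>UNIV. rot_gen i j $ p $ k * f k) =
      (\<Sum>k\<in>UNIV. (if k = i then (if p = j then 1 else 0) else if k = j then (if p = i then - 1 else 0) else 0) * f k)"
      using assms by (intro sum.cong refl) (auto simp: rot_gen_def)
    then show ?thesis unfolding sum_two_deltas[OF assms] using assms by auto
  qed
  show "(rot_gen i j ** K) $ p $ q = (if p = i then - K $ j $ q else if p = j then K $ i $ q else 0)"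
    unfolding matrix_matrix_mult_def using *[of p "\<lambda>k. K $ k $ q"] by simp
  show "(K ** transpose (rot_gen i j)) $ p $ q = (if q = i then - K $ p $ j else if q = j then K $ p $ i else 0)"
    unfolding matrix_matrix_mult_def transpose_def using *[of q "\<lambda>k. K $ p $ k"] by (simp add: mult.commute)
qed

text \<open>For \<open>i \<noteq> j\<close> the matrix \<open>rot_gen i j\<close> is skew, so this
  is its commutator with \<open>K\<close>: the velocity at time 0 of \<open>K\<close> conjugated by
  rotations in the plane of \<open>i\<close> and \<open>j\<close>.\<close>

definition rot_ad :: "'n \<Rightarrow> 'n \<Rightarrow> real^'n^'n \<Rightarrow> real^'n^'n" where
  "rot_ad i j K = rot_gen i j ** K + K ** transpose (rot_gen i j)"

lemma rot_ad_in_block_sym: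
  assumes "i \<noteq> j" "c $ i = c $ j" "K \<in> block_sym c"
  shows "rot_ad i j K \<in> block_sym c"
proof (rule block_symI)
  fix p q
  show "rot_ad i j K $ p $ q = rot_ad i j K $ q $ p"
    using assms(1) block_symD(1)[OF assms(3), of p i] block_symD(1)[OF assms(3), of p j]
      block_symD(1)[OF assms(3), of q i] block_symD(1)[OF assms(3), of q j]
    by (auto simp: rot_ad_def rot_gen_mult_nth[OF assms(1)])
  show "rot_ad i j K $ p $ q = 0" if "c $ p \<noteq> c $ q"
    using that assms(1,2) block_symD(2)[OF assms(3), of p i] block_symD(2)[OF assms(3), of p j]
      block_symD(2)[OF assms(3), of i q] block_symD(2)[OF assms(3), of j q]
    by (auto simp: rot_ad_def rot_gen_mult_nth[OF assms(1)])
qed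

text \<open>The direction \<open>esym i j\<close> is tangent to the conjugation orbit of
  \<open>diag_mat x\<close> up to the factor \<open>x $ i - x $ j\<close>; the quotients by the gap
  originate here.\<close>

lemma rot_ad_diag_mat:
  assumes "i \<noteq> j"
  shows "rot_ad i j (diag_mat x) = (x $ i - x $ j) *\<^sub>R esym i j"
  using assms by (auto simp: vec_eq_iff rot_ad_def rot_gen_mult_nth[OF assms] diag_mat_nth esym_def)

lemma diag_vec_rot_ad:
  assumes "i \<noteq> j" "K $ i $ j = K $ j $ i"
  shows "diag_vec (rot_ad i j K) = (2 * K $ i $ j) *\<^sub>R (axis j 1 - axis i 1)"
  using assms by (auto simp: vec_eq_iff rot_ad_def rot_gen_mult_nth[OF assms(1)] diag_vec_def axis_def)

lemma givens_curve_has_derivative: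
  fixes Z :: "real^'n^'n"
  assumes ij: "i \<noteq> j"
  shows "((\<lambda>t. givens i j (cos t) (sin t) ** Z ** transpose (givens i j (cos t) (sin t)))
     has_vector_derivative rot_ad i j Z) (at 0)"
proof -
  \<comment> \<open>The Givens matrix is affine in its two entries. At time 0 the cosine has
    velocity 0 and the sine velocity 1, so only \<open>rot_gen i j\<close> survives.\<close>
  let ?M0 = "givens i j 0 0 :: real^'n^'n"
  let ?M1 = "givens i j 1 0 - ?M0"
  have e: "givens i j a b = ?M0 + a *\<^sub>R ?M1 + b *\<^sub>R rot_gen i j" for a b
    using ij by (auto simp: vec_eq_iff givens_def rot_gen_def)
  have R: "((\<lambda>t. givens i j (cos t) (sin t)) has_vector_derivative rot_gen i j) (at 0)"
    unfolding e[of "cos _"] by (auto intro!: derivative_eq_intros)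
  have R': "((\<lambda>t. transpose (givens i j (cos t) (sin t)) :: real^'n^'n) has_vector_derivative transpose (rot_gen i j)) (at 0)"
  proof -
    have "bounded_linear (transpose :: real^'n^'n \<Rightarrow> real^'n^'n)"
      by (auto intro!: linear_conv_bounded_linear[THEN iffD1] linearI simp: vec_eq_iff transpose_def)
    from bounded_linear.has_vector_derivative[OF this R] show ?thesis .
  qed
  have one: "givens i j (cos 0) (sin 0) = (mat 1 :: real^'n^'n)"
    by (auto simp: vec_eq_iff givens_def mat_def)
  have RZ: "((\<lambda>t. givens i j (cos t) (sin t) ** Z) has_vector_derivative rot_gen i j ** Z) (at 0)"
    by (rule bounded_linear.has_vector_derivative[OF bounded_bilinear.bounded_linear_left[OF bounded_bilinear_matrix_mult] R])
  show ?thesis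
    using bounded_bilinear.has_vector_derivative[OF bounded_bilinear_matrix_mult RZ R']
    unfolding one by (simp add: rot_ad_def add.commute)
qed

lemma givens_curve_orth: "i \<noteq> j \<Longrightarrow> c $ i = c $ j \<Longrightarrow> givens i j (cos t) (sin t) \<in> block_orth c"
  by (rule givens_orth) auto

lemma givens_curve_0: "givens i j (cos 0) (sin 0) ** A ** transpose (givens i j (cos 0) (sin 0)) = A"
proof -
  have "givens i j (cos 0) (sin 0) = mat 1" by (auto simp: vec_eq_iff givens_def mat_def)
  then show ?thesis by simp
qed

text \<open>The quarter turn differs from the swap matrix by a sign, which cancels under
  conjugation. Thus a swap of eigenvalues is available inside the same family of rotations.\<close>

lemma givens_swap_diag_mat:
  assumes ij: "i \<noteq> j"
  shows "givens i j 0 1 ** diag_mat x ** transpose (givens i j 0 1) = diag_mat (perm_act (Transposition.transpose i j) x)"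
proof -
  have "inv (Transposition.transpose i j) = Transposition.transpose i j" by (simp add: inv_unique_comp)
  then have "(givens i j 0 1 ** diag_mat x ** transpose (givens i j 0 1)) $ p $ q =
      diag_mat (perm_act (Transposition.transpose i j) x) $ p $ q" for p q
    unfolding transpose_givens[OF ij] mult_givens_nth[OF ij] givens_mult_nth[OF ij]
    using ij by (auto simp: diag_mat_nth perm_act_nth Transposition.transpose_def)
  then show ?thesis by (simp add: vec_eq_iff)
qed

text \<open>A direction with distinct coordinates separates equal coordinates for every positive
  \<open>t\<close> and leaves different ones different for small \<open>t\<close>. Identities
  obtained by dividing by gaps are extended to all points along such lines by continuity.\<close>

lemma distinct_perturbation:
  obtains w :: "real^'n" where
    "\<And>x. \<forall>\<^sub>F t in at_right 0. \<forall>i j. i \<noteq> j \<longrightarrow> (x + t *\<^sub>R w) $ i \<noteq> (x + t *\<^sub>R w) $ j"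
proof -
  obtain f :: "'n \<Rightarrow> nat" where f: "inj f" using finite_imp_inj_to_nat_seg[of "UNIV :: 'n set"] by auto
  define w :: "real^'n" where "w = (\<chi> i. real (f i))"
  have "\<forall>\<^sub>F t in at_right 0. \<forall>i j. i \<noteq> j \<longrightarrow> (x + t *\<^sub>R w) $ i \<noteq> (x + t *\<^sub>R w) $ j" for x
  proof -
    have "\<forall>\<^sub>F t in at_right 0. i \<noteq> j \<longrightarrow> (x + t *\<^sub>R w) $ i \<noteq> (x + t *\<^sub>R w) $ j" for i j
    proof (cases "i = j \<or> x $ i \<noteq> x $ j")
      case False
      then have "w $ i \<noteq> w $ j" using f by (auto simp: w_def inj_eq)
      have "\<forall>\<^sub>F t :: real in at_right 0. t > 0" by (simp add: eventually_at_right_less)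
      then show ?thesis by eventually_elim (use False \<open>w $ i \<noteq> w $ j\<close> in auto)
    next
      case True
      show ?thesis
      proof (cases "i = j")
        case False
        have "((\<lambda>t. (x + t *\<^sub>R w) $ i - (x + t *\<^sub>R w) $ j) \<longlongrightarrow> (x + 0 *\<^sub>R w) $ i - (x + 0 *\<^sub>R w) $ j) (at_right 0)"
          by (intro tendsto_intros)
        moreover have "(x + 0 *\<^sub>R w) $ i - (x + 0 *\<^sub>R w) $ j \<noteq> 0" using True False by simp
        ultimately have "\<forall>\<^sub>F t in at_right 0. (x + t *\<^sub>R w) $ i - (x + t *\<^sub>R w) $ j \<noteq> 0"
          by (rule tendsto_imp_eventually_ne)
        then show ?thesis by eventually_elim auto
      qed simp
    qed
    then show ?thesis by (simp add: eventually_all_finite)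
  qed
  then show thesis using that by blast
qed

lemma tendsto_diag_mat_line:
  assumes "continuous_on UNIV f"
  shows "((\<lambda>t. f (diag_mat (x + t *\<^sub>R w))) \<longlongrightarrow> f (diag_mat x)) (at_right 0)"
proof -
  have "continuous_on UNIV (\<lambda>t. f (diag_mat (x + t *\<^sub>R w)))"
    by (intro continuous_on_compose2[OF assms] linear_continuous_on_compose[OF _ linear_diag_mat] continuous_intros) auto
  then have "isCont (\<lambda>t. f (diag_mat (x + t *\<^sub>R w))) 0" by (simp add: continuous_on_eq_continuous_at)
  then show ?thesis by (simp add: isCont_def filterlim_at_split)
qed

lemma eventually_line_in_ball:
  fixes x :: "'a::real_normed_vector"
  assumes "x \<in> ball c r"
  shows "\<forall>\<^sub>F t in at_right 0. x + t *\<^sub>R w \<in> ball c r"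
proof -
  have "((\<lambda>t. x + t *\<^sub>R w) \<longlongrightarrow> x + 0 *\<^sub>R w) (at_right 0)" by (intro tendsto_intros)
  then show ?thesis using assms by (intro topological_tendstoD) auto
qed

lemma conj_block_symE:
  assumes U: "U \<in> block_orth c" and H: "H \<in> block_sym c"
  obtains H' where "H' \<in> block_sym c" "H = U ** H' ** transpose U" "norm H' = norm H"
proof
  let ?H = "transpose U ** H ** U"
  show "?H \<in> block_sym c" using block_sym_conj[OF block_orth_transpose[OF U] H] by simp
  have "U ** ?H ** transpose U = (U ** transpose U) ** H ** (U ** transpose U)" by (simp only: matrix_mul_assoc)
  then show HH: "H = U ** ?H ** transpose U" using block_orthD(1)[OF U] by simp
  show "norm ?H = norm H" by (subst (2) HH) (simp only: norm_conj_orth[OF block_orthD(3)[OF U]])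
qed

text \<open>The bounds are assumed at diagonal matrices in diagonal directions only; invariance
  spreads them over all of \<open>block_sym c\<close> near \<open>diag_mat c\<close>. The second
  order hypothesis is a Lipschitz bound so that it can be used between a point and its swapped
  image. Invariance is required on \<open>block_sym c\<close>, whereas the derivatives live on the
  full matrix space.\<close>

locale block_invariant =
  fixes c :: "real^'n::{finite,linorder}" and Q :: "real^'n::{finite,linorder}^'n::{finite,linorder} \<Rightarrow> real"
    and Q1 Q2 and r \<epsilon> :: real
  assumes Q1: "\<And>X. (Q has_derivative blinfun_apply (Q1 X)) (at X)"
    and Q2: "\<And>X. (Q1 has_derivative blinfun_apply (Q2 X)) (at X)"
    and Q2_cont: "continuous_on UNIV Q2"
    and inv: "\<And>U Z. U \<in> block_orth c \<Longrightarrow> Z \<in> block_sym c \<Longrightarrow> Q (U ** Z ** transpose U) = Q Z"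
    and e0: "\<epsilon> \<ge> 0"
    and bnd: "\<And>x v. x \<in> ball c r \<Longrightarrow> \<bar>Q1 (diag_mat x) (diag_mat v)\<bar> \<le> \<epsilon> * norm v"
    and lip: "\<And>x y v. x \<in> ball c r \<Longrightarrow> y \<in> ball c r \<Longrightarrow>
      \<bar>Q1 (diag_mat x) (diag_mat v) - Q1 (diag_mat y) (diag_mat v)\<bar> \<le> \<epsilon> * norm (x - y) * norm v"
begin

lemma Q1_cont: "continuous_on S Q1"
  by (rule has_derivative_continuous_on, rule has_derivative_at_withinI, rule Q2)

lemma line_deriv1: "((\<lambda>t. Q (X + t *\<^sub>R H)) has_vector_derivative Q1 X H) (at 0)"
proof -
  have "((\<lambda>t. X + t *\<^sub>R H) has_vector_derivative H) (at 0)" by (auto intro!: derivative_eq_intros)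
  then have "((Q \<circ> (\<lambda>t. X + t *\<^sub>R H)) has_vector_derivative Q1 X H) (at 0)"
    by (rule vector_derivative_diff_chain_within) (simp add: has_derivative_at_withinI[OF Q1])
  then show ?thesis by (simp add: o_def)
qed

lemma line_deriv2: "((\<lambda>t. Q1 (X + t *\<^sub>R H)) has_vector_derivative Q2 X H) (at 0)"
proof -
  have "((\<lambda>t. X + t *\<^sub>R H) has_vector_derivative H) (at 0)" by (auto intro!: derivative_eq_intros)
  then have "((Q1 \<circ> (\<lambda>t. X + t *\<^sub>R H)) has_vector_derivative Q2 X H) (at 0)"
    by (rule vector_derivative_diff_chain_within) (simp add: has_derivative_at_withinI[OF Q2])
  then show ?thesis by (simp add: o_def)
qed

lemma line_deriv2': "((\<lambda>t. Q1 (X + t *\<^sub>R H) K) has_vector_derivative Q2 X H K) (at 0)"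
  by (rule bounded_linear.has_vector_derivative[OF blinfun.bounded_linear_left line_deriv2])

lemma conj_line:
  fixes U V Z H :: "real^'m^'m"
  shows "U ** (Z + t *\<^sub>R H) ** V = U ** Z ** V + t *\<^sub>R (U ** H ** V)"
  using linear_add[OF bounded_linear.linear[OF bounded_linear_conj[of U V]], of Z "t *\<^sub>R H"]
    linear_cmul[OF bounded_linear.linear[OF bounded_linear_conj[of U V]], of t H] by simp

text \<open>Conjugation maps the line through \<open>Z\<close> in direction \<open>H\<close> to a
  line, and \<open>Q\<close> takes the same values along both.\<close>

lemma Q1_conj:
  assumes U: "U \<in> block_orth c" and Z: "Z \<in> block_sym c" and H: "H \<in> block_sym c"
  shows "Q1 (U ** Z ** transpose U) (U ** H ** transpose U) = Q1 Z H"
proof -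
  have "(\<lambda>t. Q (U ** Z ** transpose U + t *\<^sub>R (U ** H ** transpose U))) = (\<lambda>t. Q (Z + t *\<^sub>R H))"
    unfolding conj_line[symmetric] using inv[OF U] Z H by (simp add: block_sym_add block_sym_scaleR)
  then show ?thesis
    using line_deriv1[of "U ** Z ** transpose U" "U ** H ** transpose U"] line_deriv1[of Z H]
    by (simp add: vector_derivative_unique_at)
qed

lemma Q2_conj:
  assumes U: "U \<in> block_orth c" and Z: "Z \<in> block_sym c" and H: "H \<in> block_sym c" and K: "K \<in> block_sym c"
  shows "Q2 (U ** Z ** transpose U) (U ** K ** transpose U) (U ** H ** transpose U) = Q2 Z K H"
proof -
  have "(\<lambda>t. Q1 (U ** Z ** transpose U + t *\<^sub>R (U ** K ** transpose U)) (U ** H ** transpose U)) = (\<lambda>t. Q1 (Z + t *\<^sub>R K) H)"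
    unfolding conj_line[symmetric] using Q1_conj[OF U _ H] Z K by (simp add: block_sym_add block_sym_scaleR)
  then show ?thesis
    using line_deriv2'[of "U ** Z ** transpose U" "U ** K ** transpose U" "U ** H ** transpose U"] line_deriv2'[of Z K H]
    by (simp add: vector_derivative_unique_at)
qed

text \<open>\<open>Q\<close> is constant along the rotation orbit of \<open>Z\<close>, whose
  velocity at time 0 is \<open>rot_ad i j Z\<close>.\<close>

lemma Q1_rot_ad:
  assumes ij: "i \<noteq> j" "c $ i = c $ j" and Z: "Z \<in> block_sym c"
  shows "Q1 Z (rot_ad i j Z) = 0"
proof -
  let ?R = "\<lambda>t. givens i j (cos t) (sin t)"
  note R = givens_curve_orth[of i j c, OF ij] and one = givens_curve_0[of i j]
  have "((\<lambda>t. Q (?R t ** Z ** transpose (?R t))) has_vector_derivative Q1 Z (rot_ad i j Z)) (at 0)"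
  proof -
    have "((Q \<circ> (\<lambda>t. ?R t ** Z ** transpose (?R t))) has_vector_derivative Q1 Z (rot_ad i j Z)) (at 0)"
      by (rule vector_derivative_diff_chain_within[OF givens_curve_has_derivative[OF ij(1), of Z]])
        (simp only: one has_derivative_at_withinI[OF Q1])
    then show ?thesis by (simp add: o_def)
  qed
  moreover have "(\<lambda>t. Q (?R t ** Z ** transpose (?R t))) = (\<lambda>t. Q Z)" using inv[OF R Z] by simp
  ultimately show ?thesis using has_vector_derivative_const[of "Q Z" "at 0"]
    by (simp add: vector_derivative_unique_at)
qed

text \<open>The derivative of \<open>Q\<close> at the rotated point in the rotated direction is
  constant in time; the product rule at time 0 gives two terms that cancel. A second derivative in
  an orbit direction is thus a first derivative.\<close>

lemma Q2_rot_ad: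
  assumes ij: "i \<noteq> j" "c $ i = c $ j" and Z: "Z \<in> block_sym c" and H: "H \<in> block_sym c"
  shows "Q2 Z (rot_ad i j Z) H = - Q1 Z (rot_ad i j H)"
proof -
  let ?R = "\<lambda>t. givens i j (cos t) (sin t)"
  note R = givens_curve_orth[of i j c, OF ij] and one = givens_curve_0[of i j]
  have d: "((\<lambda>t. Q1 (?R t ** Z ** transpose (?R t))) has_vector_derivative Q2 Z (rot_ad i j Z)) (at 0)"
  proof -
    have "((Q1 \<circ> (\<lambda>t. ?R t ** Z ** transpose (?R t))) has_vector_derivative Q2 Z (rot_ad i j Z)) (at 0)"
      by (rule vector_derivative_diff_chain_within[OF givens_curve_has_derivative[OF ij(1), of Z]])
        (simp only: one has_derivative_at_withinI[OF Q2])
    then show ?thesis by (simp add: o_def)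
  qed
  have "((\<lambda>t. Q1 (?R t ** Z ** transpose (?R t)) (?R t ** H ** transpose (?R t)))
      has_vector_derivative Q1 Z (rot_ad i j H) + Q2 Z (rot_ad i j Z) H) (at 0)"
    using bounded_bilinear.has_vector_derivative[OF bounded_bilinear_blinfun_apply d givens_curve_has_derivative[OF ij(1), of H]]
    unfolding one .
  moreover have "(\<lambda>t. Q1 (?R t ** Z ** transpose (?R t)) (?R t ** H ** transpose (?R t))) = (\<lambda>t. Q1 Z H)"
    using Q1_conj[OF R Z H] by simp
  ultimately have "Q1 Z (rot_ad i j H) + Q2 Z (rot_ad i j Z) H = 0"
    using has_vector_derivative_const[of "Q1 Z H" "at 0"] by (simp add: vector_derivative_unique_at)
  then show ?thesis by simp
qed

text \<open>The gradient at a diagonal matrix is diagonal. With distinct entries every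
  \<open>esym i j\<close> inside a block is an orbit direction, along which the derivative vanishes;
  the remaining diagonal matrices are limits of such ones.\<close>

lemma Q1_diag_diag_vec:
  assumes H: "H \<in> block_sym c"
  shows "Q1 (diag_mat x) H = Q1 (diag_mat x) (diag_mat (diag_vec H))"
proof -
  have dist: "Q1 (diag_mat x) H = Q1 (diag_mat x) (diag_mat (diag_vec H))" if x: "\<forall>i j. i \<noteq> j \<longrightarrow> x $ i \<noteq> x $ j" for x
  proof -
    have "Q1 (diag_mat x) (esym i j) = 0" if "i \<noteq> j" "c $ i = c $ j" for i j
      using Q1_rot_ad[OF that diag_mat_in_block_sym, of x] x that by (simp add: rot_ad_diag_mat blinfun.scaleR_right)
    then have "Q1 (diag_mat x) (\<Sum>i\<in>UNIV. \<Sum>j\<in>UNIV. if i \<noteq> j \<and> c $ i = c $ j then (H $ i $ j / 2) *\<^sub>R esym i j else 0) = 0"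
      by (auto simp: blinfun.sum_right blinfun.scaleR_right intro!: sum.neutral)
    then show ?thesis
      by (subst block_sym_decomp[OF H]) (simp add: blinfun.add_right)
  qed
  obtain w :: "real^'n::{finite,linorder}" where
    w: "\<And>x. \<forall>\<^sub>F t in at_right 0. \<forall>i j. i \<noteq> j \<longrightarrow> (x + t *\<^sub>R w) $ i \<noteq> (x + t *\<^sub>R w) $ j"
    using distinct_perturbation by blast
  have lim: "((\<lambda>t. Q1 (diag_mat (x + t *\<^sub>R w)) A) \<longlongrightarrow> Q1 (diag_mat x) A) (at_right 0)" for A
    using tendsto_diag_mat_line[of "\<lambda>Z. Q1 Z A"] Q1_cont by (simp add: continuous_intros)
  have "\<forall>\<^sub>F t in at_right 0. Q1 (diag_mat (x + t *\<^sub>R w)) H = Q1 (diag_mat (x + t *\<^sub>R w)) (diag_mat (diag_vec H))"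
    using w[of x] by eventually_elim (rule dist)
  from tendsto_cong[THEN iffD1, OF this lim[of H]] show ?thesis
    using lim[of "diag_mat (diag_vec H)"] tendsto_unique trivial_limit_at_right_real by blast
qed

text \<open>Differentiating the invariance under rotations in the plane of the coordinates \<open>i\<close>, \<open>j\<close> turns this
  second derivative into a difference quotient of first derivatives, taken at \<open>x\<close> and at \<open>x\<close> with its
  coordinates \<open>i\<close> and \<open>j\<close> swapped; the Lipschitz hypothesis controls it.\<close>

lemma Q2_esym_bound:
  assumes x: "x \<in> ball c r" and ij: "i \<noteq> j" "c $ i = c $ j" and H: "H \<in> block_sym c"
  shows "\<bar>Q2 (diag_mat x) (esym i j) H\<bar> \<le> 4 * \<epsilon> * norm H"
proof -
  let ?t = "Transposition.transpose i j"
  have tp: "?t permutes UNIV" by (simp add: permutes_swap_id)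
  have dist: "\<bar>Q2 (diag_mat x) (esym i j) H\<bar> \<le> 4 * \<epsilon> * norm H"
    if x: "x \<in> ball c r" and d: "\<forall>i j. i \<noteq> j \<longrightarrow> x $ i \<noteq> x $ j" for x
  proof -
    let ?y = "perm_act ?t x"
    have "perm_act ?t c = c" by (simp add: perm_act_transpose ij)
    then have y: "?y \<in> ball c r" using dist_perm_act[OF tp, of c x] x by simp
    have R: "givens i j 0 1 \<in> block_orth c" by (rule givens_orth) (use ij in auto)
    have tj: "perm_act ?t (axis j 1) = (axis i 1 :: (real, 'n) vec)"
      using ij by (simp add: perm_act_transpose axis_def)
    have "Q1 (diag_mat ?y) (diag_mat (axis i 1)) = Q1 (diag_mat x) (diag_mat (axis j 1))"
      using Q1_conj[OF R diag_mat_in_block_sym diag_mat_in_block_sym, of x "axis j 1"]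
      by (simp add: givens_swap_diag_mat[OF ij(1)] tj)
    then have "\<bar>Q1 (diag_mat x) (diag_mat (axis j 1)) - Q1 (diag_mat x) (diag_mat (axis i 1))\<bar> \<le> \<epsilon> * norm (?y - x)"
      using lip[OF y x, of "axis i 1"] by simp
    moreover have "norm (?y - x) \<le> 2 * \<bar>x $ i - x $ j\<bar>"
    proof -
      have "norm (axis i 1 - axis j 1 :: (real, 'n) vec) \<le> 2"
        using norm_triangle_ineq4[of "axis i 1" "axis j 1 :: (real, 'n) vec"] by simp
      then have "\<bar>x $ i - x $ j\<bar> * norm (axis i 1 - axis j 1 :: (real, 'n) vec) \<le> \<bar>x $ i - x $ j\<bar> * 2"
        by (rule mult_left_mono) simp
      then show ?thesis by (simp add: perm_act_transpose mult.commute)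
    qed
    ultimately have b: "\<bar>Q1 (diag_mat x) (diag_mat (axis j 1 - axis i 1))\<bar> \<le> \<epsilon> * (2 * \<bar>x $ i - x $ j\<bar>)"
      using e0 by (smt (verit) blinfun.diff_right linear_diff[OF linear_diag_mat] mult_left_mono)
    have "(x $ i - x $ j) * Q2 (diag_mat x) (esym i j) H = Q2 (diag_mat x) (rot_ad i j (diag_mat x)) H"
      by (simp add: rot_ad_diag_mat[OF ij(1)] blinfun.scaleR_right blinfun.scaleR_left)
    also have "\<dots> = - Q1 (diag_mat x) (rot_ad i j H)" by (rule Q2_rot_ad[OF ij diag_mat_in_block_sym H])
    also have "\<dots> = - (2 * H $ i $ j) * Q1 (diag_mat x) (diag_mat (axis j 1 - axis i 1))"
      using Q1_diag_diag_vec[OF rot_ad_in_block_sym[OF ij H]] diag_vec_rot_ad[OF ij(1), of H] block_symD(1)[OF H, of i j]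
      by (simp add: linear_cmul[OF linear_diag_mat] blinfun.scaleR_right)
    finally have "\<bar>(x $ i - x $ j) * Q2 (diag_mat x) (esym i j) H\<bar> =
        \<bar>- (2 * H $ i $ j) * Q1 (diag_mat x) (diag_mat (axis j 1 - axis i 1))\<bar>" by simp
    then have "\<bar>x $ i - x $ j\<bar> * \<bar>Q2 (diag_mat x) (esym i j) H\<bar> =
       2 * \<bar>H $ i $ j\<bar> * \<bar>Q1 (diag_mat x) (diag_mat (axis j 1 - axis i 1))\<bar>"
      by (simp add: abs_mult)
    \<comment> \<open>One factor 2 comes from the diagonal of \<open>rot_ad i j H\<close>, the other
      from the distance of \<open>x\<close> to its swapped image; the gap now stands on both sides
      and cancels, since it is nonzero for distinct coordinates.\<close>
    also have "\<dots> \<le> 2 * norm H * (\<epsilon> * (2 * \<bar>x $ i - x $ j\<bar>))"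
      using entry_le_norm[of H i j] b e0 by (intro mult_mono) auto
    finally have "\<bar>x $ i - x $ j\<bar> * \<bar>Q2 (diag_mat x) (esym i j) H\<bar> \<le> \<bar>x $ i - x $ j\<bar> * (4 * \<epsilon> * norm H)"
      by (simp add: algebra_simps)
    then show ?thesis using d ij(1) by simp
  qed
  obtain w :: "real^'n::{finite,linorder}" where
    w: "\<And>x. \<forall>\<^sub>F t in at_right 0. \<forall>i j. i \<noteq> j \<longrightarrow> (x + t *\<^sub>R w) $ i \<noteq> (x + t *\<^sub>R w) $ j"
    using distinct_perturbation by blast
  have lim: "((\<lambda>t. \<bar>Q2 (diag_mat (x + t *\<^sub>R w)) (esym i j) H\<bar>) \<longlongrightarrow> \<bar>Q2 (diag_mat x) (esym i j) H\<bar>) (at_right 0)"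
    using tendsto_diag_mat_line[of "\<lambda>Z. \<bar>Q2 Z (esym i j) H\<bar>"] Q2_cont by (simp add: continuous_intros)
  from eventually_line_in_ball[OF x, of w]
    w[of x] have "\<forall>\<^sub>F t in at_right 0. \<bar>Q2 (diag_mat (x + t *\<^sub>R w)) (esym i j) H\<bar> \<le> 4 * \<epsilon> * norm H"
    by eventually_elim (use dist in blast)
  then show ?thesis using tendsto_upperbound[OF lim] by simp
qed

text \<open>Along lines of diagonal matrices the Lipschitz hypothesis bounds the difference
  quotients whose limit is this second derivative.\<close>

lemma Q2_diag_diag_bound:
  assumes x: "x \<in> ball c r"
  shows "\<bar>Q2 (diag_mat x) (diag_mat k) (diag_mat h)\<bar> \<le> \<epsilon> * norm k * norm h"
proof -
  have "((\<lambda>t. Q1 (diag_mat (x + t *\<^sub>R k)) (diag_mat h)) has_vector_derivative Q2 (diag_mat x) (diag_mat k) (diag_mat h)) (at 0)"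
    using line_deriv2'[of "diag_mat x" "diag_mat k" "diag_mat h"]
    by (simp add: linear_add[OF linear_diag_mat] linear_cmul[OF linear_diag_mat])
  then have "((\<lambda>t. (Q1 (diag_mat (x + t *\<^sub>R k)) (diag_mat h) - Q1 (diag_mat x) (diag_mat h)) / t)
      \<longlongrightarrow> Q2 (diag_mat x) (diag_mat k) (diag_mat h)) (at 0)"
    by (simp add: has_real_derivative_iff_has_vector_derivative[symmetric] has_field_derivative_iff)
  then have lim: "((\<lambda>t. \<bar>(Q1 (diag_mat (x + t *\<^sub>R k)) (diag_mat h) - Q1 (diag_mat x) (diag_mat h)) / t\<bar>)
      \<longlongrightarrow> \<bar>Q2 (diag_mat x) (diag_mat k) (diag_mat h)\<bar>) (at_right 0)"
    by (intro tendsto_rabs) (simp add: filterlim_at_split)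
  have "\<forall>\<^sub>F t in at_right 0. x + t *\<^sub>R k \<in> ball c r" by (rule eventually_line_in_ball[OF x])
  moreover have "\<forall>\<^sub>F t :: real in at_right 0. t > 0" by (simp add: eventually_at_right_less)
  ultimately have "\<forall>\<^sub>F t in at_right 0. \<bar>(Q1 (diag_mat (x + t *\<^sub>R k)) (diag_mat h) - Q1 (diag_mat x) (diag_mat h)) / t\<bar>
     \<le> \<epsilon> * norm k * norm h"
  proof eventually_elim
    case (elim t)
    then show ?case using lip[OF elim(1) x, of h] by (simp add: field_simps)
  qed
  then show ?thesis using tendsto_upperbound[OF lim] by simp
qed

lemma Q1_bound:
  assumes X: "X \<in> block_sym c" "norm (X - diag_mat c) < r" and H: "H \<in> block_sym c"
  shows "\<bar>Q1 X H\<bar> \<le> \<epsilon> * norm H"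
proof -
  obtain U y where U: "U \<in> block_orth c" "X = U ** diag_mat y ** transpose U"
    using block_spectral[OF X(1)] by metis
  have y: "y \<in> ball c r" using X(2) norm_conj_diag[OF U(1), of y] U(2) by (simp add: dist_norm norm_minus_commute)
  obtain H' where H': "H' \<in> block_sym c" and HH: "H = U ** H' ** transpose U" and nH: "norm H' = norm H"
    using conj_block_symE[OF U(1) H] by blast
  have "Q1 X H = Q1 (diag_mat y) (diag_mat (diag_vec H'))"
    unfolding HH U(2) Q1_conj[OF U(1) diag_mat_in_block_sym H'] by (rule Q1_diag_diag_vec[OF H'])
  also have "\<bar>\<dots>\<bar> \<le> \<epsilon> * norm (diag_vec H')" by (rule bnd[OF y])
  also have "\<dots> \<le> \<epsilon> * norm H'" using norm_diag_vec_le e0 by (intro mult_left_mono)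
  finally show ?thesis unfolding nH .
qed

text \<open>Diagonalising \<open>X\<close> reduces to a diagonal base point. There the diagonal part
  of \<open>K\<close> contributes 1 to the constant, and each of the \<open>CARD('n) ^ 2\<close>
  index pairs contributes 2, namely the 4 of the off-diagonal bound times the coefficient
  1/2.\<close>

lemma Q2_bound:
  assumes X: "X \<in> block_sym c" "norm (X - diag_mat c) < r" and H: "H \<in> block_sym c" and K: "K \<in> block_sym c"
  shows "\<bar>Q2 X K H\<bar> \<le> (1 + 2 * real CARD('n) ^ 2) * \<epsilon> * norm K * norm H"
proof -
  obtain U y where U: "U \<in> block_orth c" "X = U ** diag_mat y ** transpose U"
    using block_spectral[OF X(1)] by metis
  have y: "y \<in> ball c r" using X(2) norm_conj_diag[OF U(1), of y] U(2) by (simp add: dist_norm norm_minus_commute)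
  have main: "\<bar>Q2 (diag_mat y) K H\<bar> \<le> (1 + 2 * real CARD('n) ^ 2) * \<epsilon> * norm K * norm H"
    if H: "H \<in> block_sym c" and K: "K \<in> block_sym c" for H K
  proof -
    have "Q2 (diag_mat y) (diag_mat k) H = Q2 (diag_mat y) (diag_mat k) (diag_mat (diag_vec H))" for k
    proof -
      \<comment> \<open>The line stays among diagonal matrices, where the first derivative sees only
        the diagonal of \<open>H\<close>; differentiating in \<open>t\<close> passes this on to the
        second derivative.\<close>
      have "(\<lambda>t. Q1 (diag_mat y + t *\<^sub>R diag_mat k) H) = (\<lambda>t. Q1 (diag_mat y + t *\<^sub>R diag_mat k) (diag_mat (diag_vec H)))"
        using Q1_diag_diag_vec[OF H, of "y + _ *\<^sub>R k"]
        by (simp add: linear_add[OF linear_diag_mat] linear_cmul[OF linear_diag_mat])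
      then show ?thesis
        using line_deriv2'[of "diag_mat y" "diag_mat k" H] line_deriv2'[of "diag_mat y" "diag_mat k" "diag_mat (diag_vec H)"]
        by (simp add: vector_derivative_unique_at)
    qed
    then have "\<bar>Q2 (diag_mat y) (diag_mat (diag_vec K)) H\<bar> \<le> \<epsilon> * norm (diag_vec K) * norm (diag_vec H)"
      using Q2_diag_diag_bound[OF y] by simp
    also have "\<dots> \<le> \<epsilon> * norm K * norm H"
      using norm_diag_vec_le[of K] norm_diag_vec_le[of H] e0 by (intro mult_mono) auto
    finally have b1: "\<bar>Q2 (diag_mat y) (diag_mat (diag_vec K)) H\<bar> \<le> \<epsilon> * norm K * norm H" .
    have b2: "\<bar>Q2 (diag_mat y) (if i \<noteq> j \<and> c $ i = c $ j then (K $ i $ j / 2) *\<^sub>R esym i j else 0) H\<bar>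
        \<le> 2 * \<epsilon> * norm K * norm H" for i j
    proof (cases "i \<noteq> j \<and> c $ i = c $ j")
      case True
      have "\<bar>K $ i $ j / 2\<bar> * \<bar>Q2 (diag_mat y) (esym i j) H\<bar> \<le> (norm K / 2) * (4 * \<epsilon> * norm H)"
        using True entry_le_norm[of K i j] e0 by (intro mult_mono Q2_esym_bound[OF y] H) auto
      then show ?thesis using True by (simp add: blinfun.scaleR_right blinfun.scaleR_left abs_mult algebra_simps)
    next
      case False
      then show ?thesis using e0 by auto
    qed
    have "Q2 (diag_mat y) K H = Q2 (diag_mat y) (diag_mat (diag_vec K)) H +
      (\<Sum>i\<in>UNIV. \<Sum>j\<in>UNIV. Q2 (diag_mat y) (if i \<noteq> j \<and> c $ i = c $ j then (K $ i $ j / 2) *\<^sub>R esym i j else 0) H)"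
      by (subst block_sym_decomp[OF K]) (simp only: blinfun.add_right blinfun.add_left blinfun.sum_right blinfun.sum_left)
    also have "\<bar>\<dots>\<bar> \<le> \<epsilon> * norm K * norm H + (\<Sum>i\<in>(UNIV :: 'n set). \<Sum>j\<in>(UNIV :: 'n set). 2 * \<epsilon> * norm K * norm H)"
      by (intro order_trans[OF abs_triangle_ineq] add_mono b1 order_trans[OF sum_abs] sum_mono b2)
    also have "\<dots> = (1 + 2 * real CARD('n) ^ 2) * \<epsilon> * norm K * norm H"
      by (simp add: algebra_simps power2_eq_square)
    finally show ?thesis .
  qed
  obtain H' where H': "H' \<in> block_sym c" and HH: "H = U ** H' ** transpose U" and nH: "norm H' = norm H"
    using conj_block_symE[OF U(1) H] by blast
  obtain K' where K': "K' \<in> block_sym c" and KK: "K = U ** K' ** transpose U" and nK: "norm K' = norm K"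
    using conj_block_symE[OF U(1) K] by blast
  have "Q2 X K H = Q2 (diag_mat y) K' H'"
    unfolding HH KK U(2) by (rule Q2_conj[OF U(1) diag_mat_in_block_sym H' K'])
  then show ?thesis using main[OF H' K'] by (simp add: nH nK)
qed

end

section \<open>Lifting symmetric C2 functions to matrices\<close>

text \<open>The orthogonal projection onto \<open>block_sym c\<close>. Precomposing with it extends
  functions of block symmetric matrices to the full matrix space, where \<open>C2_on\<close> is
  formulated.\<close>

definition block_proj :: "real^'n \<Rightarrow> real^'n^'n \<Rightarrow> real^'n^'n" where
  "block_proj c X = (\<chi> i j. if c $ i = c $ j then (X $ i $ j + X $ j $ i) / 2 else 0)"

lemma bounded_linear_block_proj: "bounded_linear (block_proj c)"
  by (intro linear_conv_bounded_linear[THEN iffD1] linearI) (auto simp: vec_eq_iff block_proj_def algebra_simps add_divide_distrib)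

lemma block_proj_in_block_sym: "block_proj c X \<in> block_sym c"
  by (rule block_symI) (auto simp: block_proj_def add.commute)

lemma block_proj_block_sym:
  assumes "X \<in> block_sym c"
  shows "block_proj c X = X"
proof -
  have "block_proj c X $ i $ j = X $ i $ j" for i j
    using block_symD(1)[OF assms, of i j] block_symD(2)[OF assms, of i j] by (auto simp: block_proj_def)
  then show ?thesis by (simp add: vec_eq_iff)
qed

lemma conj_diag_in_block_sym: "U \<in> block_orth c \<Longrightarrow> U ** diag_mat y ** transpose U \<in> block_sym c"
  by (rule block_sym_conj[OF _ diag_mat_in_block_sym])

text \<open>\<open>lam\<close> is any choice of block eigenvalues; symmetry of \<open>g\<close>
  makes the choice immaterial. In particular \<open>lam (diag_mat x)\<close> may be a rearrangement
  of \<open>x\<close>, and the second claim holds because both sides are limits of the same values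
  of the lifted polynomials.\<close>

lemma spectral_lift_C2:
  fixes c :: "real^'n::{finite,linorder}" and g :: "real^'n::{finite,linorder} \<Rightarrow> real"
  assumes C2: "C2_on UNIV g" and supp: "\<And>y. y \<notin> cball c r \<Longrightarrow> g y = 0" and r: "r > 0"
    and sym: "\<And>h x. h \<in> perm_stab c \<Longrightarrow> g (perm_act h x) = g x"
    and lam: "\<And>Z. Z \<in> block_sym c \<Longrightarrow> \<exists>U\<in>block_orth c. Z = U ** diag_mat (lam Z) ** transpose U"
  shows "C2_on {X. norm (block_proj c X - diag_mat c) < r} (\<lambda>X. g (lam (block_proj c X)))"
    and "x \<in> ball c r \<Longrightarrow> g (lam (diag_mat x)) = g x"
proof -
  obtain g1 g2 where "C2_with UNIV g g1 g2" using C2 C2_on_iff_C2_with by blast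
  note g = C2_withD[OF this, simplified]
  obtain p p1 p2 where pm: "\<And>k. mono_span (p k)"
    and p1: "\<And>k x. x \<in> ball c r \<Longrightarrow> (p k has_derivative blinfun_apply (p1 k x)) (at x)"
    and p2: "\<And>k x. x \<in> ball c r \<Longrightarrow> (p1 k has_derivative blinfun_apply (p2 k x)) (at x)"
    and u0: "uniform_limit (ball c r) p g sequentially"
    and u1: "uniform_limit (ball c r) p1 g1 sequentially"
    and u2: "uniform_limit (ball c r) p2 g2 sequentially"
    using C2_approx_by_mono_span[OF g supp r] by blast
  define G where "G = perm_stab c"
  define N where "N = real (card G)"
  have N: "N > 0" using card_perm_stab_pos by (simp add: N_def G_def)
  have Gp: "h permutes UNIV" "perm_act h c = c" if "h \<in> G" for h using that by (auto simp: G_def perm_stab_def)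
  have Gball: "perm_act h x \<in> ball c r" if "h \<in> G" "x \<in> ball c r" for h x
    using dist_perm_act[OF Gp(1)[OF that(1)], of c x] Gp(2)[OF that(1)] that(2) by simp
  have "\<forall>k. \<exists>Q. real_polynomial_function Q \<and>
     (\<forall>U\<in>block_orth c. \<forall>y. Q (U ** diag_mat y ** transpose U) = (\<Sum>h\<in>G. p k (perm_act h y)))"
    using mono_span_lift[OF pm] unfolding G_def by blast
  from choice[OF this] obtain Q where Qp: "\<And>k. real_polynomial_function (Q k)"
    and Q: "\<And>k U y. U \<in> block_orth c \<Longrightarrow> Q k (U ** diag_mat y ** transpose U) = (\<Sum>h\<in>G. p k (perm_act h y))"
    by blast
  \<comment> \<open>Division by the order of the stabiliser turns the sum produced by the lift into
    an average, whose limit is \<open>g\<close> itself.\<close>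
  define f where "f k X = 1 / N * Q k (block_proj c X)" for k X
  have f: "f k (U ** diag_mat y ** transpose U) = 1 / N * (\<Sum>h\<in>G. p k (perm_act h y))" if "U \<in> block_orth c" for k U y
    unfolding f_def block_proj_block_sym[OF conj_diag_in_block_sym[OF that]] Q[OF that] ..
  have fd: "f k (diag_mat y) = 1 / N * (\<Sum>h\<in>G. p k (perm_act h y))" for k y
    using f[OF mat_1_in_block_orth, of k y] by simp
  have fb: "f k (block_proj c X) = f k X" for k X by (simp add: f_def block_proj_block_sym[OF block_proj_in_block_sym])
  have "C2_on UNIV (f k)" for k
    unfolding f_def
    by (intro C2_on_cmult C2_on_compose_linear[OF C2_on_real_polynomial_function[OF Qp, of UNIV] bounded_linear_block_proj]) auto
  then have "\<forall>k. \<exists>F1 F2. C2_with UNIV (f k) F1 F2" by (simp add: C2_on_iff_C2_with)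
  from choice[OF this] obtain F1 where "\<forall>k. \<exists>F2. C2_with UNIV (f k) (F1 k) F2" by blast
  from choice[OF this] obtain F2 where "\<And>k. C2_with UNIV (f k) (F1 k) (F2 k)" by blast
  note F1 = C2_withD(1)[OF this UNIV_I] and F2 = C2_withD(2)[OF this UNIV_I] and cF2 = C2_withD(3)[OF this]
  have dP: "(block_proj c has_derivative block_proj c) (at X)" for X
    by (rule bounded_linear_imp_has_derivative[OF bounded_linear_block_proj])
  \<comment> \<open>Since \<open>f k\<close> factors through the projection, so do its derivatives;
    bounds on \<open>block_sym c\<close> therefore yield bounds in all directions, at the price of a
    factor \<open>B\<close> per argument.\<close>
  have F1P: "F1 k X H = F1 k (block_proj c X) (block_proj c H)" for k X H
  proof -
    have "((\<lambda>X. f k (block_proj c X)) has_derivative (\<lambda>H. F1 k (block_proj c X) (block_proj c H))) (at X)"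
      by (rule has_derivative_compose[OF dP F1])
    then have "(f k has_derivative (\<lambda>H. F1 k (block_proj c X) (block_proj c H))) (at X)" by (simp add: fb)
    from has_derivative_unique[OF F1 this] show ?thesis by metis
  qed
  have F2P: "F2 k X K H = F2 k (block_proj c X) (block_proj c K) (block_proj c H)" for k X K H
  proof -
    have "((\<lambda>X. F1 k (block_proj c X) (block_proj c H)) has_derivative (\<lambda>K. F2 k (block_proj c X) (block_proj c K) (block_proj c H))) (at X)"
      by (rule bounded_linear.has_derivative[OF blinfun.bounded_linear_left has_derivative_compose[OF dP F2]])
    moreover have "((\<lambda>X. F1 k X H) has_derivative (\<lambda>K. F2 k X K H)) (at X)"
      by (rule bounded_linear.has_derivative[OF blinfun.bounded_linear_left F2])
    ultimately have "(\<lambda>K. F2 k X K H) = (\<lambda>K. F2 k (block_proj c X) (block_proj c K) (block_proj c H))"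
      unfolding F1P[of k _ H, symmetric] by (intro has_derivative_unique)
    then show ?thesis by metis
  qed
  have F1diag: "F1 k (diag_mat x) (diag_mat v) = 1 / N * (\<Sum>h\<in>G. p1 k (perm_act h x) (perm_act h v))"
    if x: "x \<in> ball c r" for k x v
  proof -
    have "((\<lambda>x. f k (diag_mat x)) has_derivative (\<lambda>v. F1 k (diag_mat x) (diag_mat v))) (at x)"
      by (rule has_derivative_compose[OF linear_imp_has_derivative[OF linear_diag_mat] F1])
    moreover have "((\<lambda>x. 1 / N * (\<Sum>h\<in>G. p k (perm_act h x))) has_derivative
        (\<lambda>v. 1 / N * (\<Sum>h\<in>G. p1 k (perm_act h x) (perm_act h v)))) (at x)"
      by (intro has_derivative_mult_right has_derivative_sum
          has_derivative_compose[OF linear_imp_has_derivative[OF linear_perm_act]] p1 Gball x)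
    ultimately have "(\<lambda>v. F1 k (diag_mat x) (diag_mat v)) = (\<lambda>v. 1 / N * (\<Sum>h\<in>G. p1 k (perm_act h x) (perm_act h v)))"
      unfolding fd by (intro has_derivative_unique)
    then show ?thesis by metis
  qed
  obtain B where B: "B > 0" "\<And>H. norm (block_proj c H) \<le> B * norm H"
    using bounded_linear.pos_bounded[OF bounded_linear_block_proj] by (metis mult.commute)
  define C where "C = 1 + 2 * real CARD('n) ^ 2"
  have C: "C > 0" by (simp add: C_def add_pos_nonneg)
  define W where "W = {X. norm (block_proj c X - diag_mat c) < r}"
  have key: "\<exists>M. \<forall>m\<ge>M. \<forall>n\<ge>M. \<forall>X\<in>W. norm (F1 m X - F1 n X) \<le> e * B \<and> norm (F2 m X - F2 n X) \<le> C * e * B * B"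
    if e: "e > 0" for e
  proof -
    have "uniformly_Cauchy_on (ball c r) p1" "uniformly_Cauchy_on (ball c r) p2"
      using u1 u2 by (auto intro!: uniformly_convergent_Cauchy simp: uniformly_convergent_on_def)
    then obtain M1 M2 where M1: "\<forall>x\<in>ball c r. \<forall>m\<ge>M1. \<forall>n\<ge>M1. dist (p1 m x) (p1 n x) < e"
      and M2: "\<forall>x\<in>ball c r. \<forall>m\<ge>M2. \<forall>n\<ge>M2. dist (p2 m x) (p2 n x) < e"
      unfolding uniformly_Cauchy_on_def using e by meson
    have "norm (F1 m X - F1 n X) \<le> e * B \<and> norm (F2 m X - F2 n X) \<le> C * e * B * B"
      if mn: "m \<ge> max M1 M2" "n \<ge> max M1 M2" and X: "X \<in> W" for m n X
    proof -
      define D where "D x = p1 m x - p1 n x" for x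
      have D: "norm (D x) \<le> e" if "x \<in> ball c r" for x
        using M1 that mn by (auto simp: D_def dist_norm intro: less_imp_le)
      have Dlip: "norm (D x - D y) \<le> e * norm (x - y)" if "x \<in> ball c r" "y \<in> ball c r" for x y
      proof (rule differentiable_bound[where S="ball c r" and f'="\<lambda>z. blinfun_apply (p2 m z - p2 n z)"])
        fix z assume z: "z \<in> ball c r"
        show "(D has_derivative blinfun_apply (p2 m z - p2 n z)) (at z within ball c r)"
          unfolding D_def minus_blinfun.rep_eq
          by (rule has_derivative_at_withinI[OF has_derivative_diff[OF p2[OF z] p2[OF z]]])
        show "onorm (blinfun_apply (p2 m z - p2 n z)) \<le> e"
          using M2 z mn by (auto simp: norm_blinfun.rep_eq[symmetric] dist_norm intro: less_imp_le)
      qed (use that in auto)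
      have avg: "\<bar>1 / N * (\<Sum>h\<in>G. a h)\<bar> \<le> b" if "\<And>h. h \<in> G \<Longrightarrow> \<bar>a h\<bar> \<le> b" for a and b :: real
      proof -
        have "\<bar>\<Sum>h\<in>G. a h\<bar> \<le> (\<Sum>h\<in>G. b)" using that by (intro order_trans[OF sum_abs] sum_mono)
        then have "\<bar>\<Sum>h\<in>G. a h\<bar> \<le> N * b" by (simp add: N_def)
        then show ?thesis using N by (simp add: abs_mult field_simps)
      qed
      have dd: "(F1 m (diag_mat x) - F1 n (diag_mat x)) (diag_mat v) = 1 / N * (\<Sum>h\<in>G. D (perm_act h x) (perm_act h v))"
        if "x \<in> ball c r" for x v
        using that by (simp add: blinfun.diff_left F1diag D_def sum_subtractf diff_divide_distrib)
      \<comment> \<open>Taking the difference of two lifts as the invariant function makes the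
        bounds of the locale Cauchy estimates, uniform over \<open>W\<close>.\<close>
      interpret block_invariant c "\<lambda>X. f m X - f n X" "\<lambda>X. F1 m X - F1 n X" "\<lambda>X. F2 m X - F2 n X" r e
      proof
        show "((\<lambda>X. f m X - f n X) has_derivative blinfun_apply (F1 m X - F1 n X)) (at X)" for X
          unfolding minus_blinfun.rep_eq by (intro has_derivative_diff F1)
        show "((\<lambda>X. F1 m X - F1 n X) has_derivative blinfun_apply (F2 m X - F2 n X)) (at X)" for X
          unfolding minus_blinfun.rep_eq by (intro has_derivative_diff F2)
        show "continuous_on UNIV (\<lambda>X. F2 m X - F2 n X)" by (intro continuous_intros cF2)
        show "f m (U ** Z ** transpose U) - f n (U ** Z ** transpose U) = f m Z - f n Z"
          if U: "U \<in> block_orth c" and Z: "Z \<in> block_sym c" for U Z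
        proof -
          obtain V where V: "V \<in> block_orth c" "Z = V ** diag_mat (lam Z) ** transpose V" using lam[OF Z] by blast
          have "U ** Z ** transpose U = (U ** V) ** diag_mat (lam Z) ** transpose (U ** V)"
            by (subst V(2)) (simp only: matrix_transpose_mul matrix_mul_assoc)
          then have "f k (U ** Z ** transpose U) = f k Z" for k
            using f[OF block_orth_mult[OF U V(1)], of k "lam Z"] f[OF V(1), of k "lam Z"] V(2) by simp
          then show ?thesis by simp
        qed
        show "0 \<le> e" using e by simp
        show "\<bar>(F1 m (diag_mat x) - F1 n (diag_mat x)) (diag_mat v)\<bar> \<le> e * norm v" if x: "x \<in> ball c r" for x v
          unfolding dd[OF x]
        proof (rule avg)
          fix h assume h: "h \<in> G"
          have "\<bar>D (perm_act h x) (perm_act h v)\<bar> \<le> norm (D (perm_act h x)) * norm v"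
            using norm_blinfun[of "D (perm_act h x)" "perm_act h v"] norm_perm_act[OF Gp(1)[OF h], of v] by simp
          also have "\<dots> \<le> e * norm v" by (intro mult_right_mono D Gball h x) simp
          finally show "\<bar>D (perm_act h x) (perm_act h v)\<bar> \<le> e * norm v" .
        qed
        show "\<bar>(F1 m (diag_mat x) - F1 n (diag_mat x)) (diag_mat v) - (F1 m (diag_mat y) - F1 n (diag_mat y)) (diag_mat v)\<bar>
           \<le> e * norm (x - y) * norm v" if x: "x \<in> ball c r" and y: "y \<in> ball c r" for x y v
        proof -
          have "\<bar>1 / N * (\<Sum>h\<in>G. (D (perm_act h x) - D (perm_act h y)) (perm_act h v))\<bar> \<le> e * norm (x - y) * norm v"
          proof (rule avg)
            fix h assume h: "h \<in> G"
            have "\<bar>(D (perm_act h x) - D (perm_act h y)) (perm_act h v)\<bar> \<le> norm (D (perm_act h x) - D (perm_act h y)) * norm v"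
              using norm_blinfun[of "D (perm_act h x) - D (perm_act h y)" "perm_act h v"] norm_perm_act[OF Gp(1)[OF h], of v] by simp
            also have "norm (D (perm_act h x) - D (perm_act h y)) \<le> e * norm (x - y)"
              using Dlip[OF Gball[OF h x] Gball[OF h y]] dist_perm_act[OF Gp(1)[OF h], of x y] by (simp add: dist_norm)
            finally show "\<bar>(D (perm_act h x) - D (perm_act h y)) (perm_act h v)\<bar> \<le> e * norm (x - y) * norm v"
              by (simp add: mult_right_mono)
          qed
          then show ?thesis
            unfolding dd[OF x] dd[OF y] by (simp add: blinfun.diff_left sum_subtractf diff_divide_distrib)
        qed
      qed
      have Xb: "norm (block_proj c X - diag_mat c) < r" using X by (simp add: W_def)
      have "norm ((F1 m X - F1 n X) H) \<le> e * B * norm H" for H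
      proof -
        have "\<bar>(F1 m X - F1 n X) H\<bar> \<le> e * norm (block_proj c H)"
          using Q1_bound[OF block_proj_in_block_sym Xb block_proj_in_block_sym, of H]
          by (simp add: blinfun.diff_left F1P[of _ X H, symmetric])
        also have "\<dots> \<le> e * (B * norm H)" using e B(2) by (intro mult_left_mono) auto
        finally show ?thesis by (simp add: mult.assoc)
      qed
      then have 1: "norm (F1 m X - F1 n X) \<le> e * B" using e B(1) by (intro norm_blinfun_bound) auto
      have "norm ((F2 m X - F2 n X) K H) \<le> C * e * B * B * norm K * norm H" for K H
      proof -
        have "\<bar>(F2 m X - F2 n X) K H\<bar> \<le> C * e * norm (block_proj c K) * norm (block_proj c H)"
          using Q2_bound[OF block_proj_in_block_sym Xb block_proj_in_block_sym block_proj_in_block_sym, of K H]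
          by (simp add: blinfun.diff_left F2P[of _ X K H, symmetric] C_def)
        also have "\<dots> \<le> C * e * (B * norm K) * (B * norm H)"
          using e C B by (intro mult_mono mult_nonneg_nonneg) auto
        finally show ?thesis by (simp add: mult_ac)
      qed
      then have "norm ((F2 m X - F2 n X) K) \<le> C * e * B * B * norm K" for K
        by (rule norm_blinfun_bound[rotated]) (use e B(1) C in auto)
      then have "norm (F2 m X - F2 n X) \<le> C * e * B * B"
        by (rule norm_blinfun_bound[rotated]) (use e B(1) C in auto)
      with 1 show ?thesis by blast
    qed
    then show ?thesis by blast
  qed
  have uc1: "uniformly_Cauchy_on W F1"
  proof (unfold uniformly_Cauchy_on_def, intro allI impI)
    fix e :: real assume e: "e > 0"
    \<comment> \<open>\<open>key\<close> yields non-strict bounds; the factor 2 leaves room for the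
      strict inequality of uniform Cauchy sequences.\<close>
    then have e': "e / (2 * B) > 0" using B by simp
    obtain M where "\<forall>m\<ge>M. \<forall>n\<ge>M. \<forall>X\<in>W. norm (F1 m X - F1 n X) \<le> e / (2 * B) * B" using key[OF e'] by blast
    moreover have "e / (2 * B) * B < e" using e B by simp
    ultimately show "\<exists>M. \<forall>x\<in>W. \<forall>m\<ge>M. \<forall>n\<ge>M. dist (F1 m x) (F1 n x) < e"
      unfolding dist_norm by (meson le_less_trans)
  qed
  have uc2: "uniformly_Cauchy_on W F2"
  proof (unfold uniformly_Cauchy_on_def, intro allI impI)
    fix e :: real assume e: "e > 0"
    then have e': "e / (2 * C * B * B) > 0" using B C by simp
    obtain M where "\<forall>m\<ge>M. \<forall>n\<ge>M. \<forall>X\<in>W. norm (F2 m X - F2 n X) \<le> C * (e / (2 * C * B * B)) * B * B" using key[OF e'] by blast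
    moreover have "C * (e / (2 * C * B * B)) * B * B < e" using e B C by simp
    ultimately show "\<exists>M. \<forall>x\<in>W. \<forall>m\<ge>M. \<forall>n\<ge>M. dist (F2 m x) (F2 n x) < e"
      unfolding dist_norm by (meson le_less_trans)
  qed
  have plim: "(\<lambda>k. 1 / N * (\<Sum>h\<in>G. p k (perm_act h y))) \<longlonglongrightarrow> g y" if y: "y \<in> ball c r" for y
  proof -
    have "(\<lambda>k. 1 / N * (\<Sum>h\<in>G. p k (perm_act h y))) \<longlonglongrightarrow> 1 / N * (\<Sum>h\<in>G. g (perm_act h y))"
      by (intro tendsto_intros tendsto_uniform_limitI[OF u0] Gball y)
    moreover have "1 / N * (\<Sum>h\<in>G. g (perm_act h y)) = g y"
      using sym N id_in_perm_stab[of c] by (auto simp: G_def N_def)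
    ultimately show ?thesis by simp
  qed
  have lim: "(\<lambda>k. f k X) \<longlonglongrightarrow> g (lam (block_proj c X))" if X: "X \<in> W" for X
  proof -
    obtain U where U: "U \<in> block_orth c" "block_proj c X = U ** diag_mat (lam (block_proj c X)) ** transpose U"
      using lam[OF block_proj_in_block_sym] by blast
    have "norm (block_proj c X - diag_mat c) = norm (lam (block_proj c X) - c)"
      using norm_conj_diag[OF U(1), of "lam (block_proj c X)"] U(2) by simp
    then have y: "lam (block_proj c X) \<in> ball c r" using X by (simp add: W_def dist_norm norm_minus_commute)
    have "f k X = 1 / N * (\<Sum>h\<in>G. p k (perm_act h (lam (block_proj c X))))" for k
      using fb[of k X] f[OF U(1), of k "lam (block_proj c X)"] U(2) by simp
    then show ?thesis using plim[OF y] by simp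
  qed
  have We: "W = block_proj c -` ball (diag_mat c) r" by (auto simp: W_def dist_norm norm_minus_commute)
  have "open W" unfolding We by (intro open_vimage open_ball linear_continuous_on bounded_linear_block_proj)
  moreover have "convex W" unfolding We by (intro convex_linear_vimage bounded_linear.linear bounded_linear_block_proj convex_ball)
  ultimately show "C2_on {X. norm (block_proj c X - diag_mat c) < r} (\<lambda>X. g (lam (block_proj c X)))"
    unfolding W_def[symmetric]
    by (rule C2_on_limit[OF _ _ F1 F2 continuous_on_subset[OF cF2 subset_UNIV] uc1 uc2 lim])
  show "g (lam (diag_mat x)) = g x" if x: "x \<in> ball c r"
  proof -
    have b: "block_proj c (diag_mat x) = diag_mat x" by (rule block_proj_block_sym[OF diag_mat_in_block_sym])
    have "norm (diag_mat x - diag_mat c) = norm (x - c)"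
      by (simp add: linear_diff[OF linear_diag_mat, symmetric] norm_diag_mat)
    then have "diag_mat x \<in> W" using x by (simp add: W_def b dist_norm norm_minus_commute)
    from lim[OF this] have "(\<lambda>k. f k (diag_mat x)) \<longlonglongrightarrow> g (lam (diag_mat x))" by (simp add: b)
    moreover have "(\<lambda>k. f k (diag_mat x)) \<longlonglongrightarrow> g x" using plim[OF x] by (simp add: fd)
    ultimately show ?thesis by (rule LIMSEQ_unique)
  qed
qed

section \<open>A twice continuously differentiable cutoff\<close>

lemma pos_part_power_has_derivative:
  "((\<lambda>t :: real. max 0 t ^ Suc (Suc k)) has_real_derivative real (Suc (Suc k)) * max 0 t ^ Suc k) (at t)"
proof -
  consider "t > 0" | "t < 0" | "t = 0" by linarith
  then show ?thesis
  proof cases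
    case 1
    have "((\<lambda>t :: real. t ^ Suc (Suc k)) has_real_derivative real (Suc (Suc k)) * t ^ Suc k) (at t)"
      using DERIV_pow[of "Suc (Suc k)" t] by simp
    from has_field_derivative_transform_within_open[OF this, of "{0<..}" "\<lambda>t. max 0 t ^ Suc (Suc k)"] 1
    show ?thesis by (auto simp: max_def)
  next
    case 2
    have "((\<lambda>t :: real. 0) has_real_derivative 0) (at t)" by simp
    from has_field_derivative_transform_within_open[OF this, of "{..<0}" "\<lambda>t. max 0 t ^ Suc (Suc k)"] 2
    show ?thesis by (auto simp: max_def)
  next
    case 3
    have "((\<lambda>h :: real. max 0 h ^ Suc (Suc k) / h) \<longlongrightarrow> 0) (at 0)"
    proof (rule Lim_null_comparison)
      have "norm (max 0 h ^ Suc (Suc k) / h) \<le> \<bar>h\<bar> ^ Suc k" for h :: real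
      proof (cases "h > 0")
        case False
        then have *: "max 0 h ^ Suc (Suc k) = 0" by simp
        show ?thesis unfolding * by (simp del: power_Suc)
      qed (simp add: max_def)
      then show "\<forall>\<^sub>F h :: real in at 0. norm (max 0 h ^ Suc (Suc k) / h) \<le> \<bar>h\<bar> ^ Suc k" by simp
      have "((\<lambda>h :: real. \<bar>h\<bar> ^ Suc k) \<longlongrightarrow> \<bar>0\<bar> ^ Suc k) (at 0)" by (intro tendsto_intros)
      then show "((\<lambda>h :: real. \<bar>h\<bar> ^ Suc k) \<longlongrightarrow> 0) (at 0)" by simp
    qed
    then show ?thesis using 3 by (simp add: has_field_derivative_iff)
  qed
qed

text \<open>The third power makes the positive part C2. The function is positive in the open ball,
  so multiplying by it keeps zero sets there; it equals 1 at the centre, and it depends only on the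
  distance to \<open>c\<close>, so the stabiliser of \<open>c\<close> preserves it.\<close>

definition cutoff :: "'a::euclidean_space \<Rightarrow> real \<Rightarrow> 'a \<Rightarrow> real" where
  "cutoff c r z = max 0 (1 - ((z - c) \<bullet> (z - c)) / r\<^sup>2) ^ 3"

lemma C2_on_cutoff: "C2_on U (cutoff c r)"
  unfolding cutoff_def[abs_def]
proof (rule C2_on_compose_real[where f="\<lambda>z. 1 - ((z - c) \<bullet> (z - c)) / r\<^sup>2" and g="\<lambda>t. max 0 t ^ 3"
      and ?g1.0="\<lambda>t. 3 * max 0 t ^ 2" and ?g2.0="\<lambda>t. 3 * (2 * max 0 t)"])
  have "real_polynomial_function (\<lambda>z :: 'a. (z - c) \<bullet> b)" for b
    unfolding inner_diff_left
    by (intro real_polynomial_function_diff real_polynomial_function.intros(1,2) bounded_linear_inner_left)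
  then have "real_polynomial_function (\<lambda>z. 1 - (\<Sum>b\<in>Basis. ((z - c) \<bullet> b) * ((z - c) \<bullet> b)) / r\<^sup>2)"
    by (intro real_polynomial_function_diff real_polynomial_function.intros(2,4) real_polynomial_function_divide
        real_polynomial_function_sum) auto
  moreover have sq: "(z - c) \<bullet> (z - c) = (\<Sum>b\<in>Basis. ((z - c) \<bullet> b) * ((z - c) \<bullet> b))" for z
    by (rule euclidean_inner)
  ultimately show "C2_on U (\<lambda>z. 1 - ((z - c) \<bullet> (z - c)) / r\<^sup>2)"
    unfolding sq by (intro C2_on_real_polynomial_function)
  show "((\<lambda>t. max 0 t ^ 3) has_real_derivative 3 * max 0 t ^ 2) (at t)" for t :: real
    using pos_part_power_has_derivative[of 1 t] by (simp add: numeral_3_eq_3 numeral_2_eq_2)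
  have "((\<lambda>t. max 0 t ^ 2) has_real_derivative 2 * max 0 t) (at t)" for t :: real
    using pos_part_power_has_derivative[of 0 t] by (simp add: numeral_2_eq_2)
  then show "((\<lambda>t. 3 * max 0 t ^ 2) has_real_derivative 3 * (2 * max 0 t)) (at t)" for t :: real
    by (rule DERIV_cmult)
  show "continuous_on UNIV (\<lambda>t :: real. 3 * (2 * max 0 t))" by (intro continuous_intros)
qed

lemma inner_diff_self_dist: "(z - c) \<bullet> (z - c) = (dist c z)\<^sup>2"
  by (subst dist_commute) (simp add: dist_norm power2_norm_eq_inner)

lemma cutoff_eq_0_iff: "r > 0 \<Longrightarrow> cutoff c r z = 0 \<longleftrightarrow> r \<le> dist c z"
proof -
  assume r: "r > 0"
  have "r\<^sup>2 \<le> (dist c z)\<^sup>2 \<longleftrightarrow> r \<le> dist c z"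
    using r by (simp add: power_mono_iff)
  then show ?thesis using r by (auto simp: cutoff_def inner_diff_self_dist max_def field_simps)
qed

text \<open>The product is C2 on \<open>ball c r\<close> and vanishes outside
  \<open>cball c s\<close>; because \<open>s < r\<close> these two open regions cover the
  space.\<close>

lemma C2_on_cutoff_extension:
  fixes F :: "'a::euclidean_space \<Rightarrow> real"
  assumes F: "C2_on (ball c r) F" and r: "0 < s" "s < r"
  shows "C2_on UNIV (\<lambda>z. if z \<in> ball c r then F z * cutoff c s z else 0)" (is "C2_on UNIV ?g")
proof -
  have "C2_on (ball c r) ?g"
    by (rule C2_on_cong[OF open_ball _ C2_on_mult[OF F C2_on_cutoff]]) auto
  moreover have "C2_on (- cball c s) ?g"
    by (rule C2_on_cong[OF _ _ C2_on_const[of _ 0]]) (use r in \<open>auto simp: cutoff_eq_0_iff\<close>)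
  ultimately have "C2_on (ball c r \<union> - cball c s) ?g" by (intro C2_on_Un) auto
  moreover have "ball c r \<union> - cball c s = UNIV" using r by auto
  ultimately show ?thesis by simp
qed

section \<open>Orbits as level sets, and the assembly of the theorem\<close>

lemma Delta_orb:
  assumes "x \<in> Delta \<sigma>"
  shows "orb \<sigma> i = {j. x $ j = x $ i}"
proof -
  have "orb \<sigma> i \<in> Pvec x" using assms by (auto simp: Delta_def Psig_def)
  then obtain a where a: "orb \<sigma> i = {j. x $ j = x $ a}" by (auto simp: Pvec_def)
  have "i = (\<sigma> ^^ 0) i" by simp
  then have "i \<in> orb \<sigma> i" unfolding orb_def by blast
  then show ?thesis using a by simp
qed

lemma Ssig_eq_block_sym:
  assumes "\<And>i. orb \<sigma> i = {j. c $ j = c $ i}"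
  shows "Ssig \<sigma> = block_sym c"
proof (intro equalityI subsetI)
  fix X assume "X \<in> Ssig \<sigma>"
  then show "X \<in> block_sym c" by (intro block_symI) (auto simp: Ssig_def assms)
next
  fix X assume X: "X \<in> block_sym c"
  show "X \<in> Ssig \<sigma>" unfolding Ssig_def using block_symD[OF X] by (auto simp: assms)
qed

theorem theorem4p9:
  fixes M :: "(real^('n::{finite,linorder})) set" and d :: nat
    and \<sigma> :: "('n::{finite,linorder}) \<Rightarrow> ('n::{finite,linorder})"
    and xbar :: "real^('n::{finite,linorder})"
  assumes "loc_sym_C2_submanifold M d"
    and "\<exists>y\<in>M. \<exists>\<rho>>0. \<forall>z\<in>M \<inter> ball y \<rho>. \<forall>i j. i \<noteq> j \<longrightarrow> z $ i \<noteq> z $ j"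
    and "\<sigma> permutes UNIV"
    and "xbar \<in> M \<inter> Rge \<inter> Delta \<sigma>"
  shows "\<forall>Xbar\<in>Ssig \<sigma>. lambda_sig \<sigma> Xbar = xbar \<longrightarrow>
           C2_submanifold_around (Ssig \<sigma>) {X \<in> Ssig \<sigma>. lambda_sig \<sigma> X \<in> M} Xbar (CARD('n) - d)"
proof (intro ballI impI)
  fix Xbar assume Xbar: "Xbar \<in> Ssig \<sigma>" "lambda_sig \<sigma> Xbar = xbar"
  let ?k = "CARD('n) - d" and ?lam = "lambda_sig \<sigma>"
  have xM: "xbar \<in> M" and orb: "\<And>i. orb \<sigma> i = {j. xbar $ j = xbar $ i}"
    using assms(4) Delta_orb by blast+
  note S = Ssig_eq_block_sym[OF orb]
  have lam: "\<exists>U\<in>block_orth xbar. Z = U ** diag_mat (?lam Z) ** transpose U" if Z: "Z \<in> block_sym xbar" for Z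
  proof -
    obtain U y where U: "U \<in> block_orth xbar" "Z = U ** diag_mat y ** transpose U"
      and y: "\<And>i j. i \<le> j \<Longrightarrow> xbar $ i = xbar $ j \<Longrightarrow> y $ j \<le> y $ i"
      using block_spectral[OF Z] by blast
    have "?lam Z = y" unfolding U(2) by (rule lambda_sig_conj_diag[OF orb U(1) y])
    then show ?thesis using U by blast
  qed
  have lam_dist: "dist xbar (?lam Z) = norm (Z - diag_mat xbar)" if Z: "Z \<in> block_sym xbar" for Z
  proof -
    obtain U where "U \<in> block_orth xbar" "Z = U ** diag_mat (?lam Z) ** transpose U" using lam[OF Z] by blast
    then have "norm (Z - diag_mat xbar) = norm (?lam Z - xbar)" using norm_conj_diag by metis
    then show ?thesis by (simp add: dist_norm norm_minus_commute)
  qed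
  \<comment> \<open>\<open>lam_dist\<close> with distance 0: on each block \<open>xbar\<close> is
    constant, so a matrix with these eigenvalues must be scalar there.\<close>
  have Xb: "Xbar = diag_mat xbar" using lam_dist[of Xbar] Xbar by (simp add: S)
  obtain r F DF where r: "r > 0" and F: "\<And>i. i < ?k \<Longrightarrow> C2_on (ball xbar r) (F i)"
    and DF: "\<And>i. i < ?k \<Longrightarrow> (F i has_derivative DF i) (at xbar)"
    and surj: "\<forall>w::nat \<Rightarrow> real. \<exists>v. \<forall>i<?k. DF i v = w i"
    and MF: "\<And>z. z \<in> ball xbar r \<Longrightarrow> z \<in> M \<longleftrightarrow> (\<forall>i<?k. F i z = 0)"
    and Fsym: "\<And>i g z. i < ?k \<Longrightarrow> g permutes UNIV \<Longrightarrow> perm_act g xbar = xbar \<Longrightarrow> F i (perm_act g z) = F i z"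
    using symmetric_local_equations[OF assms(1,2) xM] by blast
  define s where "s = r / 2"
  have s: "0 < s" "s < r" using r by (auto simp: s_def)
  define g where "g i z = (if z \<in> ball xbar r then F i z * cutoff xbar s z else 0)" for i z
  have gC2: "C2_on UNIV (g i)" if "i < ?k" for i
    unfolding g_def using C2_on_cutoff_extension[OF F[OF that] s] .
  have gsupp: "g i z = 0" if "z \<notin> cball xbar s" for i z
    using that s by (auto simp: g_def cutoff_eq_0_iff)
  have gsym: "g i (perm_act h z) = g i z" if i: "i < ?k" and h: "h \<in> perm_stab xbar" for i h z
  proof -
    have hp: "h permutes UNIV" "perm_act h xbar = xbar" using h by (auto simp: perm_stab_def)
    have dd: "dist xbar (perm_act h z) = dist xbar z" using dist_perm_act[OF hp(1), of xbar z] hp(2) by simp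
    then show ?thesis using Fsym[OF i hp] by (simp add: g_def cutoff_def inner_diff_self_dist)
  qed
  have gzero: "g i z = 0 \<longleftrightarrow> F i z = 0" if "z \<in> ball xbar s" for i z
    using that s by (auto simp: g_def cutoff_eq_0_iff)
  have gDF: "(g i has_derivative DF i) (at xbar)" if i: "i < ?k" for i
  proof -
    obtain D where D: "(cutoff xbar s has_derivative D) (at xbar)"
      using C2_on_cutoff[of UNIV xbar s] unfolding C2_on_def by blast
    \<comment> \<open>As \<open>F i\<close> vanishes at \<open>xbar\<close>, the derivative of the
      cutoff drops out of the product rule, and the value 1 of the cutoff leaves \<open>DF i\<close>
      unchanged.\<close>
    have "F i xbar = 0" using MF[of xbar] r xM i by simp
    moreover have "cutoff xbar s xbar = 1" by (simp add: cutoff_def)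
    ultimately have "((\<lambda>z. F i z * cutoff xbar s z) has_derivative DF i) (at xbar)"
      using has_derivative_mult[OF DF[OF i] D] by simp
    then show ?thesis
      by (rule has_derivative_transform_within_open[OF _ open_ball[of xbar r]]) (use r in \<open>auto simp: g_def\<close>)
  qed
  define Fh where "Fh i X = g i (?lam (block_proj xbar X))" for i X
  define W where "W = {X. norm (block_proj xbar X - diag_mat xbar) < s}"
  have FhC2: "C2_on W (Fh i)" if "i < ?k" for i
    unfolding Fh_def W_def by (rule spectral_lift_C2(1)[OF gC2[OF that] gsupp s(1) gsym[OF that] lam])
  have XW: "Xbar \<in> W" using s by (simp add: W_def Xb block_proj_block_sym[OF diag_mat_in_block_sym])
  have "\<forall>i. \<exists>D. i < ?k \<longrightarrow> (Fh i has_derivative D) (at Xbar)"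
    using FhC2 XW unfolding C2_on_def by blast
  from choice[OF this] obtain DFh where DFh: "\<And>i. i < ?k \<Longrightarrow> (Fh i has_derivative DFh i) (at Xbar)" by blast
  \<comment> \<open>The lifted equation restricts to \<open>g i\<close> on diagonal matrices near
    \<open>Xbar\<close>. Hence the differentials \<open>DFh i\<close> reach every right-hand side
    already on diagonal matrices, which gives the codimension.\<close>
  have DFh_diag: "DFh i (diag_mat v) = DF i v" if i: "i < ?k" for i v
  proof -
    have "((\<lambda>x. Fh i (diag_mat x)) has_derivative (\<lambda>v. DFh i (diag_mat v))) (at xbar)"
      by (rule has_derivative_compose[OF linear_imp_has_derivative[OF linear_diag_mat]])
        (use DFh[OF i] Xb in simp)
    moreover have "Fh i (diag_mat x) = g i x" if "x \<in> ball xbar s" for x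
      using spectral_lift_C2(2)[OF gC2[OF i] gsupp s(1) gsym[OF i] lam that]
      by (simp add: Fh_def block_proj_block_sym[OF diag_mat_in_block_sym])
    moreover have "xbar \<in> ball xbar s" using s by simp
    ultimately have "(g i has_derivative (\<lambda>v. DFh i (diag_mat v))) (at xbar)"
      using has_derivative_transform_within_open[OF _ open_ball] by blast
    from fun_cong[OF has_derivative_unique[OF this gDF[OF i]]] show ?thesis .
  qed
  show "C2_submanifold_around (Ssig \<sigma>) {X \<in> Ssig \<sigma>. ?lam X \<in> M} Xbar ?k"
    unfolding C2_submanifold_around_def
  proof (intro conjI, goal_cases)
    case 3
    show ?case
    proof (rule exI[of _ W], rule exI[of _ Fh], rule exI[of _ DFh], intro conjI)
      have We: "W = block_proj xbar -` ball (diag_mat xbar) s" by (auto simp: W_def dist_norm norm_minus_commute)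
      show "open W" unfolding We by (intro open_vimage open_ball linear_continuous_on bounded_linear_block_proj)
      show "\<forall>w :: nat \<Rightarrow> real. \<exists>v\<in>Ssig \<sigma>. \<forall>i<?k. DFh i v = w i"
      proof
        fix w :: "nat \<Rightarrow> real"
        obtain v where "\<forall>i<?k. DF i v = w i" using surj by blast
        then show "\<exists>v\<in>Ssig \<sigma>. \<forall>i<?k. DFh i v = w i"
          by (intro bexI[of _ "diag_mat v"]) (auto simp: DFh_diag S diag_mat_in_block_sym)
      qed
      show "{X \<in> Ssig \<sigma>. ?lam X \<in> M} \<inter> W = {z \<in> Ssig \<sigma> \<inter> W. \<forall>i<?k. Fh i z = 0}"
      proof -
        have "?lam X \<in> M \<longleftrightarrow> (\<forall>i<?k. Fh i X = 0)" if X: "X \<in> block_sym xbar" "X \<in> W" for X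
        proof -
          have b: "block_proj xbar X = X" by (rule block_proj_block_sym[OF X(1)])
          \<comment> \<open>\<open>lambda_sig\<close> preserves the distance to the centre, so
            \<open>W\<close> was chosen to land exactly in the ball where the equations describe
            \<open>M\<close> and the cutoff is positive.\<close>
          have "?lam X \<in> ball xbar s" using lam_dist[OF X(1)] X(2) by (simp add: W_def b)
          then show ?thesis using MF[of "?lam X"] gzero[of "?lam X"] s by (simp add: Fh_def b)
        qed
        then show ?thesis unfolding S by blast
      qed
    qed (use XW FhC2 DFh in auto)
  qed (use Xbar xM in auto)
qed

end
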